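(* Let $M$ be a closed manifold and let $f\in\operatorname{Diff}^1(M)$ have, for every $n\in\mathbb{N}^+$, only finitely many periodic points of period $n$. If there is a neighborhood $\mathcal{U}\subset\operatorname{Diff}^1(M)$ of $f$ such that $$\sup\left\{\|Dh^{n_{q,h}}(q)\| : h\in\mathcal{U},\ q\in\operatorname{Per}^*(h)\right\}<\infty,$$ then $f$ has finitely many periodic points.
   Context: A closed manifold is a compact connected boundaryless manifold $M$ with $\dim(M)\ge 2$, equipped with a Riemannian metric inducing norms $\|\cdot\|$ on tangent spaces and on linear maps between them. $\operatorname{Diff}^1(M)$ is the space of $C^1$ diffeomorphisms of $M$ with the $C^1$ topology. $\mathbb{N}^+$ denotes the positive integers. A point $p$ is periodic for $h\in\operatorname{Diff}^1(M)$ if $h^n(p)=p$ for some positive integer $n$; the least such $n$ is the period $n_{p,h}$ of $p$. The eigenvalues of a periodic point $p$ are the eigenvalues of $Dh^{n_{p,h}}(p):T_pM\to T_pM$. A periodic point is a sink if all its eigenvalues have modulus less than $1$. $\operatorname{Per}^*(h)$ denotes the set of periodic points of $h$ which are not sinks, i.e., with at least one eigenvalue of modulus bigger than or equal to $1$. *)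

theory Defs
  imports "HOL-Analysis.Analysis"
begin

section \<open>Differentiability classes on open subsets of Euclidean spaces\<close>

primrec Ck_on :: "nat \<Rightarrow> 'b::euclidean_space set \<Rightarrow> ('b \<Rightarrow> 'c::real_normed_vector) \<Rightarrow> bool" where
  "Ck_on 0 S F \<longleftrightarrow> continuous_on S F"
| "Ck_on (Suc k) S F \<longleftrightarrow>
     (\<exists>F'. (\<forall>x\<in>S. (F has_derivative F' x) (at x)) \<and> (\<forall>v. Ck_on k S (\<lambda>x. F' x v)))"

definition smooth_on :: "'b::euclidean_space set \<Rightarrow> ('b \<Rightarrow> 'c::real_normed_vector) \<Rightarrow> bool" where
  "smooth_on S F \<longleftrightarrow> (\<forall>k. Ck_on k S F)"


section \<open>Closed manifolds\<close>

text \<open>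
  The manifold is the whole type \<open>'a\<close>, modelled on \<open>'b\<close> (so its dimension is \<open>DIM('b)\<close>).
  The atlas need not be maximal: it only serves to determine the smooth structure.
\<close>

type_synonym ('a, 'b) chart = "'a set \<times> ('a \<Rightarrow> 'b)"

abbreviation chart_dom :: "('a, 'b) chart \<Rightarrow> 'a set" where
  "chart_dom c \<equiv> fst c"

abbreviation chart_map :: "('a, 'b) chart \<Rightarrow> 'a \<Rightarrow> 'b" where
  "chart_map c \<equiv> snd c"

definition chart_inv :: "('a, 'b) chart \<Rightarrow> 'b \<Rightarrow> 'a" where
  "chart_inv c = inv_into (chart_dom c) (chart_map c)"

definition charts_at :: "('a, 'b) chart set \<Rightarrow> 'a \<Rightarrow> ('a, 'b) chart set" where
  "charts_at A p = {c \<in> A. p \<in> chart_dom c}"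

definition smooth_atlas ::
    "('a::topological_space, 'b::euclidean_space) chart set \<Rightarrow> bool" where
  "smooth_atlas A \<longleftrightarrow>
     (\<forall>c\<in>A. open (chart_dom c) \<and> open (chart_map c ` chart_dom c) \<and>
        homeomorphism (chart_dom c) (chart_map c ` chart_dom c) (chart_map c) (chart_inv c)) \<and>
     (\<Union>c\<in>A. chart_dom c) = UNIV \<and>
     (\<forall>c\<in>A. \<forall>d\<in>A. smooth_on (chart_map c ` (chart_dom c \<inter> chart_dom d))
        (chart_map d \<circ> chart_inv c))"

definition closed_manifold ::
    "('a::{t2_space, second_countable_topology}, 'b::euclidean_space) chart set \<Rightarrow> bool" where
  "closed_manifold A \<longleftrightarrow>
     smooth_atlas A \<and> compact (UNIV :: 'a set) \<and> connected (UNIV :: 'a set) \<and> DIM('b) \<ge> 2"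


section \<open>Tangent vectors, derivatives and Riemannian metrics\<close>

text \<open>
  A tangent vector at \<open>p\<close> is the family of its coordinate vectors in all charts around \<open>p\<close>,
  related by the derivatives of the coordinate changes. The value at every other chart is \<open>0\<close>,
  so that the vector space operations on the tangent space are the pointwise ones.
\<close>

type_synonym ('a, 'b) tangent = "('a, 'b) chart \<Rightarrow> 'b"

definition tangent_space ::
    "('a, 'b::euclidean_space) chart set \<Rightarrow> 'a \<Rightarrow> ('a, 'b) tangent set" where
  "tangent_space A p = {v.
     (\<forall>c. c \<notin> charts_at A p \<longrightarrow> v c = 0) \<and>
     (\<forall>c\<in>charts_at A p. \<forall>d\<in>charts_at A p.
        v d = frechet_derivative (chart_map d \<circ> chart_inv c) (at (chart_map c p)) (v c))}"

text \<open>The tangent vector at \<open>p\<close> whose coordinate vector in the chart \<open>c\<close> is \<open>x\<close>.\<close>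

definition tangent_of_coords ::
    "('a, 'b::euclidean_space) chart set \<Rightarrow> 'a \<Rightarrow> ('a, 'b) chart \<Rightarrow> 'b \<Rightarrow> ('a, 'b) tangent" where
  "tangent_of_coords A p c x = (\<lambda>d. if d \<in> charts_at A p
     then frechet_derivative (chart_map d \<circ> chart_inv c) (at (chart_map c p)) x else 0)"

definition C1_map ::
    "('a::topological_space, 'b::euclidean_space) chart set \<Rightarrow> ('a \<Rightarrow> 'a) \<Rightarrow> bool" where
  "C1_map A h \<longleftrightarrow> continuous_on UNIV h \<and>
     (\<forall>c\<in>A. \<forall>d\<in>A. Ck_on 1 (chart_map c ` (chart_dom c \<inter> h -` chart_dom d))
        (chart_map d \<circ> h \<circ> chart_inv c))"

text \<open>
  The derivative \<open>Dh(p)\<close>, mapping the tangent space at \<open>p\<close> to the one at \<open>h p\<close>. For a \<open>C1_map\<close>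
  the chain rule makes its coordinate expressions agree for all pairs of charts.
\<close>

definition tangent_map ::
    "('a, 'b::euclidean_space) chart set \<Rightarrow> ('a \<Rightarrow> 'a) \<Rightarrow> 'a \<Rightarrow> ('a, 'b) tangent \<Rightarrow> ('a, 'b) tangent"
  where
  "tangent_map A h p v = (THE w. w \<in> tangent_space A (h p) \<and>
     (\<forall>c\<in>charts_at A p. \<forall>d\<in>charts_at A (h p).
        w d = frechet_derivative (chart_map d \<circ> h \<circ> chart_inv c) (at (chart_map c p)) (v c)))"

definition riemannian_metric ::
    "('a, 'b::euclidean_space) chart set
      \<Rightarrow> ('a \<Rightarrow> ('a, 'b) tangent \<Rightarrow> ('a, 'b) tangent \<Rightarrow> real) \<Rightarrow> bool" where
  "riemannian_metric A g \<longleftrightarrow>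
     (\<forall>p. \<forall>u\<in>tangent_space A p. \<forall>v\<in>tangent_space A p. g p u v = g p v u) \<and>
     (\<forall>p. \<forall>u\<in>tangent_space A p. \<forall>v\<in>tangent_space A p. \<forall>w\<in>tangent_space A p. \<forall>a b.
        g p (\<lambda>c. a *\<^sub>R u c + b *\<^sub>R v c) w = a * g p u w + b * g p v w) \<and>
     (\<forall>p. \<forall>u\<in>tangent_space A p. u \<noteq> (\<lambda>c. 0) \<longrightarrow> g p u u > 0) \<and>
     (\<forall>c\<in>A. \<forall>x y. smooth_on (chart_map c ` chart_dom c)
        (\<lambda>z. g (chart_inv c z) (tangent_of_coords A (chart_inv c z) c x)
                               (tangent_of_coords A (chart_inv c z) c y)))"

definition tangent_norm ::
    "('a \<Rightarrow> ('a, 'b) tangent \<Rightarrow> ('a, 'b) tangent \<Rightarrow> real) \<Rightarrow> 'a \<Rightarrow> ('a, 'b) tangent \<Rightarrow> real" where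
  "tangent_norm g p v = sqrt (g p v v)"

definition tangent_opnorm ::
    "('a, 'b::euclidean_space) chart set \<Rightarrow> ('a \<Rightarrow> ('a, 'b) tangent \<Rightarrow> ('a, 'b) tangent \<Rightarrow> real)
      \<Rightarrow> 'a \<Rightarrow> 'a \<Rightarrow> (('a, 'b) tangent \<Rightarrow> ('a, 'b) tangent) \<Rightarrow> real" where
  "tangent_opnorm A g p q L =
     (SUP v\<in>{v \<in> tangent_space A p. tangent_norm g p v \<le> 1}. tangent_norm g q (L v))"


section \<open>\<open>C\<^sup>1\<close> diffeomorphisms with the \<open>C\<^sup>1\<close> topology\<close>

definition Diff1 ::
    "('a::topological_space, 'b::euclidean_space) chart set \<Rightarrow> ('a \<Rightarrow> 'a) set" where
  "Diff1 A = {h. bij h \<and> C1_map A h \<and> C1_map A (inv h)}"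

text \<open>
  The maps that are \<open>\<epsilon>\<close>-close to \<open>h\<close>, together with their first derivatives, on the compact
  set \<open>K\<close>, in the coordinates \<open>c\<close> (around \<open>K\<close>) and \<open>d\<close> (around \<open>h ` K\<close>). These sets form the
  standard subbasis of the weak (compact-open) \<open>C\<^sup>1\<close> topology.
\<close>

definition C1_subbasic ::
    "('a::topological_space, 'b::euclidean_space) chart set \<Rightarrow> ('a \<Rightarrow> 'a) \<Rightarrow> ('a, 'b) chart
      \<Rightarrow> ('a, 'b) chart \<Rightarrow> 'a set \<Rightarrow> real \<Rightarrow> ('a \<Rightarrow> 'a) set" where
  "C1_subbasic A h c d K \<epsilon> = {k. C1_map A k \<and> k ` K \<subseteq> chart_dom d \<and>
     (\<forall>p\<in>K. norm (chart_map d (k p) - chart_map d (h p)) < \<epsilon> \<and>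
        onorm (\<lambda>x. frechet_derivative (chart_map d \<circ> k \<circ> chart_inv c) (at (chart_map c p)) x
                 - frechet_derivative (chart_map d \<circ> h \<circ> chart_inv c) (at (chart_map c p)) x)
          < \<epsilon>)}"

definition C1_topology ::
    "('a::topological_space, 'b::euclidean_space) chart set \<Rightarrow> ('a \<Rightarrow> 'a) topology" where
  "C1_topology A = topology_generated_by
     {C1_subbasic A h c d K \<epsilon> | h c d K \<epsilon>. C1_map A h \<and> c \<in> A \<and> d \<in> A \<and>
        compact K \<and> K \<subseteq> chart_dom c \<and> h ` K \<subseteq> chart_dom d \<and> \<epsilon> > 0}"

definition Diff1_topology ::
    "('a::topological_space, 'b::euclidean_space) chart set \<Rightarrow> ('a \<Rightarrow> 'a) topology" where
  "Diff1_topology A = subtopology (C1_topology A) (Diff1 A)"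


section \<open>Periodic points and sinks\<close>

definition periodic_points :: "('a \<Rightarrow> 'a) \<Rightarrow> 'a set" where
  "periodic_points h = {p. \<exists>n>0. (h ^^ n) p = p}"

definition period :: "('a \<Rightarrow> 'a) \<Rightarrow> 'a \<Rightarrow> nat" where
  "period h p = (LEAST n. n > 0 \<and> (h ^^ n) p = p)"

definition return_derivative ::
    "('a, 'b::euclidean_space) chart set \<Rightarrow> ('a \<Rightarrow> 'a) \<Rightarrow> 'a \<Rightarrow> ('a, 'b) tangent \<Rightarrow> ('a, 'b) tangent"
  where
  "return_derivative A h p = tangent_map A (h ^^ period h p) p"

text \<open>
  \<open>z\<close> is an eigenvalue of the complexification of the endomorphism \<open>L\<close> of a space \<open>V\<close> of
  tangent vectors: there is \<open>u + \<i> w \<noteq> 0\<close> with \<open>u, w\<close> in \<open>V\<close> and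
  \<open>L u + \<i> L w = z (u + \<i> w)\<close>, written out in real and imaginary parts.
\<close>

definition complex_eigenvalue ::
    "('a, 'b::real_vector) tangent set \<Rightarrow> (('a, 'b) tangent \<Rightarrow> ('a, 'b) tangent) \<Rightarrow> complex \<Rightarrow> bool"
  where
  "complex_eigenvalue V L z \<longleftrightarrow>
     (\<exists>u\<in>V. \<exists>w\<in>V. (u \<noteq> (\<lambda>c. 0) \<or> w \<noteq> (\<lambda>c. 0)) \<and>
        L u = (\<lambda>c. Re z *\<^sub>R u c - Im z *\<^sub>R w c) \<and>
        L w = (\<lambda>c. Im z *\<^sub>R u c + Re z *\<^sub>R w c))"

definition periodic_eigenvalues ::
    "('a, 'b::euclidean_space) chart set \<Rightarrow> ('a \<Rightarrow> 'a) \<Rightarrow> 'a \<Rightarrow> complex set" where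
  "periodic_eigenvalues A h p =
     {z. complex_eigenvalue (tangent_space A p) (return_derivative A h p) z}"

definition sinks :: "('a, 'b::euclidean_space) chart set \<Rightarrow> ('a \<Rightarrow> 'a) \<Rightarrow> 'a set" where
  "sinks A h = {p \<in> periodic_points h. \<forall>z\<in>periodic_eigenvalues A h p. cmod z < 1}"

text \<open>The set \<open>Per\<^sup>*(h)\<close>.\<close>

definition nonsink_periodic_points ::
    "('a, 'b::euclidean_space) chart set \<Rightarrow> ('a \<Rightarrow> 'a) \<Rightarrow> 'a set" where
  "nonsink_periodic_points A h = periodic_points h - sinks A h"

end

theory Submission
  imports Defs "Jordan_Normal_Form.Schur_Decomposition"
begin

text \<open>
  By Franks' lemma, all small perturbations of the derivatives of \<open>f\<close> along a periodic orbit are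
  realised by diffeomorphisms near \<open>f\<close>. By assumption the eigenvalues of the perturbed return maps
  are then bounded by a constant that does not depend on the orbit: for a sink they have modulus
  below \<open>1\<close>, and otherwise they are bounded by the norm. A bound on the eigenvalues bounds the trace,
  and with a rank-one perturbation a bound on the trace gives a bound on the norm. Perturbing by the
  factor \<open>1 + \<epsilon>\<close> at each step improves this to exponential decay of the return maps in the period.
  The norms of perturbed products being almost supermultiplicative, every orbit of large period then
  contains a point from which all perturbed products decay at a uniform rate. Nearby nonlinear orbits
  evolve by such perturbed products, so this point attracts a neighbourhood of uniform size. Two
  periodic points cannot attract one another unless they coincide, so by compactness there are
  finitely many such points, hence finitely many orbits of large period.
\<close>

text \<open>The hypothesis controls whole return maps only. Partial products inside a period may
  grow exponentially with the period, so a contracting return map alone gives no lower bound on the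
  size of a basin of attraction. Choosing a good starting point on the orbit repairs this, and it
  works because every estimate holds for all perturbations of a fixed size at once, with constants
  free of the period. Perturbations are indexed by time and not by orbit point: a nonlinear orbit
  makes a new error at each return, while Franks' lemma is applied to a single turn, where times and
  points correspond. Two devices keep constants from accumulating. Exponential decay is gained at
  rate \<open>1 + \<epsilon>\<close>, but only its square root is kept; the other half absorbs the
  constants once the period is large. The loss \<open>\<epsilon> / (1 + \<epsilon>)\<close> at a
  junction of two products is built into the notion of a stretch with too much growth, so that
  arbitrarily many such stretches can be joined.\<close>

no_notation m_inv (\<open>(\<open>open_block notation=\<open>prefix inv\<close>\<close>inv\<index> _)\<close> [81] 80)
no_notation scalar_prod (infix \<open>\<bullet>\<close> 70)

section \<open>Continuously differentiable maps between Euclidean spaces\<close>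

text \<open>Derivatives are bundled as elements of the normed space of bounded linear maps, so that
  C^1 becomes plain continuity and closeness of derivatives a norm. The value means something only
  where \<open>F\<close> is differentiable.\<close>

definition bderiv :: "('b::euclidean_space \<Rightarrow> 'c::euclidean_space) \<Rightarrow> 'b \<Rightarrow> ('b \<Rightarrow>\<^sub>L 'c)" where
  "bderiv F x = Blinfun (frechet_derivative F (at x))"

lemma frechet_derivative_eq_bderiv:
  "F differentiable (at x) \<Longrightarrow> frechet_derivative F (at x) = blinfun_apply (bderiv F x)"
  unfolding bderiv_def
  by (metis bounded_linear_Blinfun_apply frechet_derivative_works has_derivative_bounded_linear)

lemma has_derivative_bderiv:
  "F differentiable (at x) \<Longrightarrow> (F has_derivative blinfun_apply (bderiv F x)) (at x)"
  by (metis frechet_derivative_eq_bderiv frechet_derivative_works)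

lemma bderiv_eqI: "(F has_derivative blinfun_apply L) (at x) \<Longrightarrow> bderiv F x = L"
  unfolding bderiv_def using frechet_derivative_at by (metis blinfun_apply_inverse)

lemma has_derivative_cong_eventually:
  assumes "\<forall>\<^sub>F y in nhds x. F y = G y"
  shows "(F has_derivative D) (at x) \<longleftrightarrow> (G has_derivative D) (at x)"
proof -
  obtain S where S: "open S" "x \<in> S" "\<And>y. y \<in> S \<Longrightarrow> F y = G y"
    using assms unfolding eventually_nhds by blast
  show ?thesis
    using has_derivative_transform_within_open[OF _ S(1,2), of F D UNIV G]
      has_derivative_transform_within_open[OF _ S(1,2), of G D UNIV F] S(3)
    by (metis S(1,2) has_derivative_transform_within_open)
qed

lemma differentiable_cong_eventually:
  "\<forall>\<^sub>F y in nhds x. F y = G y \<Longrightarrow> F differentiable (at x) \<longleftrightarrow> G differentiable (at x)"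
  unfolding differentiable_def by (simp add: has_derivative_cong_eventually)

lemma bderiv_cong: "\<forall>\<^sub>F y in nhds x. F y = G y \<Longrightarrow> bderiv F x = bderiv G x"
  unfolding bderiv_def frechet_derivative_def by (simp add: has_derivative_cong_eventually)

text \<open>A pointwise form of C^1: differentiability near \<open>x\<close>, continuity of the
  derivative at \<open>x\<close> alone. It composes and localises at a point, so no domains of
  coordinate expressions have to be tracked.\<close>

definition C1_at :: "('b::euclidean_space \<Rightarrow> 'c::euclidean_space) \<Rightarrow> 'b \<Rightarrow> bool" where
  "C1_at F x \<longleftrightarrow> (\<forall>\<^sub>F y in nhds x. F differentiable (at y)) \<and> isCont (bderiv F) x"

lemma C1_at_imp_differentiable: "C1_at F x \<Longrightarrow> F differentiable (at x)"
  unfolding C1_at_def using eventually_nhds_x_imp_x by blast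

lemma C1_at_imp_isCont: "C1_at F x \<Longrightarrow> isCont F x"
  using C1_at_imp_differentiable differentiable_imp_continuous_within by blast

lemma C1_at_imp_isCont_bderiv: "C1_at F x \<Longrightarrow> isCont (bderiv F) x"
  by (simp add: C1_at_def)

lemma C1_atI:
  assumes "\<forall>\<^sub>F y in nhds x. (F has_derivative blinfun_apply (F' y)) (at y)" and "isCont F' x"
  shows "C1_at F x"
proof -
  have "\<forall>\<^sub>F y in nhds x. bderiv F y = F' y"
    using assms(1) by (rule eventually_mono) (rule bderiv_eqI)
  then show ?thesis
    unfolding C1_at_def using assms isCont_cong[of "bderiv F" F' x]
    by (auto simp: differentiable_def elim: eventually_mono)
qed

lemma C1_at_cong:
  assumes "\<forall>\<^sub>F y in nhds x. F y = G y" and F: "C1_at F x"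
  shows "C1_at G x"
proof -
  have ev: "\<forall>\<^sub>F y in nhds x. \<forall>\<^sub>F z in nhds y. F z = G z"
    using assms(1) by (simp add: eventually_eventually)
  have "\<forall>\<^sub>F y in nhds x. bderiv F y = bderiv G y"
    using ev by (rule eventually_mono) (rule bderiv_cong)
  moreover have "\<forall>\<^sub>F y in nhds x. G differentiable (at y)"
    using ev F[unfolded C1_at_def, THEN conjunct1]
    by eventually_elim (simp add: differentiable_cong_eventually)
  ultimately show ?thesis
    using F isCont_cong[of "bderiv F" "bderiv G" x] unfolding C1_at_def by auto
qed

lemma bderiv_compose:
  assumes "F differentiable (at x)" "G differentiable (at (F x))"
  shows "bderiv (G \<circ> F) x = bderiv G (F x) o\<^sub>L bderiv F x"
proof (rule bderiv_eqI)
  show "(G \<circ> F has_derivative blinfun_apply (bderiv G (F x) o\<^sub>L bderiv F x)) (at x)"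
    using diff_chain_at[OF has_derivative_bderiv[OF assms(1)] has_derivative_bderiv[OF assms(2)]]
    by (simp add: blinfun_compose.rep_eq comp_def)
qed

lemma C1_at_compose:
  assumes F: "C1_at F x" and G: "C1_at G (F x)"
  shows "C1_at (G \<circ> F) x"
proof (rule C1_atI)
  have "filterlim F (nhds (F x)) (nhds x)"
    using C1_at_imp_isCont[OF F] by (simp add: continuous_at tendsto_at_iff_tendsto_nhds)
  then have "\<forall>\<^sub>F y in nhds x. G differentiable (at (F y))"
    using G unfolding C1_at_def filterlim_iff by blast
  then show "\<forall>\<^sub>F y in nhds x. (G \<circ> F has_derivative
      blinfun_apply (bderiv G (F y) o\<^sub>L bderiv F y)) (at y)"
    using F[unfolded C1_at_def, THEN conjunct1]
  proof eventually_elim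
    case (elim y)
    then show ?case
      using diff_chain_at[OF has_derivative_bderiv has_derivative_bderiv, of F y G]
      by (simp add: blinfun_compose.rep_eq comp_def)
  qed
  show "isCont (\<lambda>y. bderiv G (F y) o\<^sub>L bderiv F y) x"
    using F G by (intro continuous_intros isCont_o2[OF C1_at_imp_isCont[OF F]])
      (auto simp: C1_at_def)
qed

lemma bderiv_id: "bderiv (\<lambda>x. x) x = id_blinfun"
  by (rule bderiv_eqI) (auto intro!: derivative_eq_intros)

lemma blinfun_compose_id_right: "L o\<^sub>L id_blinfun = L"
  by (rule blinfun_eqI) simp

text \<open>\<open>Ck_on\<close> asks for continuity of \<open>F' x v\<close> in \<open>x\<close>
  for each fixed \<open>v\<close>; in finite dimension, continuity on a basis already is continuity
  in operator norm.\<close>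

lemma Ck_on_1_iff:
  fixes F :: "'b::euclidean_space \<Rightarrow> 'c::euclidean_space"
  assumes "open S"
  shows "Ck_on 1 S F \<longleftrightarrow> (\<forall>x\<in>S. C1_at F x)"
proof
  assume "Ck_on 1 S F"
  then obtain F' where D: "\<And>x. x \<in> S \<Longrightarrow> (F has_derivative F' x) (at x)"
    and C: "\<And>v. continuous_on S (\<lambda>x. F' x v)" by auto
  show "\<forall>x\<in>S. C1_at F x"
  proof
    fix x assume x: "x \<in> S"
    have ev: "\<forall>\<^sub>F y in nhds x. y \<in> S" using assms x by (rule eventually_nhds_in_open)
    have eq: "blinfun_apply (bderiv F y) = F' y" if "y \<in> S" for y
      using D[OF that] has_derivative_bderiv has_derivative_unique
      by (metis differentiable_def)
    have "isCont (bderiv F) x"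
    proof (rule continuous_blinfun_componentwiseI1)
      fix i :: 'b
      have "isCont (\<lambda>y. F' y i) x"
        using C[of i] assms x by (simp add: continuous_on_eq_continuous_at)
      moreover have "\<forall>\<^sub>F y in nhds x. F' y i = blinfun_apply (bderiv F y) i"
        using ev by eventually_elim (simp add: eq)
      ultimately show "isCont (\<lambda>y. blinfun_apply (bderiv F y) i) x"
        using isCont_cong[of "\<lambda>y. F' y i" "\<lambda>y. blinfun_apply (bderiv F y) i" x] by simp
    qed
    moreover have "\<forall>\<^sub>F y in nhds x. F differentiable (at y)"
      using ev by eventually_elim (use D differentiable_def in blast)
    ultimately show "C1_at F x" by (simp add: C1_at_def)
  qed
next
  assume C: "\<forall>x\<in>S. C1_at F x"
  have "continuous_on S (\<lambda>x. blinfun_apply (bderiv F x) v)" for v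
    using C by (intro continuous_at_imp_continuous_on ballI continuous_intros)
      (auto simp: C1_at_def)
  then show "Ck_on 1 S F"
    using C has_derivative_bderiv[OF C1_at_imp_differentiable]
    by (auto intro!: exI[of _ "\<lambda>x. blinfun_apply (bderiv F x)"])
qed

text \<open>Mean value inequality for \<open>F z - bderiv F y z\<close>. The remainder estimate is
  uniform in the base point \<open>y\<close>, as linearisation is later done at every point near
  \<open>a\<close> and not at \<open>a\<close> only.\<close>

lemma C1_at_uniform_approx:
  assumes F: "C1_at F a" and "\<eta> > 0"
  shows "\<exists>s>0. \<forall>y\<in>ball a s. norm (bderiv F y - bderiv F a) \<le> \<eta> \<and>
    (\<forall>z\<in>ball a s. norm (F z - F y - bderiv F y (z - y)) \<le> \<eta> * norm (z - y))"
proof -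
  obtain s1 where s1: "s1 > 0" "\<And>y. y \<in> ball a s1 \<Longrightarrow> F differentiable (at y)"
    using F unfolding C1_at_def eventually_nhds_metric by (auto simp: dist_commute)
  \<comment> \<open>Half of \<eta>, as the derivatives at two points of the ball are compared
    through the one at \<open>a\<close>.\<close>
  obtain s2 where s2: "s2 > 0" "\<And>y. y \<in> ball a s2 \<Longrightarrow> norm (bderiv F y - bderiv F a) < \<eta>/2"
    using F \<open>\<eta> > 0\<close> unfolding C1_at_def continuous_at_eps_delta
    by (metis dist_norm half_gt_zero mem_ball dist_commute)
  define s where "s = min s1 s2"
  have near: "norm (bderiv F y - bderiv F a) \<le> \<eta>/2" if "y \<in> ball a s" for y
    using s2(2)[of y] that by (simp add: s_def)
  have "norm (F z - F y - bderiv F y (z - y)) \<le> \<eta> * norm (z - y)"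
    if y: "y \<in> ball a s" and z: "z \<in> ball a s" for y z
  proof -
    have "norm ((F z - bderiv F y z) - (F y - bderiv F y y)) \<le> \<eta> * norm (z - y)"
    proof (rule differentiable_bound[OF convex_ball _ _ z y])
      fix x assume x: "x \<in> ball a s"
      show "((\<lambda>z. F z - bderiv F y z) has_derivative blinfun_apply (bderiv F x - bderiv F y))
          (at x within ball a s)"
        using has_derivative_bderiv[OF s1(2), of x] x
        by (auto simp: s_def blinfun.diff_left fun_diff_def has_derivative_at_withinI
            intro!: derivative_eq_intros)
      have "norm (bderiv F x - bderiv F y) \<le> \<eta>"
        using near[OF x] near[OF y] norm_triangle_ineq4[of "bderiv F x - bderiv F a" "bderiv F y - bderiv F a"]
        by simp
      then show "onorm (blinfun_apply (bderiv F x - bderiv F y)) \<le> \<eta>"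
        by (simp add: norm_blinfun.rep_eq)
    qed
    then show ?thesis by (simp add: blinfun.diff_right algebra_simps)
  qed
  moreover have "s > 0" using s1 s2 by (simp add: s_def)
  ultimately show ?thesis using near \<open>\<eta> > 0\<close> by (intro exI[of _ s]) fastforce
qed

section \<open>Eigenvalues, traces and rank-one perturbations\<close>

definition complexified_eigenvalue :: "('b::euclidean_space \<Rightarrow>\<^sub>L 'b) \<Rightarrow> complex \<Rightarrow> bool" where
  "complexified_eigenvalue L z \<longleftrightarrow> (\<exists>u w. (u \<noteq> 0 \<or> w \<noteq> 0) \<and>
     blinfun_apply L u = Re z *\<^sub>R u - Im z *\<^sub>R w \<and> blinfun_apply L w = Im z *\<^sub>R u + Re z *\<^sub>R w)"

definition blinfun_trace :: "('b::euclidean_space \<Rightarrow>\<^sub>L 'b) \<Rightarrow> real" where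
  "blinfun_trace L = (\<Sum>b\<in>Basis. L b \<bullet> b)"

text \<open>The matrix of \<open>L\<close> is real, so the eigenvector equation splits;
  \<open>u\<close> and \<open>w\<close> have the real and imaginary parts of the entries of
  \<open>v\<close> as coordinates.\<close>

lemma eigenvector_mat_imp_complexified:
  fixes L :: "'b::euclidean_space \<Rightarrow>\<^sub>L 'b" and v :: "complex vec"
  assumes bs: "set bs = (Basis :: 'b set)" "distinct bs" and n: "n = length bs"
    and M: "M = mat n n (\<lambda>(i, j). complex_of_real (L (bs ! j) \<bullet> bs ! i))"
    and v: "v \<in> carrier_vec n" "v \<noteq> 0\<^sub>v n" "M *\<^sub>v v = e \<cdot>\<^sub>v v"
  shows "complexified_eigenvalue L e"
proof -
  have bas: "bs ! i \<in> Basis" if "i < n" for i using bs n that nth_mem by metis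
  have inner_bs: "(bs ! i) \<bullet> (bs ! j) = (if i = j then 1 else 0)" if "i < n" "j < n" for i j
    using bas[OF that(1)] bas[OF that(2)] bs(2) n that
    by (auto simp: inner_Basis nth_eq_iff_index_eq)
  define comb where "comb = (\<lambda>c. \<Sum>j<n. c j *\<^sub>R bs ! j)"
  have comb_inner: "comb c \<bullet> bs ! i = c i" if "i < n" for c i
    using that by (simp add: comb_def inner_sum_left inner_bs if_distrib cong: if_cong)
  have eqI: "x = y" if "\<And>i. i < n \<Longrightarrow> x \<bullet> bs ! i = y \<bullet> bs ! i" for x y :: 'b
    using that bs n by (intro euclidean_eqI[of x y]) (auto simp: bs(1)[symmetric] in_set_conv_nth)
  define u where "u = comb (\<lambda>j. Re (v $ j))"
  define w where "w = comb (\<lambda>j. Im (v $ j))"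
  have row: "(\<Sum>j<n. complex_of_real (L (bs ! j) \<bullet> bs ! i) * v $ j) = e * v $ i" if "i < n" for i
  proof -
    have "(M *\<^sub>v v) $ i = (\<Sum>j<n. complex_of_real (L (bs ! j) \<bullet> bs ! i) * v $ j)"
      using that v(1) by (auto simp: M scalar_prod_def atLeast0LessThan intro!: sum.cong)
    then show ?thesis using v that by auto
  qed
  have L_comb: "L (comb c) \<bullet> bs ! i = (\<Sum>j<n. c j * (L (bs ! j) \<bullet> bs ! i))" for c i
    by (simp add: comb_def blinfun.sum_right blinfun.scaleR_right inner_sum_left)
  have Lu: "L u = Re e *\<^sub>R u - Im e *\<^sub>R w"
  proof (rule eqI)
    fix i assume "i < n"
    then show "L u \<bullet> bs ! i = (Re e *\<^sub>R u - Im e *\<^sub>R w) \<bullet> bs ! i"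
      using arg_cong[OF row, of i Re]
      by (simp add: u_def w_def L_comb inner_diff_left comb_inner algebra_simps)
  qed
  have Lw: "L w = Im e *\<^sub>R u + Re e *\<^sub>R w"
  proof (rule eqI)
    fix i assume "i < n"
    then show "L w \<bullet> bs ! i = (Im e *\<^sub>R u + Re e *\<^sub>R w) \<bullet> bs ! i"
      using arg_cong[OF row, of i Im]
      by (simp add: u_def w_def L_comb inner_add_left comb_inner algebra_simps)
  qed
  have "u \<noteq> 0 \<or> w \<noteq> 0"
  proof (rule ccontr)
    assume "\<not> ?thesis"
    then have "v $ i = 0" if "i < n" for i
      using comb_inner[OF that, of "\<lambda>j. Re (v $ j)"] comb_inner[OF that, of "\<lambda>j. Im (v $ j)"]
      by (simp add: u_def w_def complex_eq_iff)
    then have "v = 0\<^sub>v n" using v(1) by (intro eq_vecI) auto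
    then show False using v(2) by contradiction
  qed
  with Lu Lw show ?thesis unfolding complexified_eigenvalue_def by blast
qed

text \<open>The trace is the sum of the complex eigenvalues with multiplicity. A Schur form has them
  on its diagonal, and similar matrices have equal trace because the traces of \<open>X * Y\<close>
  and \<open>Y * X\<close> agree.\<close>

lemma abs_trace_le_eigenvalue_bound:
  fixes L :: "'b::euclidean_space \<Rightarrow>\<^sub>L 'b" and C :: real
  assumes "\<And>z. complexified_eigenvalue L z \<Longrightarrow> cmod z \<le> C"
  shows "\<bar>blinfun_trace L\<bar> \<le> DIM('b) * C"
proof -
  obtain bs where bs: "set bs = (Basis :: 'b set)" "distinct bs"
    using finite_distinct_list[OF finite_Basis] by blast
  define n where "n = length bs"
  have n_DIM: "n = DIM('b)" using distinct_card[OF bs(2)] bs(1) by (simp add: n_def)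
  define M where "M = mat n n (\<lambda>(i, j). complex_of_real (L (bs ! j) \<bullet> bs ! i))"
  have M: "M \<in> carrier_mat n n" by (simp add: M_def)
  obtain es where es: "char_poly M = (\<Prod>a\<leftarrow>es. [:- a, 1:])" "length es = n"
    using char_poly_factorized[OF M] by blast
  obtain B P Q where "schur_decomposition M es = (B, P, Q)" by (metis prod_cases3)
  with schur_decomposition[OF M es(1)]
  have sim: "similar_mat_wit M B P Q" and diag: "diag_mat B = es" by auto
  note wit = similar_mat_witD2[OF M sim]
  have es_bound: "cmod e \<le> C" if "e \<in> set es" for e
  proof -
    have "poly (char_poly M) e = 0"
      using that by (auto simp: es(1) poly_prod_list prod_list_zero_iff)
    then obtain v where "v \<in> carrier_vec n" "v \<noteq> 0\<^sub>v n" "M *\<^sub>v v = e \<cdot>\<^sub>v v"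
      using eigenvalue_root_char_poly[OF M] M by (auto simp: eigenvalue_def eigenvector_def)
    then show ?thesis
      using eigenvector_mat_imp_complexified[OF bs n_def M_def] assms by blast
  qed
  have tr: "(\<Sum>i<n. (X * Y) $$ (i, i)) = (\<Sum>i<n. (Y * X) $$ (i, i))"
    if "X \<in> carrier_mat n n" "Y \<in> carrier_mat n n" for X Y :: "complex mat"
  proof -
    have "(\<Sum>i<n. (X * Y) $$ (i, i)) = (\<Sum>i<n. \<Sum>j<n. X $$ (i, j) * Y $$ (j, i))"
      using that by (auto simp: scalar_prod_def atLeast0LessThan intro!: sum.cong)
    also have "\<dots> = (\<Sum>j<n. \<Sum>i<n. Y $$ (j, i) * X $$ (i, j))"
      by (subst sum.swap) (simp add: mult.commute)
    also have "\<dots> = (\<Sum>i<n. (Y * X) $$ (i, i))"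
      using that by (auto simp: scalar_prod_def atLeast0LessThan intro!: sum.cong)
    finally show ?thesis .
  qed
  have "(\<Sum>i<n. M $$ (i, i)) = (\<Sum>i<n. (P * (B * Q)) $$ (i, i))"
    using wit by (simp add: assoc_mult_mat[of P n n B n Q n])
  also have "\<dots> = (\<Sum>i<n. ((B * Q) * P) $$ (i, i))" using wit by (intro tr) auto
  also have "(B * Q) * P = B" using wit by (simp add: assoc_mult_mat[of B n n Q n P n])
  finally have "(\<Sum>i<n. M $$ (i, i)) = (\<Sum>i<n. es ! i)"
    using diag wit by (auto simp: diag_mat_def)
  moreover have "blinfun_trace L = (\<Sum>i<n. L (bs ! i) \<bullet> bs ! i)"
    unfolding blinfun_trace_def bs(1)[symmetric] n_def
    using sum.reindex_bij_betw[OF bij_betw_nth[OF bs(2) refl refl], of "\<lambda>b. L b \<bullet> b"] by simp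
  ultimately have "complex_of_real (blinfun_trace L) = (\<Sum>i<n. es ! i)"
    by (simp add: M_def)
  then have "\<bar>blinfun_trace L\<bar> = cmod (\<Sum>i<n. es ! i)" by (metis norm_of_real real_norm_def)
  also have "\<dots> \<le> (\<Sum>i<n. C)" using es_bound es(2) by (intro sum_norm_le) auto
  finally show ?thesis by (simp add: n_DIM)
qed

section \<open>Perturbed products of linear maps\<close>

definition rank_one :: "'b::euclidean_space \<Rightarrow> 'b \<Rightarrow> ('b \<Rightarrow>\<^sub>L 'b)" where
  "rank_one a u = blinfun_scaleR_left a o\<^sub>L blinfun_inner_right u"

lemma rank_one_apply: "rank_one a u x = (u \<bullet> x) *\<^sub>R a"
  by (simp add: rank_one_def)

lemma rank_one_zero [simp]: "rank_one 0 u = 0"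
  by (rule blinfun_eqI) (simp add: rank_one_apply)

lemma norm_rank_one_le: "norm (rank_one a u) \<le> norm a * norm u"
proof (rule norm_blinfun_bound)
  fix x
  have "norm (rank_one a u x) = \<bar>u \<bullet> x\<bar> * norm a" by (simp add: rank_one_apply)
  also have "\<dots> \<le> norm a * norm u * norm x"
    using mult_right_mono[OF Cauchy_Schwarz_ineq2[of u x] norm_ge_zero[of a]]
    by (simp add: algebra_simps)
  finally show "norm (rank_one a u x) \<le> norm a * norm u * norm x" .
qed simp

text \<open>The rank-one map sending \<open>w\<close> to \<open>e\<close> and the orthogonal
  complement of \<open>w\<close> to 0 has norm \<open>norm e / norm w\<close>. This is how a
  prescribed displacement of one vector becomes a perturbation of a linear map.\<close>

lemma ex_blinfun_maps_to:
  fixes w e :: "'b::euclidean_space"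
  assumes "norm e \<le> \<epsilon> * norm w" "0 \<le> \<epsilon>"
  shows "\<exists>E::'b \<Rightarrow>\<^sub>L 'b. norm E \<le> \<epsilon> \<and> blinfun_apply E w = e"
proof (cases "w = 0")
  case True
  then show ?thesis using assms by (intro exI[of _ 0]) auto
next
  case False
  let ?E = "rank_one e ((1 / (norm w)\<^sup>2) *\<^sub>R w)"
  have "?E w = e"
    using False by (simp add: rank_one_apply power2_norm_eq_inner)
  moreover have "norm e * norm ((1 / (norm w)\<^sup>2) *\<^sub>R w) = norm e / norm w"
    using False by (simp add: power2_eq_square)
  moreover have "norm e / norm w \<le> \<epsilon>"
    using assms False by (simp add: pos_divide_le_eq)
  ultimately show ?thesis
    using norm_rank_one_le[of e "(1 / (norm w)\<^sup>2) *\<^sub>R w"]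
    by (intro exI[of _ ?E]) auto
qed

lemma ex_norm_attained:
  fixes L :: "'b::euclidean_space \<Rightarrow>\<^sub>L 'b"
  shows "\<exists>x. norm x = 1 \<and> norm (L x) = norm L"
proof -
  have "compact (sphere (0::'b) 1)" "sphere (0::'b) 1 \<noteq> {}" by auto
  moreover have "continuous_on (sphere 0 1) (\<lambda>x. norm (L x))" by (intro continuous_intros)
  ultimately obtain x where x: "norm x = 1" and max: "\<And>y. norm y = 1 \<Longrightarrow> norm (L y) \<le> norm (L x)"
    using continuous_attains_sup[of "sphere (0::'b) 1" "\<lambda>x. norm (L x)"] by auto
  have "norm L \<le> norm (L x)"
  proof (rule norm_blinfun_bound)
    fix y
    show "norm (L y) \<le> norm (L x) * norm y"
      using max[of "(1 / norm y) *\<^sub>R y"]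
      by (cases "y = 0") (auto simp: blinfun.scaleR_right field_simps)
  qed simp
  moreover have "norm (L x) \<le> norm L" using norm_blinfun[of L x] x by simp
  ultimately show ?thesis using x by (intro exI[of _ x]) auto
qed

lemma blinfun_trace_add: "blinfun_trace (X + Y) = blinfun_trace X + blinfun_trace Y"
  by (simp add: blinfun_trace_def blinfun.add_left inner_add_left sum.distrib)

lemma blinfun_trace_rank_one: "blinfun_trace (rank_one a u) = u \<bullet> a"
  by (simp add: blinfun_trace_def rank_one_apply euclidean_inner[of u a])

text \<open>The perturbation stands to the right of \<open>A i\<close>, as in the derivative of
  \<open>f \<circ> \<psi>\<close> at a point fixed by \<open>\<psi>\<close>. The index is absolute
  time, so \<open>E\<close> may differ at successive visits of the same orbit point.\<close>

primrec perturbed_product ::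
    "(nat \<Rightarrow> 'b::euclidean_space \<Rightarrow>\<^sub>L 'b) \<Rightarrow> (nat \<Rightarrow> 'b \<Rightarrow>\<^sub>L 'b) \<Rightarrow> nat \<Rightarrow> nat \<Rightarrow> 'b \<Rightarrow>\<^sub>L 'b" where
  "perturbed_product A E j 0 = id_blinfun"
| "perturbed_product A E j (Suc l) =
     A (j + l) o\<^sub>L (id_blinfun + E (j + l)) o\<^sub>L perturbed_product A E j l"

lemma perturbed_product_add:
  "perturbed_product A E j (l + l') = perturbed_product A E (j + l) l' o\<^sub>L perturbed_product A E j l"
  by (induction l') (auto simp: add.assoc intro!: blinfun_eqI)

lemma perturbed_product_Suc_left:
  "perturbed_product A E j (Suc l) =
     perturbed_product A E (Suc j) l o\<^sub>L A j o\<^sub>L (id_blinfun + E j)"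
  using perturbed_product_add[of A E j 1 l] by (auto intro!: blinfun_eqI)

lemma perturbed_product_cong:
  assumes "\<And>i. j \<le> i \<Longrightarrow> i < j + l \<Longrightarrow> A i = A' i"
    and "\<And>i. j \<le> i \<Longrightarrow> i < j + l \<Longrightarrow> E i = E' i"
  shows "perturbed_product A E j l = perturbed_product A' E' j l"
  using assms by (induction l) auto

lemma perturbed_product_shift:
  "perturbed_product A E (j + k) l = perturbed_product (\<lambda>i. A (i + k)) (\<lambda>i. E (i + k)) j l"
  by (induction l) (auto simp: ac_simps)

text \<open>Since \<open>(1 + r) * (id + E) = id + (r * id + (1 + r) * E)\<close>, multiplying each
  factor by \<open>1 + r\<close> is again a perturbation. This turns boundedness into exponential
  decay.\<close>

lemma perturbed_product_scale:
  "perturbed_product A (\<lambda>i. r *\<^sub>R id_blinfun + (1 + r) *\<^sub>R E i) j l =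
     (1 + r) ^ l *\<^sub>R perturbed_product A E j l"
proof (induction l)
  case (Suc l)
  have "id_blinfun + (r *\<^sub>R id_blinfun + (1 + r) *\<^sub>R E (j + l)) = (1 + r) *\<^sub>R (id_blinfun + E (j + l))"
    by (simp add: algebra_simps)
  with Suc show ?case
    by (auto intro!: blinfun_eqI simp: blinfun.scaleR_left blinfun.scaleR_right simp del: scaleR_add_left)
qed simp

text \<open>If the perturbed products have bounded spectra, their traces are bounded. A perturbation of
  size \<open>\<epsilon>\<close> of rank one at the first factor, directed along the image of a vector \<open>v\<close> under the
  product, changes the trace by a multiple \<open>\<epsilon>\<close> of the expansion of \<open>v\<close>, so the norms are bounded.\<close>

lemma perturbed_product_norm_le:
  fixes A :: "nat \<Rightarrow> 'b::euclidean_space \<Rightarrow>\<^sub>L 'b" and C :: real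
  assumes "0 < \<epsilon>" "0 < n"
    and eig: "\<And>E z. (\<And>i. norm (E i) \<le> \<epsilon>) \<Longrightarrow>
      complexified_eigenvalue (perturbed_product A E j n) z \<Longrightarrow> cmod z \<le> C"
    and E: "\<And>i. norm (E i) \<le> \<epsilon>"
  shows "norm (perturbed_product A E j n) \<le> (2 * real DIM('b) * C / \<epsilon>) * (1 + \<epsilon>)"
proof -
  obtain m where n: "n = Suc m" using \<open>0 < n\<close> gr0_conv_Suc by auto
  define Q where "Q = perturbed_product A E (Suc j) m o\<^sub>L A j"
  have trace_le: "\<bar>blinfun_trace (Q + rank_one (Q a) u)\<bar> \<le> real DIM('b) * C"
    if "norm a * norm u \<le> \<epsilon>" for a u
  proof (rule abs_trace_le_eigenvalue_bound)
    \<comment> \<open>Only the first factor is altered; the trace of the product becomes that of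
      \<open>Q\<close> plus \<open>u \<bullet> Q a\<close>.\<close>
    define E' where "E' = E(j := rank_one a u)"
    have "norm (E' i) \<le> \<epsilon>" for i
      using E[of i] norm_rank_one_le[of a u] that by (auto simp: E'_def)
    moreover have "Q + rank_one (Q a) u = perturbed_product A E' j n"
      unfolding n perturbed_product_Suc_left Q_def
      using perturbed_product_cong[of "Suc j" m A A E E']
      by (auto simp: E'_def rank_one_apply blinfun.add_left blinfun.add_right blinfun.scaleR_right
          intro!: blinfun_eqI)
    ultimately show "cmod z \<le> C" if "complexified_eigenvalue (Q + rank_one (Q a) u) z" for z
      using eig[of E' z] that by simp
  qed
  have K0: "0 \<le> real DIM('b) * C" using trace_le[of 0 0] \<open>0 < \<epsilon>\<close> by simp
  have "norm Q \<le> 2 * real DIM('b) * C / \<epsilon>"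
  proof -
    obtain v where v: "norm v = 1" "norm (Q v) = norm Q" using ex_norm_attained by blast
    define u where "u = (1 / norm (Q v)) *\<^sub>R Q v"
    have u: "norm u \<le> 1" "u \<bullet> Q v = norm (Q v)"
      by (auto simp: u_def power2_norm_eq_inner[symmetric] power2_eq_square)
    have "\<bar>blinfun_trace Q\<bar> \<le> real DIM('b) * C"
      using trace_le[of 0 0] \<open>0 < \<epsilon>\<close> by simp
    \<comment> \<open>The two traces differ by \<open>\<epsilon> * norm Q\<close> and have the same
      bound; this is the factor 2.\<close>
    moreover have "\<bar>blinfun_trace Q + \<epsilon> * norm (Q v)\<bar> \<le> real DIM('b) * C"
      using trace_le[of "\<epsilon> *\<^sub>R v" u] \<open>0 < \<epsilon>\<close> v(1) u
      by (simp add: blinfun_trace_add blinfun_trace_rank_one blinfun.scaleR_right mult_left_le)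
    ultimately have "\<epsilon> * norm Q \<le> 2 * real DIM('b) * C" using v(2) by auto
    then show ?thesis using \<open>0 < \<epsilon>\<close> by (simp add: field_simps)
  qed
  \<comment> \<open>\<open>Q\<close> leaves out the perturbation of the first factor; putting
    \<open>E j\<close> back costs \<open>1 + \<epsilon>\<close>.\<close>
  moreover have "norm (id_blinfun + E j) \<le> 1 + \<epsilon>"
    using norm_triangle_ineq[of id_blinfun "E j"] E[of j] by simp
  ultimately have "norm Q * norm (id_blinfun + E j) \<le> (2 * real DIM('b) * C / \<epsilon>) * (1 + \<epsilon>)"
    using K0 \<open>0 < \<epsilon>\<close> by (intro mult_mono) (auto simp: divide_simps ac_simps)
  then show ?thesis
    unfolding n perturbed_product_Suc_left Q_def[symmetric] using norm_blinfun_compose order_trans by blast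
qed

text \<open>The product inflated by \<open>1 + \<delta>\<close> at each step comes from
  perturbations of size at most
  \<open>\<delta> + (1 + \<delta>) * \<delta> \<le> 3 * \<delta>\<close>, so
  \<open>perturbed_product_norm_le\<close> bounds it with \<open>3 * \<delta>\<close> for
  \<epsilon>; undoing the inflation leaves the decay.\<close>

lemma perturbed_product_norm_decay:
  fixes A :: "nat \<Rightarrow> 'b::euclidean_space \<Rightarrow>\<^sub>L 'b" and C :: real
  assumes "0 < \<delta>" "\<delta> \<le> 1" "0 < n"
    and eig: "\<And>E z. (\<And>i. norm (E i) \<le> 3 * \<delta>) \<Longrightarrow>
      complexified_eigenvalue (perturbed_product A E j n) z \<Longrightarrow> cmod z \<le> C"
    and E: "\<And>i. norm (E i) \<le> \<delta>"
  shows "(1 + \<delta>) ^ n * norm (perturbed_product A E j n) \<le> (2 * real DIM('b) * C / (3 * \<delta>)) * (1 + 3 * \<delta>)"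
proof -
  have "norm (\<delta> *\<^sub>R id_blinfun + (1 + \<delta>) *\<^sub>R E i) \<le> 3 * \<delta>" for i
  proof -
    have "norm (\<delta> *\<^sub>R id_blinfun + (1 + \<delta>) *\<^sub>R E i) \<le> norm (\<delta> *\<^sub>R (id_blinfun :: 'b \<Rightarrow>\<^sub>L 'b)) + norm ((1 + \<delta>) *\<^sub>R E i)"
      by (rule norm_triangle_ineq)
    also have "\<dots> = \<delta> + (1 + \<delta>) * norm (E i)" using assms(1) by simp
    also have "\<dots> \<le> \<delta> + 2 * \<delta>" using assms E[of i] by (intro add_left_mono mult_mono) auto
    finally show ?thesis by simp
  qed
  then have "norm (perturbed_product A (\<lambda>i. \<delta> *\<^sub>R id_blinfun + (1 + \<delta>) *\<^sub>R E i) j n)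
      \<le> (2 * real DIM('b) * C / (3 * \<delta>)) * (1 + 3 * \<delta>)"
    using assms(1,3) eig by (intro perturbed_product_norm_le) auto
  then show ?thesis using assms(1) by (simp add: perturbed_product_scale)
qed

text \<open>Near-supermultiplicativity: the perturbation at the junction can move the vector
  \<open>w\<close> reached so far to \<open>w + e\<close> or \<open>w - e\<close>, where \<open>e\<close> is a small multiple of the vector most
  expanded afterwards, and the images of these two cannot both be short.\<close>

lemma perturbed_product_supermult:
  fixes A :: "nat \<Rightarrow> 'b::euclidean_space \<Rightarrow>\<^sub>L 'b"
  assumes "0 < \<epsilon>" and E: "\<And>i. norm (E i) \<le> \<epsilon>" and E': "\<And>i. norm (E' i) \<le> \<epsilon>" and "0 < l'"
  shows "\<exists>E''. (\<forall>i. norm (E'' i) \<le> \<epsilon>) \<and>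
    \<epsilon> / (1 + \<epsilon>) * norm (perturbed_product A E j l) * norm (perturbed_product A E' (j + l) l')
      \<le> norm (perturbed_product A E'' j (l + l'))"
proof -
  obtain m where l': "l' = Suc m" using \<open>0 < l'\<close> gr0_conv_Suc by auto
  obtain x where x: "norm x = 1" "norm (perturbed_product A E j l x) = norm (perturbed_product A E j l)"
    using ex_norm_attained by blast
  obtain v where v: "norm v = 1"
    "norm (perturbed_product A E' (j + l) l' v) = norm (perturbed_product A E' (j + l) l')"
    using ex_norm_attained by blast
  define w where "w = perturbed_product A E j l x"
  define Q where "Q = perturbed_product A E' (Suc (j + l)) m o\<^sub>L A (j + l)"
  define v' where "v' = v + E' (j + l) v"
  have "perturbed_product A E' (j + l) l' v = Q v'"
    unfolding l' perturbed_product_Suc_left by (simp add: Q_def v'_def blinfun.add_left)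
  then have Qv': "norm (Q v') = norm (perturbed_product A E' (j + l) l')"
    using v(2) by simp
  have "norm v' \<le> 1 + \<epsilon>"
    using norm_triangle_ineq[of v "E' (j + l) v"] norm_blinfun[of "E' (j + l)" v] E'[of "j + l"] v(1)
    by (simp add: v'_def)
  show ?thesis
  proof (cases "v' = 0")
    \<comment> \<open>The second product then vanishes at the vector where its norm is attained, so
      its norm is 0.\<close>
    case True
    then show ?thesis using E Qv' by (intro exI[of _ E]) simp
  next
    case False
    \<comment> \<open>\<open>\<epsilon> * norm w\<close> is the largest displacement of
      \<open>w\<close> within reach of perturbations of size \<epsilon>; dividing by
      \<open>norm v' \<le> 1 + \<epsilon>\<close> produces the constant
      \<open>\<epsilon> / (1 + \<epsilon>)\<close>.\<close>
    define e where "e = (\<epsilon> * norm w / norm v') *\<^sub>R v'"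
    have ne: "norm e = \<epsilon> * norm w" using False \<open>0 < \<epsilon>\<close> by (simp add: e_def)
    have "\<epsilon> / (1 + \<epsilon>) * norm w * norm (Q v') \<le> \<epsilon> * norm w / norm v' * norm (Q v')"
      using \<open>norm v' \<le> 1 + \<epsilon>\<close> \<open>0 < \<epsilon>\<close> False
      by (intro mult_right_mono) (auto simp: intro!: divide_left_mono mult_left_mono mult_pos_pos)
    also have "\<dots> = norm (Q e)" using \<open>0 < \<epsilon>\<close> by (simp add: e_def blinfun.scaleR_right)
    finally have Qe: "\<epsilon> / (1 + \<epsilon>) * norm w * norm (Q v') \<le> norm (Q e)" .
    have "2 * norm (Q e) = norm (Q (w + e) - Q (w - e))"
      by (simp add: blinfun.add_right blinfun.diff_right flip: scaleR_2)
    also have "\<dots> \<le> norm (Q (w + e)) + norm (Q (w - e))" by (rule norm_triangle_ineq4)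
    finally have two: "2 * norm (Q e) \<le> norm (Q (w + e)) + norm (Q (w - e))" .
    obtain e' where e': "norm e' = norm e" "norm (Q e) \<le> norm (Q (w + e'))"
    proof (cases "norm (Q e) \<le> norm (Q (w + e))")
      case True
      then show ?thesis using that[of e] by simp
    next
      case False
      then show ?thesis using that[of "- e"] two by simp
    qed
    obtain F :: "'b \<Rightarrow>\<^sub>L 'b" where F: "norm F \<le> \<epsilon>" "F w = e'"
      using ex_blinfun_maps_to[of e' \<epsilon> w] e'(1) ne \<open>0 < \<epsilon>\<close> by auto
    \<comment> \<open>At the junction \<open>F\<close> takes the place of \<open>E' (j + l)\<close>,
      whose effect is already contained in \<open>v'\<close>.\<close>
    define E'' where "E'' = (\<lambda>i. if i < j + l then E i else if i = j + l then F else E' i)"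
    have "perturbed_product A E'' j (l + l') x = Q (w + F w)"
    proof -
      have "perturbed_product A E'' j l = perturbed_product A E j l"
        by (rule perturbed_product_cong) (auto simp: E''_def)
      moreover have "perturbed_product A E'' (Suc (j + l)) m = perturbed_product A E' (Suc (j + l)) m"
        by (rule perturbed_product_cong) (auto simp: E''_def)
      ultimately show ?thesis
        unfolding perturbed_product_add l' perturbed_product_Suc_left
        by (simp add: E''_def Q_def w_def blinfun.add_left)
    qed
    then have "norm (Q (w + e')) \<le> norm (perturbed_product A E'' j (l + l'))"
      using norm_blinfun[of "perturbed_product A E'' j (l + l')" x] x(1) F(2) by simp
    moreover have "norm (E'' i) \<le> \<epsilon>" for i using E E' F by (auto simp: E''_def)
    ultimately show ?thesis
      using Qe e'(2) x(2) Qv' unfolding w_def by (intro exI[of _ E'']) auto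
  qed
qed

lemma perturbed_product_norm_power_le:
  fixes A :: "nat \<Rightarrow> 'b::euclidean_space \<Rightarrow>\<^sub>L 'b"
  assumes "\<And>j. norm (perturbed_product A E j n) \<le> q" "0 \<le> q"
  shows "norm (perturbed_product A E j (k * n)) \<le> q ^ k"
proof (induction k)
  case (Suc k)
  have "norm (perturbed_product A E j (k * n + n)) \<le>
      norm (perturbed_product A E (j + k * n) n) * norm (perturbed_product A E j (k * n))"
    unfolding perturbed_product_add by (rule norm_blinfun_compose)
  also have "\<dots> \<le> q * q ^ k" using assms Suc by (intro mult_mono) auto
  finally show ?case by (simp add: add.commute)
qed simp

text \<open>If no starting time were uniformly contracting, one could jump from each time to a later
  one with too much growth in between. Two of the times visited agree modulo \<open>n\<close>, and by
  near-supermultiplicativity the growth between them contradicts the contraction over \<open>n\<close> steps.\<close>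

lemma ex_contracting_time:
  fixes A :: "nat \<Rightarrow> 'b::euclidean_space \<Rightarrow>\<^sub>L 'b"
  assumes "0 < \<epsilon>" "0 < \<theta>" "0 < n"
    and contr: "\<And>j E. (\<And>i. norm (E i) \<le> \<epsilon>) \<Longrightarrow> norm (perturbed_product A E j n) \<le> \<theta> ^ n"
  shows "\<exists>j. \<forall>l E. (\<forall>i. norm (E i) \<le> \<epsilon>) \<longrightarrow> \<epsilon> / (1 + \<epsilon>) * norm (perturbed_product A E j l) \<le> \<theta> ^ l"
proof (rule ccontr)
  define c where "c = \<epsilon> / (1 + \<epsilon>)"
  have c: "0 < c" "c \<le> 1" using \<open>0 < \<epsilon>\<close> by (auto simp: c_def)
  assume "\<not> ?thesis"
  then have "\<forall>j. \<exists>l E. (\<forall>i. norm (E i) \<le> \<epsilon>) \<and> \<theta> ^ l < c * norm (perturbed_product A E j l)"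
    by (auto simp: c_def not_le)
  then obtain len Ebad where bad: "\<And>j i. norm (Ebad j i) \<le> \<epsilon>"
    "\<And>j. \<theta> ^ len j < c * norm (perturbed_product A (Ebad j) j (len j))" by metis
  have len: "0 < len j" for j
    using bad(2)[of j] c by (cases "len j") auto
  \<comment> \<open>The visited times: each bad stretch begins where the previous one ends.\<close>
  define s where "s = rec_nat (0::nat) (\<lambda>_ t. t + len t)"
  have s_Suc: "s (Suc i) = s i + len (s i)" for i by (simp add: s_def)
  have s_less: "a < b \<Longrightarrow> s a < s b" for a b
    by (rule lift_Suc_mono_less[of s]) (use s_Suc len in auto)
  \<comment> \<open>Joining stretches costs a factor \<open>c\<close> per junction. The factor
    \<open>c\<close> in the definition of a bad stretch pays for exactly this, so the inequality
    does not weaken with the number of stretches.\<close>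
  have chain: "\<exists>E. (\<forall>i. norm (E i) \<le> \<epsilon>) \<and>
      \<theta> ^ (s (a + Suc d) - s a) < c * norm (perturbed_product A E (s a) (s (a + Suc d) - s a))" for a d
  proof (induction d)
    case 0
    then show ?case using bad[of "s a"] s_Suc by auto
  next
    case (Suc d)
    let ?l = "s (a + Suc d) - s a" and ?t = "s (a + Suc d)"
    have t: "s a + ?l = ?t" using s_less[of a "a + Suc d"] by simp
    have l: "s (a + Suc (Suc d)) - s a = ?l + len ?t" using t s_Suc[of "a + Suc d"] by simp
    from Suc obtain E where E: "\<And>i. norm (E i) \<le> \<epsilon>"
      "\<theta> ^ ?l < c * norm (perturbed_product A E (s a) ?l)" by blast
    obtain E'' where E'': "\<And>i. norm (E'' i) \<le> \<epsilon>"
      "c * norm (perturbed_product A E (s a) ?l) * norm (perturbed_product A (Ebad ?t) ?t (len ?t))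
        \<le> norm (perturbed_product A E'' (s a) (?l + len ?t))"
      using perturbed_product_supermult[OF \<open>0 < \<epsilon>\<close> _ _ len[of ?t], where A = A and j = "s a" and l = ?l and E = E and E' = "Ebad ?t"]
      E(1) bad(1)[of ?t] unfolding t c_def by blast
    have "0 < c * norm (perturbed_product A E (s a) ?l)"
      using E(2) zero_less_power[OF \<open>0 < \<theta>\<close>] by (rule less_trans[rotated])
    then have "\<theta> ^ (?l + len ?t) < (c * norm (perturbed_product A E (s a) ?l)) *
        (c * norm (perturbed_product A (Ebad ?t) ?t (len ?t)))"
      unfolding power_add using E(2) bad(2)[of ?t] \<open>0 < \<theta>\<close> by (intro mult_strict_mono) auto
    also have "\<dots> \<le> c * norm (perturbed_product A E'' (s a) (?l + len ?t))"
      using mult_left_mono[OF E''(2), of c] c by (simp add: algebra_simps)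
    finally show ?case unfolding l using E''(1) by blast
  qed
  \<comment> \<open>There are infinitely many visited times but only \<open>n\<close> residues, so
    the distance between some two of them is a multiple of \<open>n\<close>.\<close>
  have "\<not> inj (\<lambda>i. s i mod n)"
  proof
    assume "inj (\<lambda>i. s i mod n)"
    moreover have "range (\<lambda>i. s i mod n) \<subseteq> {..<n}" using \<open>0 < n\<close> by auto
    ultimately show False using finite_imageD[of "\<lambda>i. s i mod n" UNIV] finite_subset by blast
  qed
  then obtain a b :: nat where "a < b" "s a mod n = s b mod n"
    unfolding inj_def by (metis linorder_neqE_nat)
  then obtain k where k: "s b - s a = k * n"
    using s_less[of a b] by (metis less_imp_le mod_eq_dvd_iff_nat dvd_def mult.commute)
  obtain d where "b = a + Suc d" using \<open>a < b\<close> less_iff_Suc_add by auto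
  then obtain E where E: "\<And>i. norm (E i) \<le> \<epsilon>" "\<theta> ^ (k * n) < c * norm (perturbed_product A E (s a) (k * n))"
    using chain[of a d] k by auto
  have "norm (perturbed_product A E (s a) (k * n)) \<le> (\<theta> ^ n) ^ k"
    using contr[OF E(1)] \<open>0 < \<theta>\<close> by (intro perturbed_product_norm_power_le) auto
  then have "c * norm (perturbed_product A E (s a) (k * n)) \<le> 1 * \<theta> ^ (k * n)"
    using c by (intro mult_mono) (auto simp: power_mult[symmetric] mult.commute)
  then show False using E(2) by simp
qed

section \<open>Maps between charts\<close>

lemma isCont_eventually_mem:
  assumes "isCont h x" "open S" "h x \<in> S"
  shows "\<forall>\<^sub>F y in nhds x. h y \<in> S"
proof -
  have "filterlim h (nhds (h x)) (nhds x)"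
    using assms(1) by (simp add: continuous_at tendsto_at_iff_tendsto_nhds)
  then show ?thesis using assms(2,3) by (rule topological_tendstoD)
qed

lemma smooth_atlas_coversE:
  assumes "smooth_atlas A"
  obtains c where "c \<in> charts_at A x"
proof -
  have "x \<in> (\<Union>c\<in>A. chart_dom c)" using assms by (simp add: smooth_atlas_def)
  then obtain c where "c \<in> A" "x \<in> chart_dom c" by blast
  then show ?thesis using that by (simp add: charts_at_def)
qed

locale atlas =
  fixes A :: "('a::{t2_space, second_countable_topology}, 'b::euclidean_space) chart set"
  assumes smooth_atlas: "smooth_atlas A"
begin

lemma charts_atD: "c \<in> charts_at A x \<Longrightarrow> c \<in> A" "c \<in> charts_at A x \<Longrightarrow> x \<in> chart_dom c"
  by (auto simp: charts_at_def)

lemma open_chart_dom: "c \<in> A \<Longrightarrow> open (chart_dom c)"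
  using smooth_atlas by (auto simp: smooth_atlas_def)

lemma open_chart_image: "c \<in> A \<Longrightarrow> open (chart_map c ` chart_dom c)"
  using smooth_atlas by (auto simp: smooth_atlas_def)

lemma chart_homeomorphism:
  "c \<in> A \<Longrightarrow> homeomorphism (chart_dom c) (chart_map c ` chart_dom c) (chart_map c) (chart_inv c)"
  using smooth_atlas by (auto simp: smooth_atlas_def)

lemma chart_inv_map [simp]: "c \<in> A \<Longrightarrow> x \<in> chart_dom c \<Longrightarrow> chart_inv c (chart_map c x) = x"
  using chart_homeomorphism by (auto simp: homeomorphism_def)

lemma chart_map_inv [simp]: "c \<in> A \<Longrightarrow> y \<in> chart_map c ` chart_dom c \<Longrightarrow> chart_map c (chart_inv c y) = y"
  using chart_homeomorphism by (auto simp: homeomorphism_def)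

lemma chart_inv_in_dom: "c \<in> A \<Longrightarrow> y \<in> chart_map c ` chart_dom c \<Longrightarrow> chart_inv c y \<in> chart_dom c"
  using chart_homeomorphism by auto

lemma isCont_chart_map: "c \<in> A \<Longrightarrow> x \<in> chart_dom c \<Longrightarrow> isCont (chart_map c) x"
  using chart_homeomorphism[of c] open_chart_dom[of c]
  by (auto simp: homeomorphism_def continuous_on_eq_continuous_at)

lemma isCont_chart_inv: "c \<in> A \<Longrightarrow> y \<in> chart_map c ` chart_dom c \<Longrightarrow> isCont (chart_inv c) y"
  using chart_homeomorphism[of c] open_chart_image[of c]
  by (auto simp: homeomorphism_def continuous_on_eq_continuous_at)

lemma eventually_chart_inv:
  assumes "c \<in> charts_at A x" "\<forall>\<^sub>F z in nhds x. P z"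
  shows "\<forall>\<^sub>F y in nhds (chart_map c x). y \<in> chart_map c ` chart_dom c \<and> P (chart_inv c y)"
proof -
  note c = charts_atD[OF assms(1)]
  have "filterlim (chart_inv c) (nhds x) (nhds (chart_map c x))"
    using isCont_chart_inv[OF c(1), of "chart_map c x"] c
      tendsto_at_iff_tendsto_nhds[of "chart_inv c" "chart_map c x"]
    by (simp add: continuous_at)
  with assms(2) have "\<forall>\<^sub>F y in nhds (chart_map c x). P (chart_inv c y)"
    by (simp add: filterlim_iff)
  moreover have "\<forall>\<^sub>F y in nhds (chart_map c x). y \<in> chart_map c ` chart_dom c"
    using c open_chart_image by (intro eventually_nhds_in_open) auto
  ultimately show ?thesis by (rule eventually_conj[rotated])
qed

lemma eventually_chart_map:
  assumes "c \<in> charts_at A x" "\<forall>\<^sub>F y in nhds (chart_map c x). P y"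
  shows "\<forall>\<^sub>F z in nhds x. z \<in> chart_dom c \<and> P (chart_map c z)"
proof -
  note c = charts_atD[OF assms(1)]
  have "filterlim (chart_map c) (nhds (chart_map c x)) (nhds x)"
    using isCont_chart_map[OF c] by (simp add: continuous_at tendsto_at_iff_tendsto_nhds)
  with assms(2) have "\<forall>\<^sub>F z in nhds x. P (chart_map c z)" by (simp add: filterlim_iff)
  moreover have "\<forall>\<^sub>F z in nhds x. z \<in> chart_dom c"
    using c open_chart_dom by (intro eventually_nhds_in_open) auto
  ultimately show ?thesis by (rule eventually_conj[rotated])
qed

lemma open_chart_map_image:
  assumes "c \<in> A" "open S"
  shows "open (chart_map c ` (chart_dom c \<inter> S))"
proof -
  have "openin (top_of_set (chart_map c ` chart_dom c)) (chart_map c ` (chart_dom c \<inter> S))"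
    using chart_homeomorphism[OF assms(1)] assms(2)
    by (intro homeomorphism_imp_open_map[where T = "chart_map c ` chart_dom c"]) auto
  then show ?thesis using open_chart_image[OF assms(1)] by (simp add: openin_open_eq)
qed

lemma C1_at_transition:
  assumes "c \<in> charts_at A x" "d \<in> charts_at A x"
  shows "C1_at (chart_map d \<circ> chart_inv c) (chart_map c x)"
proof -
  note c = charts_atD[OF assms(1)] and d = charts_atD[OF assms(2)]
  have "Ck_on 1 (chart_map c ` (chart_dom c \<inter> chart_dom d)) (chart_map d \<circ> chart_inv c)"
    using smooth_atlas c d unfolding smooth_atlas_def smooth_on_def by blast
  then show ?thesis
    using Ck_on_1_iff[OF open_chart_map_image[OF c(1) open_chart_dom[OF d(1)]]] c d by blast
qed

text \<open>Passing through the chart \<open>e\<close> is harmless only near \<open>x\<close>: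
  farther away \<open>h\<close> may leave the domain of \<open>e\<close>, where
  \<open>chart_inv e \<circ> chart_map e\<close> need not be the identity.\<close>

lemma coords_compose_eventually:
  assumes "c \<in> charts_at A x" "e \<in> charts_at A (h x)" "isCont h x"
  shows "\<forall>\<^sub>F y in nhds (chart_map c x). ((chart_map d \<circ> k \<circ> chart_inv e) \<circ> (chart_map e \<circ> h \<circ> chart_inv c)) y
    = (chart_map d \<circ> (k \<circ> h) \<circ> chart_inv c) y"
proof -
  have "\<forall>\<^sub>F z in nhds x. h z \<in> chart_dom e"
    using assms(3) open_chart_dom charts_atD[OF assms(2)] by (intro isCont_eventually_mem) auto
  from eventually_chart_inv[OF assms(1) this]
  show ?thesis by eventually_elim (use charts_atD[OF assms(2)] in simp)
qed

text \<open>The chain rule across the intermediate chart \<open>e\<close>. With \<open>h\<close> or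
  \<open>k\<close> the identity it is the rule for changing charts at the source or at the
  target.\<close>

lemma
  assumes c: "c \<in> charts_at A x" and e: "e \<in> charts_at A (h x)" and cont: "isCont h x"
    and h: "C1_at (chart_map e \<circ> h \<circ> chart_inv c) (chart_map c x)"
    and k: "C1_at (chart_map d \<circ> k \<circ> chart_inv e) (chart_map e (h x))"
  shows C1_at_coords_compose: "C1_at (chart_map d \<circ> (k \<circ> h) \<circ> chart_inv c) (chart_map c x)"
    and bderiv_coords_compose: "bderiv (chart_map d \<circ> (k \<circ> h) \<circ> chart_inv c) (chart_map c x) =
      bderiv (chart_map d \<circ> k \<circ> chart_inv e) (chart_map e (h x)) o\<^sub>L
      bderiv (chart_map e \<circ> h \<circ> chart_inv c) (chart_map c x)"
proof -
  have eq: "(chart_map e \<circ> h \<circ> chart_inv c) (chart_map c x) = chart_map e (h x)"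
    using charts_atD[OF c] by simp
  have k': "C1_at (chart_map d \<circ> k \<circ> chart_inv e) ((chart_map e \<circ> h \<circ> chart_inv c) (chart_map c x))"
    unfolding eq by (rule k)
  note ev = coords_compose_eventually[where h = h and d = d and k = k, OF c e cont]
  show "C1_at (chart_map d \<circ> (k \<circ> h) \<circ> chart_inv c) (chart_map c x)"
    by (rule C1_at_cong[OF ev C1_at_compose[OF h k']])
  show "bderiv (chart_map d \<circ> (k \<circ> h) \<circ> chart_inv c) (chart_map c x) =
      bderiv (chart_map d \<circ> k \<circ> chart_inv e) (chart_map e (h x)) o\<^sub>L
      bderiv (chart_map e \<circ> h \<circ> chart_inv c) (chart_map c x)"
    using bderiv_cong[OF ev]
      bderiv_compose[OF C1_at_imp_differentiable[OF h] C1_at_imp_differentiable[OF k']]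
    unfolding eq by (rule trans[OF sym])
qed

lemma C1_map_imp_isCont: "C1_map A h \<Longrightarrow> isCont h x"
  by (simp add: C1_map_def continuous_on_eq_continuous_at)

lemma C1_map_imp_C1_at:
  assumes "C1_map A h" "c \<in> charts_at A x" "d \<in> charts_at A (h x)"
  shows "C1_at (chart_map d \<circ> h \<circ> chart_inv c) (chart_map c x)"
proof -
  note c = charts_atD[OF assms(2)] and d = charts_atD[OF assms(3)]
  have "open (h -` chart_dom d)"
    using assms(1) open_chart_dom[OF d(1)] by (auto simp: C1_map_def intro: open_vimage)
  moreover have "Ck_on 1 (chart_map c ` (chart_dom c \<inter> h -` chart_dom d)) (chart_map d \<circ> h \<circ> chart_inv c)"
    using assms(1) c d unfolding C1_map_def by blast
  ultimately show ?thesis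
    using Ck_on_1_iff[OF open_chart_map_image[OF c(1)]] c d by blast
qed

text \<open>One pair of charts at each point suffices: composing with the identity on either side,
  which in coordinates is a smooth transition map, gives all the others.\<close>

lemma C1_mapI:
  assumes "\<And>x. isCont h x"
    and "\<And>x. \<exists>c\<in>charts_at A x. \<exists>d\<in>charts_at A (h x). C1_at (chart_map d \<circ> h \<circ> chart_inv c) (chart_map c x)"
  shows "C1_map A h"
proof -
  have cont: "continuous_on UNIV h" using assms(1) by (simp add: continuous_on_eq_continuous_at)
  have "Ck_on 1 (chart_map c' ` (chart_dom c' \<inter> h -` chart_dom d')) (chart_map d' \<circ> h \<circ> chart_inv c')"
    if "c' \<in> A" "d' \<in> A" for c' d'
  proof -
    have "open (h -` chart_dom d')"
      using cont open_chart_dom[OF that(2)] by (auto intro: open_vimage)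
    moreover have "C1_at (chart_map d' \<circ> h \<circ> chart_inv c') (chart_map c' x)"
      if "x \<in> chart_dom c'" "h x \<in> chart_dom d'" for x
    proof -
      obtain c d where c: "c \<in> charts_at A x" and d: "d \<in> charts_at A (h x)"
        and C: "C1_at (chart_map d \<circ> h \<circ> chart_inv c) (chart_map c x)"
        using assms(2) by blast
      have c': "c' \<in> charts_at A x" and d': "d' \<in> charts_at A (h x)"
        using that \<open>c' \<in> A\<close> \<open>d' \<in> A\<close> by (auto simp: charts_at_def)
      have "C1_at (chart_map d \<circ> (h \<circ> id) \<circ> chart_inv c') (chart_map c' x)"
        using c c' C C1_at_transition[OF c' c] by (intro C1_at_coords_compose[where e = c]) auto
      then have "C1_at (chart_map d' \<circ> (id \<circ> h) \<circ> chart_inv c') (chart_map c' x)"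
        using d d' c' assms(1) C1_at_transition[OF d d']
        by (intro C1_at_coords_compose[where e = d]) auto
      then show ?thesis by simp
    qed
    ultimately show ?thesis
      using Ck_on_1_iff[OF open_chart_map_image[OF \<open>c' \<in> A\<close>]] by blast
  qed
  with cont show ?thesis by (simp add: C1_map_def)
qed

lemma C1_map_compose:
  assumes "C1_map A h" "C1_map A k"
  shows "C1_map A (k \<circ> h)"
proof (rule C1_mapI)
  fix x
  have cont: "isCont h x" "isCont k (h x)" using assms by (simp_all add: C1_map_imp_isCont)
  then show "isCont (k \<circ> h) x" unfolding comp_def by (rule isCont_o2)
  obtain c where c: "c \<in> charts_at A x" using smooth_atlas_coversE[OF smooth_atlas] .
  obtain e where e: "e \<in> charts_at A (h x)" using smooth_atlas_coversE[OF smooth_atlas] .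
  obtain d where d: "d \<in> charts_at A (k (h x))" using smooth_atlas_coversE[OF smooth_atlas] .
  have "C1_at (chart_map d \<circ> (k \<circ> h) \<circ> chart_inv c) (chart_map c x)"
    by (rule C1_at_coords_compose[OF c e cont(1) C1_map_imp_C1_at[OF assms(1) c e]
        C1_map_imp_C1_at[OF assms(2) e d]])
  with c d show "\<exists>c\<in>charts_at A x. \<exists>d\<in>charts_at A ((k \<circ> h) x).
      C1_at (chart_map d \<circ> (k \<circ> h) \<circ> chart_inv c) (chart_map c x)"
    by auto
qed

lemma C1_map_id: "C1_map A id"
proof (rule C1_mapI)
  fix x
  obtain c where "c \<in> charts_at A x" using smooth_atlas_coversE[OF smooth_atlas] .
  then show "\<exists>c\<in>charts_at A x. \<exists>d\<in>charts_at A (id x). C1_at (chart_map d \<circ> id \<circ> chart_inv c) (chart_map c x)"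
    using C1_at_transition[of c x c] by auto
qed auto

lemma Diff1_compose: "h \<in> Diff1 A \<Longrightarrow> k \<in> Diff1 A \<Longrightarrow> k \<circ> h \<in> Diff1 A"
  using C1_map_compose[of h k] C1_map_compose[of "inv k" "inv h"]
  by (simp add: Diff1_def o_inv_distrib bij_comp)

lemma id_in_Diff1: "id \<in> Diff1 A"
  using C1_map_id by (simp add: Diff1_def)

section \<open>Tangent maps in coordinates\<close>

lemma transition_compose:
  assumes "c \<in> charts_at A p" "d \<in> charts_at A p" "e \<in> charts_at A p"
  shows "bderiv (chart_map e \<circ> chart_inv d) (chart_map d p) (bderiv (chart_map d \<circ> chart_inv c) (chart_map c p) x)
    = bderiv (chart_map e \<circ> chart_inv c) (chart_map c p) x"
  using bderiv_coords_compose[where h = id and k = id and x = p and c = c and e = d and d = e]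
    C1_at_transition assms by simp

lemma tangent_of_coords_apply:
  assumes "c \<in> charts_at A p"
  shows "tangent_of_coords A p c x = (\<lambda>d. if d \<in> charts_at A p
    then bderiv (chart_map d \<circ> chart_inv c) (chart_map c p) x else 0)"
  unfolding tangent_of_coords_def
proof (rule ext)
  fix d
  show "(if d \<in> charts_at A p then frechet_derivative (chart_map d \<circ> chart_inv c) (at (chart_map c p)) x else 0)
    = (if d \<in> charts_at A p then bderiv (chart_map d \<circ> chart_inv c) (chart_map c p) x else 0)"
    using frechet_derivative_eq_bderiv[OF C1_at_imp_differentiable[OF C1_at_transition[OF assms]]]
    by simp
qed

lemma tangent_of_coords_same:
  assumes "c \<in> charts_at A p"
  shows "tangent_of_coords A p c x c = x"
proof -
  have "\<forall>\<^sub>F y in nhds (chart_map c p). (chart_map c \<circ> chart_inv c) y = y"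
    using eventually_chart_inv[OF assms, of "\<lambda>_. True"] charts_atD[OF assms]
    by (auto elim!: eventually_mono)
  then have "bderiv (chart_map c \<circ> chart_inv c) (chart_map c p) = id_blinfun"
    using bderiv_cong bderiv_id by metis
  then show ?thesis using assms by (simp add: tangent_of_coords_apply)
qed

lemma tangent_of_coords_in_tangent_space:
  assumes "c \<in> charts_at A p"
  shows "tangent_of_coords A p c x \<in> tangent_space A p"
  unfolding tangent_space_def tangent_of_coords_apply[OF assms]
  using assms transition_compose C1_at_imp_differentiable[OF C1_at_transition]
  by (auto simp: frechet_derivative_eq_bderiv)

lemma tangent_space_eq_coords:
  assumes "v \<in> tangent_space A p" "c \<in> charts_at A p"
  shows "v = tangent_of_coords A p c (v c)"
proof (rule ext)
  fix d
  show "v d = tangent_of_coords A p c (v c) d"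
  proof (cases "d \<in> charts_at A p")
    case True
    then have "v d = frechet_derivative (chart_map d \<circ> chart_inv c) (at (chart_map c p)) (v c)"
      using assms unfolding tangent_space_def by blast
    with True show ?thesis unfolding tangent_of_coords_def by (simp only: if_True)
  next
    case False
    then have "v d = 0" using assms(1) unfolding tangent_space_def by blast
    with False show ?thesis by (simp add: tangent_of_coords_def)
  qed
qed

lemma tangent_of_coords_linear:
  assumes "c \<in> charts_at A p"
  shows "tangent_of_coords A p c (a *\<^sub>R x + b *\<^sub>R y) =
    (\<lambda>d. a *\<^sub>R tangent_of_coords A p c x d + b *\<^sub>R tangent_of_coords A p c y d)"
  unfolding tangent_of_coords_apply[OF assms]
  by (auto simp: blinfun.add_right blinfun.scaleR_right)

text \<open>The description in \<open>tangent_map\<close> ranges over all pairs of charts. By the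
  chain rule one pair determines the others, and a tangent vector is determined by one coordinate
  vector, so the described vector exists and is unique.\<close>

lemma tangent_map_coords:
  assumes h: "C1_map A h" and c: "c \<in> charts_at A p" and d: "d \<in> charts_at A (h p)"
    and v: "v \<in> tangent_space A p"
  shows "tangent_map A h p v =
    tangent_of_coords A (h p) d (bderiv (chart_map d \<circ> h \<circ> chart_inv c) (chart_map c p) (v c))"
    (is "_ = ?w")
proof -
  let ?D = "\<lambda>c d. bderiv (chart_map d \<circ> h \<circ> chart_inv c) (chart_map c p)"
  have D: "frechet_derivative (chart_map d' \<circ> h \<circ> chart_inv c') (at (chart_map c' p)) = ?D c' d'"
    if "c' \<in> charts_at A p" "d' \<in> charts_at A (h p)" for c' d'
    using that C1_at_imp_differentiable[OF C1_map_imp_C1_at[OF h]]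
    by (simp add: frechet_derivative_eq_bderiv)
  have change: "?w d' = ?D c' d' (v c')" if "c' \<in> charts_at A p" "d' \<in> charts_at A (h p)" for c' d'
  proof -
    have "v c' = bderiv (chart_map c' \<circ> chart_inv c) (chart_map c p) (v c)"
      using tangent_space_eq_coords[OF v c] that(1) tangent_of_coords_apply[OF c] by metis
    moreover have "bderiv (chart_map d' \<circ> (h \<circ> id) \<circ> chart_inv c) (chart_map c p) =
        bderiv (chart_map d' \<circ> h \<circ> chart_inv c') (chart_map c' (id p)) o\<^sub>L
        bderiv (chart_map c' \<circ> id \<circ> chart_inv c) (chart_map c p)"
      by (rule bderiv_coords_compose[OF c])
        (use that in \<open>simp_all add: C1_at_transition[OF c] C1_map_imp_C1_at[OF h]\<close>)
    moreover have "bderiv (chart_map d' \<circ> (id \<circ> h) \<circ> chart_inv c) (chart_map c p) =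
        bderiv (chart_map d' \<circ> id \<circ> chart_inv d) (chart_map d (h p)) o\<^sub>L
        bderiv (chart_map d \<circ> h \<circ> chart_inv c) (chart_map c p)"
      by (rule bderiv_coords_compose[where h = h, OF c d])
        (use that in \<open>simp_all add: C1_at_transition[OF d] C1_map_imp_C1_at[OF h c d] C1_map_imp_isCont[OF h]\<close>)
    moreover have "?w d' = bderiv (chart_map d' \<circ> chart_inv d) (chart_map d (h p)) (?D c d (v c))"
      using that(2) by (simp add: tangent_of_coords_apply[OF d])
    ultimately show ?thesis by (simp flip: blinfun_apply_blinfun_compose)
  qed
  show ?thesis
    unfolding tangent_map_def
  proof (rule the_equality)
    show "?w \<in> tangent_space A (h p) \<and> (\<forall>c\<in>charts_at A p. \<forall>d\<in>charts_at A (h p).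
        ?w d = frechet_derivative (chart_map d \<circ> h \<circ> chart_inv c) (at (chart_map c p)) (v c))"
      using change D tangent_of_coords_in_tangent_space[OF d] by simp
  next
    fix w assume w: "w \<in> tangent_space A (h p) \<and> (\<forall>c\<in>charts_at A p. \<forall>d\<in>charts_at A (h p).
        w d = frechet_derivative (chart_map d \<circ> h \<circ> chart_inv c) (at (chart_map c p)) (v c))"
    then have "w d = ?w d" using change D c d by metis
    then show "w = ?w"
      using tangent_space_eq_coords[OF _ d] tangent_of_coords_in_tangent_space[OF d] w by metis
  qed
qed

end

section \<open>Local perturbations of the identity\<close>

lemma ex_left_inverse_near_id:
  fixes B :: "'b::euclidean_space \<Rightarrow>\<^sub>L 'b"
  assumes "norm B \<le> 1/2"
  shows "\<exists>L::'b \<Rightarrow>\<^sub>L 'b. L o\<^sub>L (id_blinfun + B) = id_blinfun \<and> (id_blinfun + B) o\<^sub>L L = id_blinfun \<and> norm L \<le> 2"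
proof -
  let ?M = "blinfun_apply (id_blinfun + B)"
  have lower: "norm v \<le> 2 * norm (?M v)" for v
  proof -
    have "norm (B v) \<le> norm v / 2"
      using norm_blinfun[of B v] mult_right_mono[OF assms norm_ge_zero[of v]] by simp
    moreover have "norm v \<le> norm (?M v) + norm (B v)"
      using norm_triangle_ineq4[of "?M v" "B v"] by (simp add: blinfun.add_left)
    ultimately show ?thesis by simp
  qed
  have lin: "linear ?M" by (rule bounded_linear.linear[OF blinfun.bounded_linear_right])
  have "inj ?M"
    unfolding linear_injective_0[OF lin] using lower by (metis mult_zero_right norm_zero norm_le_zero_iff)
  then obtain g where g: "linear g" "g \<circ> ?M = id"
    using linear_injective_left_inverse[OF lin] by blast
  then have g': "?M \<circ> g = id" using linear_inverse_left[OF g(1) lin] by blast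
  have app: "blinfun_apply (Blinfun g) = g"
    using g(1) by (simp add: bounded_linear_Blinfun_apply linear_conv_bounded_linear)
  have "norm (Blinfun g) \<le> 2"
    using lower[of "g _"] g' by (intro norm_blinfun_bound) (auto simp: app fun_eq_iff)
  then show ?thesis
    using g g' by (intro exI[of _ "Blinfun g"]) (auto simp: app fun_eq_iff intro!: blinfun_eqI)
qed

text \<open>\<open>\<Theta>\<close> minus the identity is Lipschitz with constant 1/2. Hence
  \<open>\<Theta>\<close> shrinks distances by at most a factor 2, which gives injectivity, and
  solving \<open>\<Theta> y = z\<close> is a fixed point problem for a contraction, which gives
  surjectivity.\<close>

lemma
  fixes \<Theta> :: "'b::euclidean_space \<Rightarrow> 'b" and B :: "'b \<Rightarrow> 'b \<Rightarrow>\<^sub>L 'b"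
  assumes deriv: "\<And>y. (\<Theta> has_derivative blinfun_apply (id_blinfun + B y)) (at y)"
    and B: "\<And>y. norm (B y) \<le> 1/2" "\<And>y. isCont B y"
  shows bij_near_id: "bij \<Theta>"
    and C1_at_near_id: "C1_at \<Theta> y"
    and C1_at_inv_near_id: "C1_at (inv_into UNIV \<Theta>) y"
proof -
  have lip: "norm ((\<Theta> z - z) - (\<Theta> y - y)) \<le> 1/2 * norm (z - y)" for y z
  proof (rule differentiable_bound[of UNIV _ "\<lambda>x. blinfun_apply (B x)"])
    show "((\<lambda>x. \<Theta> x - x) has_derivative blinfun_apply (B x)) (at x within UNIV)" for x
      using deriv[of x] by (auto intro!: derivative_eq_intros simp: blinfun.add_left)
    show "onorm (blinfun_apply (B x)) \<le> 1/2" for x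
      using B(1)[of x] by (simp add: norm_blinfun.rep_eq)
  qed auto
  have expand: "norm (z - y) \<le> 2 * norm (\<Theta> z - \<Theta> y)" for y z
    using lip[of z y] norm_triangle_ineq4[of "\<Theta> z - \<Theta> y" "(\<Theta> z - z) - (\<Theta> y - y)"] by simp
  have "inj \<Theta>" by (rule injI) (use expand in \<open>metis mult_zero_right norm_le_zero_iff norm_zero right_minus_eq\<close>)
  moreover have "surj \<Theta>"
    unfolding surj_def
  proof
    fix z
    have "\<exists>!y. z - (\<Theta> y - y) = y"
      using lip by (intro banach_fix_type[of "1/2"]) (auto simp: dist_norm norm_minus_commute algebra_simps)
    then obtain y where "z - (\<Theta> y - y) = y" by blast
    then have "z = \<Theta> y" by (simp add: diff_eq_eq)
    then show "\<exists>y. z = \<Theta> y" ..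
  qed
  ultimately show bij: "bij \<Theta>" by (simp add: bij_def)
  show "C1_at \<Theta> y"
    using deriv B(2) by (intro C1_atI[where F' = "\<lambda>y. id_blinfun + B y"] continuous_intros always_eventually) auto
  define G where "G = inv_into UNIV \<Theta>"
  have \<Theta>G: "\<Theta> (G u) = u" for u using bij unfolding G_def by (simp add: bij_is_surj surj_f_inv_f)
  have "norm (G u - G v) \<le> 2 * norm (u - v)" for u v
    using expand[of "G u" "G v"] by (simp add: \<Theta>G)
  then have "((\<lambda>v. G v - G u) \<longlongrightarrow> 0) (at u)" for u
    by (rule Lim_null_comparison[where g = "\<lambda>v. 2 * norm (v - u)", OF always_eventually, rule_format])
      (auto intro!: tendsto_eq_intros)
  then have contG: "isCont G u" for u
    unfolding isCont_def by (rule LIM_zero_cancel)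
  obtain L where L1: "\<And>y. L y o\<^sub>L (id_blinfun + B y) = id_blinfun"
    and L2: "\<And>y. (id_blinfun + B y) o\<^sub>L L y = id_blinfun" and L3: "\<And>y. norm (L y) \<le> 2"
    using ex_left_inverse_near_id[OF B(1)] by metis
  have L1': "L z (w + B z w) = w" and L2': "L z w + B z (L z w) = w" for z w
    using L1[of z, THEN arg_cong, of "\<lambda>T. blinfun_apply T w"] L2[of z, THEN arg_cong, of "\<lambda>T. blinfun_apply T w"]
    by (simp_all add: blinfun.add_left)
  have "norm (L z - L y) \<le> 4 * norm (B z - B y)" for y z
  proof -
    \<comment> \<open>The resolvent identity; it makes the inverse derivatives depend continuously
      on the point.\<close>
    have "L z - L y = L z o\<^sub>L ((B y - B z) o\<^sub>L L y)"
    proof (rule blinfun_eqI)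
      fix v
      define w where "w = L y v"
      have "L z v - w = L z (w + B y w) - L z (w + B z w)"
        using L1'[of z w] L2'[of y v] by (simp add: w_def)
      also have "\<dots> = L z ((B y - B z) w)"
        by (simp add: blinfun.diff_left flip: blinfun.diff_right)
      finally show "blinfun_apply (L z - L y) v = blinfun_apply (L z o\<^sub>L ((B y - B z) o\<^sub>L L y)) v"
        by (simp add: blinfun.diff_left w_def)
    qed
    then have "norm (L z - L y) \<le> norm (L z) * norm ((B y - B z) o\<^sub>L L y)"
      using norm_blinfun_compose by metis
    also have "\<dots> \<le> norm (L z) * (norm (B y - B z) * norm (L y))"
      by (intro mult_left_mono norm_blinfun_compose) auto
    also have "\<dots> \<le> 2 * (norm (B y - B z) * 2)"
      using L3 by (intro mult_mono) auto
    finally show ?thesis by (simp add: norm_minus_commute)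
  qed
  moreover have "((\<lambda>z. 4 * norm (B z - B y)) \<longlongrightarrow> 0) (at y)" for y
  proof -
    have "((\<lambda>z. 4 * norm (B z - B y)) \<longlongrightarrow> 4 * norm (B y - B y)) (at y)"
      using B(2)[of y] unfolding isCont_def by (intro tendsto_intros)
    then show ?thesis by simp
  qed
  ultimately have "((\<lambda>z. L z - L y) \<longlongrightarrow> 0) (at y)" for y
    by (rule Lim_null_comparison[where g = "\<lambda>z. 4 * norm (B z - B y)", OF always_eventually, rule_format])
  then have contL: "isCont L y" for y
    unfolding isCont_def by (rule LIM_zero_cancel)
  have "(G has_derivative blinfun_apply (L (G y))) (at y)" for y
  proof (rule has_derivative_inverse_basic[where f = \<Theta> and T = UNIV, OF deriv blinfun.bounded_linear_right])
    show "blinfun_apply (L (G y)) \<circ> blinfun_apply (id_blinfun + B (G y)) = id"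
      using L1' by (simp add: fun_eq_iff blinfun.add_left)
    show "isCont G y" by (rule contG)
    show "\<Theta> (G z) = z" for z by (rule \<Theta>G)
  qed auto
  then have "C1_at G y"
    by (intro C1_atI[where F' = "\<lambda>y. L (G y)"] always_eventually isCont_o2[OF contG contL]) auto
  then show "C1_at (inv_into UNIV \<Theta>) y" by (simp add: G_def)
qed

section \<open>Cutoff perturbations with a prescribed derivative at one point\<close>

lemma max_0_square_has_real_derivative:
  "((\<lambda>s::real. (max 0 s)\<^sup>2) has_real_derivative 2 * max 0 s) (at s)"
proof -
  consider "s > 0" | "s < 0" | "s = 0" by linarith
  then show ?thesis
  proof cases
    case 1
    have "((\<lambda>s::real. s\<^sup>2) has_real_derivative 2 * s) (at s)" by (auto intro!: derivative_eq_intros)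
    then have "((\<lambda>s::real. (max 0 s)\<^sup>2) has_real_derivative 2 * s) (at s)"
      by (rule has_field_derivative_transform_within_open[where S = "{0<..}"]) (use 1 in auto)
    then show ?thesis using 1 by simp
  next
    case 2
    have "((\<lambda>s::real. 0) has_real_derivative 0) (at s)" by simp
    then have "((\<lambda>s::real. (max 0 s)\<^sup>2) has_real_derivative 0) (at s)"
      by (rule has_field_derivative_transform_within_open[where S = "{..<0}"]) (use 2 in auto)
    then show ?thesis using 2 by simp
  next
    case 3
    have "(\<lambda>h::real. (max 0 h)\<^sup>2 / h) \<midarrow>0\<rightarrow> 0"
    proof (rule Lim_null_comparison[where g = abs])
      have "(max 0 h)\<^sup>2 \<le> \<bar>h\<bar> * \<bar>h\<bar>" for h :: real
        by (simp add: max_def power2_eq_square)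
      then show "\<forall>\<^sub>F h in at 0. norm ((max 0 h)\<^sup>2 / h) \<le> \<bar>h :: real\<bar>"
        by (intro eventually_at_ball'[THEN eventually_mono, of 1]) (auto simp: divide_le_eq)
    qed (auto intro!: tendsto_eq_intros)
    with 3 show ?thesis by (simp add: DERIV_def)
  qed
qed

text \<open>The cutoff factor is squared to make it continuously differentiable at the boundary of the ball.\<close>

definition bump_map :: "'b \<Rightarrow> real \<Rightarrow> ('b::euclidean_space \<Rightarrow>\<^sub>L 'b) \<Rightarrow> 'b \<Rightarrow> 'b" where
  "bump_map a r E y = y + (max 0 (1 - (norm (y - a))\<^sup>2 / r\<^sup>2))\<^sup>2 *\<^sub>R E (y - a)"

text \<open>The derivative of \<open>bump_map\<close> minus the identity, by the product rule: the
  rank-one term comes from differentiating the cutoff.\<close>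

definition bump_deriv :: "'b \<Rightarrow> real \<Rightarrow> ('b::euclidean_space \<Rightarrow>\<^sub>L 'b) \<Rightarrow> 'b \<Rightarrow> ('b \<Rightarrow>\<^sub>L 'b)" where
  "bump_deriv a r E y = (max 0 (1 - (norm (y - a))\<^sup>2 / r\<^sup>2))\<^sup>2 *\<^sub>R E
     - (4 / r\<^sup>2 * max 0 (1 - (norm (y - a))\<^sup>2 / r\<^sup>2)) *\<^sub>R rank_one (E (y - a)) (y - a)"

lemma bump_map_center [simp]: "bump_map a r E a = a"
  by (simp add: bump_map_def)

lemma bump_map_outside: "0 < r \<Longrightarrow> y \<notin> cball a r \<Longrightarrow> bump_map a r E y = y"
  by (simp add: bump_map_def dist_norm norm_minus_commute divide_le_eq)

lemma bump_map_has_derivative: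
  "(bump_map a r E has_derivative blinfun_apply (id_blinfun + bump_deriv a r E y)) (at y)"
proof -
  let ?s = "\<lambda>y. 1 - (norm (y - a))\<^sup>2 / r\<^sup>2"
  have "(?s has_derivative (\<lambda>v. - (2 * ((y - a) \<bullet> v)) / r\<^sup>2)) (at y)"
    unfolding power2_norm_eq_inner divide_inverse
    by (auto intro!: derivative_eq_intros simp: inner_commute)
  from has_derivative_compose[OF this max_0_square_has_real_derivative[THEN has_field_derivative_imp_has_derivative]]
  have "((\<lambda>y. (max 0 (?s y))\<^sup>2) has_derivative
      (\<lambda>v. 2 * max 0 (?s y) * (- (2 * ((y - a) \<bullet> v)) / r\<^sup>2))) (at y)" .
  moreover have "((\<lambda>y. E (y - a)) has_derivative (\<lambda>v. E v)) (at y)"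
    by (auto intro!: derivative_eq_intros)
  ultimately have "((\<lambda>y. y + (max 0 (?s y))\<^sup>2 *\<^sub>R E (y - a)) has_derivative
      (\<lambda>v. v + ((max 0 (?s y))\<^sup>2 *\<^sub>R E v
        + (2 * max 0 (?s y) * (- (2 * ((y - a) \<bullet> v)) / r\<^sup>2)) *\<^sub>R E (y - a)))) (at y)"
    by (intro has_derivative_add has_derivative_ident has_derivative_scaleR)
  then have "(bump_map a r E has_derivative
      (\<lambda>v. v + ((max 0 (?s y))\<^sup>2 *\<^sub>R E v
        + (2 * max 0 (?s y) * (- (2 * ((y - a) \<bullet> v)) / r\<^sup>2)) *\<^sub>R E (y - a)))) (at y)"
    by (simp only: bump_map_def[abs_def])
  then show ?thesis
    by (rule has_derivative_eq_rhs)
      (simp add: fun_eq_iff bump_deriv_def blinfun.add_left blinfun.diff_left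
        blinfun.scaleR_left rank_one_apply mult.commute mult.left_commute)
qed

text \<open>The gradient of the cutoff is of order \<open>1 / r\<close> and meets
  \<open>E (y - a)\<close>, which is of order \<open>r\<close>. So the bound, 1 from the cutoff and
  4 from its gradient, does not depend on \<open>r\<close>, and supports can shrink without loss of
  C^1 smallness.\<close>

lemma norm_bump_deriv_le:
  assumes "0 < r"
  shows "norm (bump_deriv a r E y) \<le> 5 * norm E"
proof (cases "norm (y - a) < r")
  case False
  then have "1 - (norm (y - a))\<^sup>2 / r\<^sup>2 \<le> 0" using assms by (simp add: divide_simps power_mono)
  then show ?thesis by (simp add: bump_deriv_def)
next
  case True
  define m where "m = max 0 (1 - (norm (y - a))\<^sup>2 / r\<^sup>2)"
  have m: "0 \<le> m" "m \<le> 1" by (auto simp: m_def)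
  have "norm (rank_one (E (y - a)) (y - a)) \<le> norm E * norm (y - a) * norm (y - a)"
    by (rule order_trans[OF norm_rank_one_le]) (simp add: mult_right_mono norm_blinfun)
  also have "\<dots> \<le> norm E * r * r" using True assms by (intro mult_mono) auto
  finally have R: "norm (rank_one (E (y - a)) (y - a)) \<le> norm E * r * r" .
  have "norm (bump_deriv a r E y) \<le> norm (m\<^sup>2 *\<^sub>R E) + norm ((4 / r\<^sup>2 * m) *\<^sub>R rank_one (E (y - a)) (y - a))"
    unfolding bump_deriv_def m_def by (rule norm_triangle_ineq4)
  also have "\<dots> = m\<^sup>2 * norm E + 4 / r\<^sup>2 * m * norm (rank_one (E (y - a)) (y - a))"
    using m by simp
  also have "\<dots> \<le> 1 * norm E + 4 / r\<^sup>2 * 1 * (norm E * r * r)"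
    using m R by (intro add_mono mult_mono) (auto simp: power_le_one)
  also have "\<dots> = 5 * norm E" using assms by (simp add: power2_eq_square)
  finally show ?thesis .
qed

lemma isCont_bump_deriv: "0 < r \<Longrightarrow> isCont (bump_deriv a r E) y"
  unfolding bump_deriv_def rank_one_def
  by (intro continuous_intros bounded_linear.isCont[OF bounded_linear_blinfun_scaleR_left]
      bounded_linear.isCont[OF bounded_linear_blinfun_inner_right]) auto

lemma bump_deriv_center: "bump_deriv a r E a = E"
  by (simp add: bump_deriv_def)

lemma norm_bump_map_diff_le:
  assumes "0 < r"
  shows "norm (bump_map a r E y - y) \<le> norm E * r"
proof (cases "norm (y - a) < r")
  case False
  then show ?thesis using assms bump_map_outside[of r y a E]
    by (auto simp: bump_map_def dist_norm divide_simps power_mono max_def norm_minus_commute)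
next
  case True
  have "norm (bump_map a r E y - y) = (max 0 (1 - (norm (y - a))\<^sup>2 / r\<^sup>2))\<^sup>2 * norm (E (y - a))"
    by (simp add: bump_map_def)
  also have "\<dots> \<le> 1 * (norm E * norm (y - a))"
    by (intro mult_mono norm_blinfun) (auto intro!: power_le_one)
  also have "\<dots> \<le> norm E * r" using True by (simp add: mult_left_mono)
  finally show ?thesis .
qed

section \<open>Perturbations of diffeomorphisms along finite sets\<close>

context atlas
begin

lemma coords_cong_eventually:
  assumes "c \<in> charts_at A x" "\<forall>\<^sub>F z in nhds x. h z = k z"
  shows "\<forall>\<^sub>F y in nhds (chart_map c x). (chart_map d \<circ> h \<circ> chart_inv c) y = (chart_map d \<circ> k \<circ> chart_inv c) y"
  using eventually_chart_inv[OF assms] by (rule eventually_mono) simp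

lemma isCont_cong_eventually:
  assumes "\<forall>\<^sub>F z in nhds x. h z = k z" "isCont k (x::'a)"
  shows "isCont h x"
  using assms isCont_cong[of h k x] by simp

section \<open>Extending coordinate maps to the manifold by the identity\<close>

definition chart_lift :: "('a, 'b) chart \<Rightarrow> ('b \<Rightarrow> 'b) \<Rightarrow> 'a \<Rightarrow> 'a" where
  "chart_lift c \<Theta> x = (if x \<in> chart_dom c then chart_inv c (\<Theta> (chart_map c x)) else x)"

text \<open>As \<open>B\<close> is compact and inside the coordinate image, the set it describes is
  closed in the whole manifold, and the extension by the identity has no seam at the boundary of the
  chart domain.\<close>

definition supported_in_chart :: "('a, 'b) chart \<Rightarrow> 'b set \<Rightarrow> ('b \<Rightarrow> 'b) \<Rightarrow> bool" where
  "supported_in_chart c B \<Theta> \<longleftrightarrow> c \<in> A \<and> compact B \<and> B \<subseteq> chart_map c ` chart_dom c \<and>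
     bij \<Theta> \<and> (\<forall>y. y \<notin> B \<longrightarrow> \<Theta> y = y)"

lemma supported_in_chart_inv:
  assumes "supported_in_chart c B \<Theta>"
  shows "supported_in_chart c B (inv \<Theta>)"
proof -
  have "inv \<Theta> y = y" if "y \<notin> B" for y
    using assms that unfolding supported_in_chart_def by (metis bij_inv_eq_iff)
  then show ?thesis using assms by (simp add: supported_in_chart_def bij_imp_bij_inv)
qed

text \<open>If \<open>\<Theta> y\<close> left the coordinate image, it would lie outside
  \<open>B\<close> and be fixed by \<open>\<Theta>\<close>; injectivity then forces
  \<open>\<Theta> y = y\<close>.\<close>

lemma supported_in_chart_image:
  assumes "supported_in_chart c B \<Theta>" "y \<in> chart_map c ` chart_dom c"
  shows "\<Theta> y \<in> chart_map c ` chart_dom c"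
proof (rule ccontr)
  assume n: "\<Theta> y \<notin> chart_map c ` chart_dom c"
  then have "\<Theta> y \<notin> B" using assms(1) by (auto simp: supported_in_chart_def)
  then have "\<Theta> (\<Theta> y) = \<Theta> y" using assms(1) by (simp add: supported_in_chart_def)
  then have "\<Theta> y = y" using assms(1) by (metis bij_def injD supported_in_chart_def)
  with n assms(2) show False by simp
qed

lemma chart_lift_in_chart:
  assumes "supported_in_chart c B \<Theta>" "x \<in> chart_dom c"
  shows "chart_lift c \<Theta> x \<in> chart_dom c" "chart_map c (chart_lift c \<Theta> x) = \<Theta> (chart_map c x)"
  using assms supported_in_chart_image[OF assms(1), of "chart_map c x"] chart_inv_in_dom[of c "\<Theta> (chart_map c x)"]
  by (auto simp: chart_lift_def supported_in_chart_def)

lemma chart_lift_outside: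
  assumes "supported_in_chart c B \<Theta>" "x \<notin> chart_inv c ` B"
  shows "chart_lift c \<Theta> x = x"
proof (cases "x \<in> chart_dom c")
  case True
  have "c \<in> A" using assms(1) by (simp add: supported_in_chart_def)
  then have "chart_map c x \<notin> B" using assms(2) True by (metis chart_inv_map imageI)
  then show ?thesis using assms(1) True by (simp add: chart_lift_def supported_in_chart_def)
qed (simp add: chart_lift_def)

lemma chart_lift_compose_inv:
  assumes "supported_in_chart c B \<Theta>"
  shows "chart_lift c (inv \<Theta>) (chart_lift c \<Theta> x) = x"
proof (cases "x \<in> chart_dom c")
  case True
  have "c \<in> A" "inj \<Theta>" using assms by (auto simp: supported_in_chart_def bij_def)
  then show ?thesis
    using chart_lift_in_chart[OF assms True] True by (simp add: chart_lift_def[of c "inv \<Theta>"])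
qed (simp add: chart_lift_def)

lemma compact_chart_inv_image:
  assumes "supported_in_chart c B \<Theta>"
  shows "compact (chart_inv c ` B)"
proof (rule compact_continuous_image)
  show "continuous_on B (chart_inv c)"
    using assms isCont_chart_inv unfolding supported_in_chart_def
    by (meson continuous_at_imp_continuous_on subset_iff)
  show "compact B" using assms by (simp add: supported_in_chart_def)
qed

lemma chart_lift_coords_eventually:
  assumes "supported_in_chart c B \<Theta>" "x \<in> chart_dom c"
  shows "\<forall>\<^sub>F y in nhds (chart_map c x). (chart_map c \<circ> chart_lift c \<Theta> \<circ> chart_inv c) y = \<Theta> y"
proof -
  have c: "c \<in> A" "c \<in> charts_at A x" using assms by (auto simp: supported_in_chart_def charts_at_def)
  show ?thesis
    using eventually_chart_inv[OF c(2), of "\<lambda>_. True"]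
  proof (rule eventually_mono)
    show "(chart_map c \<circ> chart_lift c \<Theta> \<circ> chart_inv c) y = \<Theta> y"
      if "y \<in> chart_map c ` chart_dom c \<and> True" for y
      using that c chart_lift_in_chart(2)[OF assms(1) chart_inv_in_dom[OF c(1)]] by simp
  qed simp
qed

lemma eventually_identity_outside:
  assumes "closed N" "\<forall>y. y \<notin> N \<longrightarrow> \<psi> y = y" "x \<notin> N"
  shows "\<forall>\<^sub>F z in nhds x. \<psi> z = id z"
proof -
  have "\<forall>\<^sub>F z in nhds x. z \<in> - N" using assms by (intro eventually_nhds_in_open) auto
  then show ?thesis by (rule eventually_mono) (use assms(2) in auto)
qed

lemma C1_map_chart_lift:
  assumes "supported_in_chart c B \<Theta>" "\<And>y. C1_at \<Theta> y"
  shows "C1_map A (chart_lift c \<Theta>)"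
proof (rule C1_mapI)
  fix x
  have cA: "c \<in> A" using assms by (auto simp: supported_in_chart_def)
  have outside: "\<forall>\<^sub>F z in nhds x. chart_lift c \<Theta> z = id z" if "x \<notin> chart_dom c"
  proof (rule eventually_identity_outside)
    show "closed (chart_inv c ` B)"
      using compact_chart_inv_image[OF assms(1)] by (rule compact_imp_closed)
    show "\<forall>y. y \<notin> chart_inv c ` B \<longrightarrow> chart_lift c \<Theta> y = y"
      using chart_lift_outside[OF assms(1)] by blast
    show "x \<notin> chart_inv c ` B"
      using assms(1) that chart_inv_in_dom[OF cA] by (auto simp: supported_in_chart_def)
  qed
  show "isCont (chart_lift c \<Theta>) x"
  proof (cases "x \<in> chart_dom c")
    case True
    have "\<forall>\<^sub>F z in nhds x. z \<in> chart_dom c"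
      using True cA open_chart_dom by (intro eventually_nhds_in_open) auto
    then have ev: "\<forall>\<^sub>F z in nhds x. chart_lift c \<Theta> z = chart_inv c (\<Theta> (chart_map c z))"
      by (rule eventually_mono) (simp add: chart_lift_def)
    have "isCont (chart_inv c) (\<Theta> (chart_map c x))"
      using supported_in_chart_image[OF assms(1), of "chart_map c x"] True by (intro isCont_chart_inv cA) auto
    then have "isCont (\<lambda>z. chart_inv c (\<Theta> (chart_map c z))) x"
      by (rule isCont_o2[OF isCont_o2[OF isCont_chart_map[OF cA True] C1_at_imp_isCont[OF assms(2)]]])
    with ev show ?thesis by (rule isCont_cong_eventually)
  next
    case False
    then show ?thesis using isCont_cong_eventually[OF outside] by simp
  qed
  show "\<exists>d\<in>charts_at A x. \<exists>e\<in>charts_at A (chart_lift c \<Theta> x).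
      C1_at (chart_map e \<circ> chart_lift c \<Theta> \<circ> chart_inv d) (chart_map d x)"
  proof (cases "x \<in> chart_dom c")
    case True
    have "\<forall>\<^sub>F y in nhds (chart_map c x). \<Theta> y = (chart_map c \<circ> chart_lift c \<Theta> \<circ> chart_inv c) y"
      using chart_lift_coords_eventually[OF assms(1) True] by (rule eventually_mono) simp
    then have "C1_at (chart_map c \<circ> chart_lift c \<Theta> \<circ> chart_inv c) (chart_map c x)"
      using assms(2) by (rule C1_at_cong)
    then show ?thesis
      using True cA chart_lift_in_chart(1)[OF assms(1) True]
      by (intro bexI[of _ c]) (simp_all add: charts_at_def)
  next
    case False
    obtain d where d: "d \<in> charts_at A x" using smooth_atlas_coversE[OF smooth_atlas] .
    have x: "chart_lift c \<Theta> x = x" using False by (simp add: chart_lift_def)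
    have "\<forall>\<^sub>F z in nhds x. id z = chart_lift c \<Theta> z"
      using outside[OF False] by (rule eventually_mono) simp
    moreover have "C1_at (chart_map d \<circ> id \<circ> chart_inv d) (chart_map d x)"
      using C1_map_imp_C1_at[OF C1_map_id d, of d] d by simp
    ultimately have "C1_at (chart_map d \<circ> chart_lift c \<Theta> \<circ> chart_inv d) (chart_map d x)"
      using C1_at_cong[OF coords_cong_eventually[OF d]] by blast
    then show ?thesis using d x by metis
  qed
qed

lemma chart_lift_in_Diff1:
  assumes "supported_in_chart c B \<Theta>" "\<And>y. C1_at \<Theta> y" "\<And>y. C1_at (inv \<Theta>) y"
  shows "chart_lift c \<Theta> \<in> Diff1 A"
proof -
  have "bij \<Theta>" using assms(1) by (simp add: supported_in_chart_def)
  have eq: "chart_lift c \<Theta> (chart_lift c (inv \<Theta>) x) = x" for x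
    using chart_lift_compose_inv[OF supported_in_chart_inv[OF assms(1)], of x]
    by (simp add: inv_inv_eq[OF \<open>bij \<Theta>\<close>])
  have "inv (chart_lift c \<Theta>) = chart_lift c (inv \<Theta>)"
    using chart_lift_compose_inv[OF assms(1)] eq by (intro inv_equality)
  moreover have "bij (chart_lift c \<Theta>)"
    using chart_lift_compose_inv[OF assms(1)] eq by (intro o_bij[of "chart_lift c (inv \<Theta>)"]) auto
  ultimately show ?thesis
    using C1_map_chart_lift[OF assms(1,2)] C1_map_chart_lift[OF supported_in_chart_inv[OF assms(1)] assms(3)]
    by (simp add: Diff1_def)
qed

end

section \<open>Finite covers by compact pieces of chart domains\<close>

locale atlas_cover = atlas A
  for A :: "('a::{t2_space, second_countable_topology}, 'b::euclidean_space) chart set" +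
  fixes P :: "('a, 'b) chart set" and K :: "('a, 'b) chart \<Rightarrow> 'a set"
  assumes finite_cover: "finite P" and cover_subset: "P \<subseteq> A"
    and cover_compact: "c \<in> P \<Longrightarrow> compact (K c)"
    and cover_in_dom: "c \<in> P \<Longrightarrow> K c \<subseteq> chart_dom c"
    and cover_covers: "\<exists>c\<in>P. x \<in> interior (K c)"

lemma (in atlas) ex_compact_nbhd_in_chart:
  assumes "c \<in> charts_at A x"
  shows "\<exists>N. compact N \<and> N \<subseteq> chart_dom c \<and> x \<in> interior N"
proof -
  note c = charts_atD[OF assms]
  obtain r where r: "0 < r" "cball (chart_map c x) r \<subseteq> chart_map c ` chart_dom c"
    using open_chart_image[OF c(1)] c(2) open_contains_cball by (metis imageI)
  define N where "N = chart_inv c ` cball (chart_map c x) r"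
  have "compact N" unfolding N_def
    using isCont_chart_inv[OF c(1)] r(2)
    by (intro compact_continuous_image continuous_at_imp_continuous_on) auto
  moreover have "N \<subseteq> chart_dom c"
    using r(2) chart_inv_in_dom[OF c(1)] by (auto simp: N_def)
  moreover have "\<forall>\<^sub>F z in nhds x. z \<in> N"
  proof -
    have "\<forall>\<^sub>F y in nhds (chart_map c x). y \<in> ball (chart_map c x) r"
      using r(1) by (intro eventually_nhds_in_open) auto
    from eventually_chart_map[OF assms this] show ?thesis
    proof (rule eventually_mono)
      fix z assume z: "z \<in> chart_dom c \<and> chart_map c z \<in> ball (chart_map c x) r"
      then have "chart_inv c (chart_map c z) \<in> N" unfolding N_def by (intro imageI) auto
      with z c(1) show "z \<in> N" by simp
    qed
  qed
  then have "x \<in> interior N" unfolding eventually_nhds interior_def by blast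
  ultimately show ?thesis by blast
qed

lemma ex_atlas_cover:
  fixes A :: "('a::{t2_space, second_countable_topology}, 'b::euclidean_space) chart set"
  assumes "smooth_atlas A" "compact (UNIV :: 'a set)"
  shows "\<exists>P K. atlas_cover A P K"
proof -
  interpret atlas A by unfold_locales (rule assms(1))
  have "\<exists>c N. c \<in> charts_at A x \<and> compact N \<and> N \<subseteq> chart_dom c \<and> x \<in> interior N" for x
    using smooth_atlas_coversE[OF assms(1), of x] ex_compact_nbhd_in_chart by metis
  then obtain c N where c: "\<And>x. c x \<in> charts_at A x" and N: "\<And>x. compact (N x)"
      "\<And>x. N x \<subseteq> chart_dom (c x)" "\<And>x. x \<in> interior (N x)"
    by metis
  obtain F where F: "finite F" "UNIV \<subseteq> (\<Union>x\<in>F. interior (N x))"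
  proof (rule compactE_image[OF assms(2), of UNIV "\<lambda>x. interior (N x)"])
    show "UNIV \<subseteq> (\<Union>x. interior (N x))" using N(3) by blast
  qed auto
  \<comment> \<open>Several points may have been given the same chart; \<open>K d\<close> collects
    all their neighbourhoods.\<close>
  define K where "K = (\<lambda>d. \<Union>x\<in>{x\<in>F. c x = d}. N x)"
  have "atlas_cover A (c ` F) K"
  proof unfold_locales
    show "finite (c ` F)" using F by simp
    show "c ` F \<subseteq> A" using c charts_atD by blast
    show "compact (K d)" for d unfolding K_def using F N by (intro compact_UN) auto
    show "K d \<subseteq> chart_dom d" for d using N(2) by (auto simp: K_def)
    fix x
    obtain y where y: "y \<in> F" "x \<in> interior (N y)" using F by blast
    then have "N y \<subseteq> K (c y)" by (auto simp: K_def)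
    then have "x \<in> interior (K (c y))" using y interior_mono by blast
    then show "\<exists>d\<in>c ` F. x \<in> interior (K d)" using y by blast
  qed
  then show ?thesis by blast
qed

context atlas_cover
begin

text \<open>The chart in which all local estimates at a point are made. Estimates that are uniform on each
  of the finitely many compact sets \<open>K c\<close> are thereby uniform on the whole manifold, although
  \<open>cover_chart\<close> is not locally constant.\<close>

definition cover_chart :: "'a \<Rightarrow> ('a, 'b) chart" where
  "cover_chart x = (SOME c. c \<in> P \<and> x \<in> interior (K c))"

lemma cover_chart: "cover_chart x \<in> P" "x \<in> interior (K (cover_chart x))"
  using someI_ex[of "\<lambda>c. c \<in> P \<and> x \<in> interior (K c)"] cover_covers[of x]
  unfolding cover_chart_def by blast+

lemma cover_chart_in_K: "x \<in> K (cover_chart x)"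
  using cover_chart(2) interior_subset by blast

lemma cover_chart_in_charts_at [simp]: "cover_chart x \<in> charts_at A x"
  using cover_chart(1)[of x] cover_chart_in_K[of x] cover_subset cover_in_dom[of "cover_chart x"]
  unfolding charts_at_def by blast

text \<open>C^1 closeness to the identity, read in some chart of the cover whose compact piece
  contains \<open>x\<close>. Any one such chart will do, so a bump has to be estimated only in the
  chart in which it was built.\<close>

definition near_id_at :: "real \<Rightarrow> ('a \<Rightarrow> 'a) \<Rightarrow> 'a \<Rightarrow> bool" where
  "near_id_at \<delta> \<psi> x \<longleftrightarrow> (\<exists>q\<in>P. x \<in> K q \<and> \<psi> x \<in> chart_dom q \<and>
     norm (chart_map q (\<psi> x) - chart_map q x) \<le> \<delta> \<and>
     norm (bderiv (chart_map q \<circ> \<psi> \<circ> chart_inv q) (chart_map q x) - id_blinfun) \<le> \<delta>)"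

lemma near_id_at_mono: "near_id_at \<delta> \<psi> x \<Longrightarrow> \<delta> \<le> \<delta>' \<Longrightarrow> near_id_at \<delta>' \<psi> x"
  unfolding near_id_at_def by fastforce

lemma cover_charts_at: "q \<in> P \<Longrightarrow> x \<in> K q \<Longrightarrow> q \<in> charts_at A x"
  using cover_subset cover_in_dom[of q] unfolding charts_at_def by blast

lemma near_id_at_cong:
  assumes "near_id_at \<delta> \<psi> x" "\<forall>\<^sub>F z in nhds x. \<psi> z = \<psi>' z"
  shows "near_id_at \<delta> \<psi>' x"
proof -
  obtain q where q: "q \<in> P" "x \<in> K q" "\<psi> x \<in> chart_dom q"
    "norm (chart_map q (\<psi> x) - chart_map q x) \<le> \<delta>"
    "norm (bderiv (chart_map q \<circ> \<psi> \<circ> chart_inv q) (chart_map q x) - id_blinfun) \<le> \<delta>"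
    using assms(1) unfolding near_id_at_def by blast
  have "\<psi> x = \<psi>' x" using eventually_nhds_x_imp_x[OF assms(2)] .
  moreover have "bderiv (chart_map q \<circ> \<psi> \<circ> chart_inv q) (chart_map q x) =
      bderiv (chart_map q \<circ> \<psi>' \<circ> chart_inv q) (chart_map q x)"
    using cover_charts_at[OF q(1,2)] assms(2) by (intro bderiv_cong coords_cong_eventually)
  ultimately show ?thesis using q unfolding near_id_at_def by (intro bexI[of _ q]) auto
qed

lemma bderiv_coords_id:
  assumes "c \<in> charts_at A x"
  shows "bderiv (chart_map c \<circ> id \<circ> chart_inv c) (chart_map c x) = id_blinfun"
proof -
  have "\<forall>\<^sub>F y in nhds (chart_map c x). (chart_map c \<circ> id \<circ> chart_inv c) y = y"
    using eventually_chart_inv[OF assms, of "\<lambda>_. True"] charts_atD[OF assms]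
    by (auto elim!: eventually_mono)
  then show ?thesis using bderiv_cong bderiv_id by metis
qed

lemma near_id_at_id: "0 \<le> \<delta> \<Longrightarrow> near_id_at \<delta> id x"
  unfolding near_id_at_def
  using cover_chart(1)[of x] cover_chart_in_K[of x] charts_atD[OF cover_chart_in_charts_at[of x]]
    bderiv_coords_id[OF cover_chart_in_charts_at[of x]]
  by (intro bexI[of _ "cover_chart x"]) simp_all

lemma near_id_at_outside:
  assumes "0 \<le> \<delta>" "closed N" "\<forall>y. y \<notin> N \<longrightarrow> \<psi> y = y" "x \<notin> N"
  shows "near_id_at \<delta> \<psi> x"
proof (rule near_id_at_cong[OF near_id_at_id[OF assms(1)]])
  show "\<forall>\<^sub>F z in nhds x. id z = \<psi> z"
    using eventually_identity_outside[of N \<psi> x, OF assms(2,3,4)] by (rule eventually_mono) (rule sym)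
qed

text \<open>A bump in a coordinate ball inside \<open>W\<close> and \<open>K c\<close>, lifted to
  the manifold. Its derivative differs from the identity by at most \<open>5 * norm E\<close>: the
  bound 1/10 on \<open>norm E\<close> brings this to 1/2, which makes it a diffeomorphism, and the
  bound \<open>\<delta>/5\<close> brings it to \<delta>.\<close>

lemma ex_perturbation_at_point:
  assumes "0 < \<delta>" "norm E \<le> 1/10" "norm E \<le> \<delta>/5" and W: "open W" "x \<in> W"
  shows "\<exists>\<psi> N. \<psi> \<in> Diff1 A \<and> closed N \<and> N \<subseteq> W \<and> (\<forall>y. y \<notin> N \<longrightarrow> \<psi> y = y) \<and>
    (\<forall>y. near_id_at \<delta> \<psi> y) \<and> \<psi> x = x \<and>
    bderiv (chart_map (cover_chart x) \<circ> \<psi> \<circ> chart_inv (cover_chart x)) (chart_map (cover_chart x) x)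
      = id_blinfun + E"
proof -
  define c where "c = cover_chart x"
  have c: "c \<in> charts_at A x" "c \<in> P" "x \<in> interior (K c)"
    using cover_chart by (simp_all add: c_def)
  note cA = charts_atD[OF c(1)]
  define a where "a = chart_map c x"
  have "open (chart_map c ` (chart_dom c \<inter> (W \<inter> interior (K c))))"
    using W by (intro open_chart_map_image cA) auto
  moreover have "a \<in> chart_map c ` (chart_dom c \<inter> (W \<inter> interior (K c)))"
    using cA c W by (auto simp: a_def)
  ultimately obtain r0 where r0: "0 < r0" "cball a r0 \<subseteq> chart_map c ` (chart_dom c \<inter> (W \<inter> interior (K c)))"
    using open_contains_cball by metis
  \<comment> \<open>A radius at most 1 keeps the displacement, which is at most
    \<open>norm E * r\<close>, below \<delta> as well.\<close>
  define r where "r = min r0 1"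
  have r: "0 < r" "r \<le> 1" "cball a r \<subseteq> chart_map c ` (chart_dom c \<inter> (W \<inter> interior (K c)))"
    using r0 by (auto simp: r_def)
  define \<Theta> where "\<Theta> = bump_map a r E"
  have small: "norm (bump_deriv a r E y) \<le> 1/2" for y
    using norm_bump_deriv_le[OF r(1), where a = a and E = E and y = y] assms(2) by simp
  have deriv: "(\<Theta> has_derivative blinfun_apply (id_blinfun + bump_deriv a r E y)) (at y)" for y
    unfolding \<Theta>_def by (rule bump_map_has_derivative)
  note cont = isCont_bump_deriv[OF r(1), where a = a and E = E]
  have C1: "C1_at \<Theta> y" "C1_at (inv \<Theta>) y" and "bij \<Theta>" for y
    using C1_at_near_id[OF deriv small cont] C1_at_inv_near_id[OF deriv small cont]
      bij_near_id[OF deriv small cont] by auto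
  then have supp: "supported_in_chart c (cball a r) \<Theta>"
    using cA r bump_map_outside[OF r(1), where a = a and E = E] by (auto simp: supported_in_chart_def \<Theta>_def)
  define \<psi> where "\<psi> = chart_lift c \<Theta>"
  define N where "N = chart_inv c ` cball a r"
  have "closed N"
    unfolding N_def using compact_chart_inv_image[OF supp] by (rule compact_imp_closed)
  have N: "N \<subseteq> W" "N \<subseteq> K c" "N \<subseteq> chart_dom c"
    using r(3) cA(1) interior_subset[of "K c"] by (fastforce simp: N_def)+
  have off: "\<psi> y = y" if "y \<notin> N" for y
    using chart_lift_outside[OF supp] that by (simp add: \<psi>_def N_def)
  have bd: "bderiv (chart_map c \<circ> \<psi> \<circ> chart_inv c) (chart_map c y) = id_blinfun + bump_deriv a r E (chart_map c y)"
    if "y \<in> chart_dom c" for y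
    unfolding \<psi>_def
    by (rule trans[OF bderiv_cong[OF chart_lift_coords_eventually[OF supp that]] bderiv_eqI[OF deriv]])
  have near: "near_id_at \<delta> \<psi> y" for y
  proof (cases "y \<in> N")
    case True
    then have y: "y \<in> chart_dom c" using N by blast
    have "norm (\<Theta> (chart_map c y) - chart_map c y) \<le> norm E * r"
      unfolding \<Theta>_def by (rule norm_bump_map_diff_le[OF r(1)])
    also have "\<dots> \<le> \<delta> * 1" using assms r by (intro mult_mono) auto
    finally have "norm (chart_map c (\<psi> y) - chart_map c y) \<le> \<delta>"
      using chart_lift_in_chart(2)[OF supp y] by (simp add: \<psi>_def)
    moreover have "norm (bderiv (chart_map c \<circ> \<psi> \<circ> chart_inv c) (chart_map c y) - id_blinfun) \<le> \<delta>"
      using norm_bump_deriv_le[OF r(1), where a = a and E = E and y = "chart_map c y"] assms(3) by (simp add: bd[OF y])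
    ultimately show ?thesis
      unfolding near_id_at_def
      using c(2) True N chart_lift_in_chart(1)[OF supp y] by (auto simp: \<psi>_def intro!: bexI[of _ c])
  next
    case False
    then show ?thesis using assms(1) \<open>closed N\<close> off by (intro near_id_at_outside[of _ N]) auto
  qed
  have "\<psi> x = x" using cA by (simp add: \<psi>_def chart_lift_def \<Theta>_def a_def[symmetric]) (simp add: a_def)
  moreover have "bderiv (chart_map c \<circ> \<psi> \<circ> chart_inv c) (chart_map c x) = id_blinfun + E"
    using bd[OF cA(2)] by (simp add: a_def[symmetric] bump_deriv_center)
  moreover have "\<psi> \<in> Diff1 A"
    unfolding \<psi>_def by (rule chart_lift_in_Diff1[OF supp C1])
  ultimately show ?thesis
    using \<open>closed N\<close> N off near unfolding c_def[symmetric] by blast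
qed

text \<open>The supports are disjoint, so near each point the composition agrees with a single
  perturbation or with the identity. Hence \<delta> does not grow with the number of points, which
  is what allows orbits of any length.\<close>

lemma ex_perturbation_at_finite_set:
  assumes "finite X" "0 < \<delta>" and E: "\<And>x. x \<in> X \<Longrightarrow> norm (E x) \<le> 1/10 \<and> norm (E x) \<le> \<delta>/5"
    and W: "\<And>x. x \<in> X \<Longrightarrow> open (W x) \<and> x \<in> W x" "disjoint_family_on W X"
  shows "\<exists>\<psi> N. \<psi> \<in> Diff1 A \<and> closed N \<and> N \<subseteq> (\<Union>x\<in>X. W x) \<and> (\<forall>y. y \<notin> N \<longrightarrow> \<psi> y = y) \<and>
    (\<forall>y. near_id_at \<delta> \<psi> y) \<and> (\<forall>x\<in>X. \<psi> x = x \<and>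
    bderiv (chart_map (cover_chart x) \<circ> \<psi> \<circ> chart_inv (cover_chart x)) (chart_map (cover_chart x) x)
      = id_blinfun + E x)"
  using assms(1) E W
proof (induction X)
  case empty
  show ?case
    using \<open>0 < \<delta>\<close>
    by (intro exI[of _ id] exI[of _ "{}"] conjI id_in_Diff1 near_id_at_id allI ballI impI) simp_all
next
  case (insert x X)
  have "disjoint_family_on W X" using insert.prems(3) by (auto simp: disjoint_family_on_def)
  then have "\<exists>\<psi> N. \<psi> \<in> Diff1 A \<and> closed N \<and> N \<subseteq> (\<Union>x\<in>X. W x) \<and> (\<forall>y. y \<notin> N \<longrightarrow> \<psi> y = y) \<and>
      (\<forall>y. near_id_at \<delta> \<psi> y) \<and> (\<forall>x\<in>X. \<psi> x = x \<and>
      bderiv (chart_map (cover_chart x) \<circ> \<psi> \<circ> chart_inv (cover_chart x)) (chart_map (cover_chart x) x)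
        = id_blinfun + E x)"
    using insert.prems by (intro insert.IH) simp_all
  then obtain \<psi> N where \<psi>: "\<psi> \<in> Diff1 A" "closed N" "N \<subseteq> (\<Union>x\<in>X. W x)" "\<forall>y. y \<notin> N \<longrightarrow> \<psi> y = y"
    "\<And>y. near_id_at \<delta> \<psi> y" and \<psi>_fix: "\<And>z. z \<in> X \<Longrightarrow> \<psi> z = z"
    and \<psi>_deriv: "\<And>z. z \<in> X \<Longrightarrow> bderiv (chart_map (cover_chart z) \<circ> \<psi> \<circ> chart_inv (cover_chart z))
      (chart_map (cover_chart z) z) = id_blinfun + E z"
    by blast
  have Ex: "norm (E x) \<le> 1/10" "norm (E x) \<le> \<delta>/5" "open (W x)" "x \<in> W x"
    using insert.prems(1,2) by simp_all
  obtain \<phi> M where \<phi>: "\<phi> \<in> Diff1 A" "closed M" "M \<subseteq> W x" "\<forall>y. y \<notin> M \<longrightarrow> \<phi> y = y"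
    "\<And>y. near_id_at \<delta> \<phi> y" and \<phi>_fix: "\<phi> x = x"
    and \<phi>_deriv: "bderiv (chart_map (cover_chart x) \<circ> \<phi> \<circ> chart_inv (cover_chart x))
      (chart_map (cover_chart x) x) = id_blinfun + E x"
    using ex_perturbation_at_point[OF \<open>0 < \<delta>\<close> Ex] by blast
  have disj: "W x \<inter> W z = {}" if "z \<in> X" for z
    using insert.prems(3) insert.hyps(2) that by (auto simp: disjoint_family_on_def)
  \<comment> \<open>\<open>\<phi>\<close> is injective and fixes everything off \<open>M\<close>, so
    it maps \<open>W x\<close> into itself, and \<open>\<psi>\<close> is the identity there.\<close>
  have on_W: "\<forall>\<^sub>F z in nhds y. \<phi> z = (\<psi> \<circ> \<phi>) z" if "y \<in> W x" for y
  proof -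
    have "\<phi> z \<in> W x" if "z \<in> W x" for z
    proof (rule ccontr)
      assume "\<phi> z \<notin> W x"
      then have "\<phi> (\<phi> z) = \<phi> z" using \<phi>(3,4) by blast
      moreover have "inj \<phi>" using \<phi>(1) by (simp add: Diff1_def bij_def)
      ultimately have "\<phi> z = z" by (metis injD)
      then show False using that \<open>\<phi> z \<notin> W x\<close> by simp
    qed
    moreover have "\<psi> z = z" if "z \<in> W x" for z
    proof -
      have "z \<notin> N" using \<psi>(3) disj that by blast
      then show ?thesis using \<psi>(4) by blast
    qed
    ultimately have eq: "\<phi> z = (\<psi> \<circ> \<phi>) z" if "z \<in> W x" for z
      using that by simp
    have "\<forall>\<^sub>F z in nhds y. z \<in> W x"
      using that insert.prems(2) by (intro eventually_nhds_in_open) auto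
    then show ?thesis by (rule eventually_mono) (rule eq)
  qed
  have off_W: "\<forall>\<^sub>F z in nhds y. \<psi> z = (\<psi> \<circ> \<phi>) z" if "y \<notin> M" for y
    using eventually_identity_outside[OF \<phi>(2,4) that] by (rule eventually_mono) simp
  have near: "near_id_at \<delta> (\<psi> \<circ> \<phi>) y" for y
    using near_id_at_cong[OF \<phi>(5) on_W] near_id_at_cong[OF \<psi>(5) off_W] \<phi>(3) by blast
  have "(\<psi> \<circ> \<phi>) z = z \<and> bderiv (chart_map (cover_chart z) \<circ> (\<psi> \<circ> \<phi>) \<circ> chart_inv (cover_chart z))
      (chart_map (cover_chart z) z) = id_blinfun + E z" if "z \<in> insert x X" for z
  proof (cases "z = x")
    case True
    have x: "x \<in> W x" using insert.prems(2) by simp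
    have "(\<psi> \<circ> \<phi>) x = x" using eventually_nhds_x_imp_x[OF on_W[OF x]] \<phi>_fix by metis
    then show ?thesis
      unfolding True \<phi>_deriv[symmetric]
      using bderiv_cong[OF coords_cong_eventually[OF cover_chart_in_charts_at on_W[OF x]], symmetric] by blast
  next
    case False
    then have z: "z \<in> X" "z \<in> W z" using that insert.prems(2) by auto
    then have "z \<notin> M" using disj[of z] \<phi>(3) by blast
    note ev = off_W[OF this]
    have "(\<psi> \<circ> \<phi>) z = z" using eventually_nhds_x_imp_x[OF ev] \<psi>_fix[OF z(1)] by metis
    then show ?thesis
      unfolding \<psi>_deriv[OF z(1), symmetric]
      using bderiv_cong[OF coords_cong_eventually[OF cover_chart_in_charts_at ev], symmetric] by blast
  qed
  moreover have "closed (N \<union> M)" "N \<union> M \<subseteq> (\<Union>x\<in>insert x X. W x)" using \<psi> \<phi> by auto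
  moreover have "(\<psi> \<circ> \<phi>) y = y" if "y \<notin> N \<union> M" for y using that \<psi>(4) \<phi>(4) by simp
  moreover have "\<psi> \<circ> \<phi> \<in> Diff1 A" using \<psi>(1) \<phi>(1) by (intro Diff1_compose)
  ultimately show ?case using near by blast
qed

lemma ex_disjoint_neighbourhoods:
  assumes "finite (X :: 'a set)"
  shows "\<exists>W. (\<forall>x\<in>X. open (W x) \<and> x \<in> W x) \<and> disjoint_family_on W X"
proof -
  have "\<exists>U V. x \<noteq> y \<longrightarrow> open U \<and> open V \<and> x \<in> U \<and> y \<in> V \<and> U \<inter> V = {}" for x y :: 'a
    by (metis hausdorff)
  then obtain U V where UV: "\<And>x y :: 'a. x \<noteq> y \<Longrightarrow>
      open (U x y) \<and> open (V x y) \<and> x \<in> U x y \<and> y \<in> V x y \<and> U x y \<inter> V x y = {}"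
    by metis
  \<comment> \<open>The separating sets for \<open>(x, y)\<close> and \<open>(y, x)\<close> are
    chosen independently, so \<open>W x\<close> has to lie in a set of either choice.\<close>
  define W where "W = (\<lambda>x. \<Inter>y\<in>X - {x}. U x y \<inter> V y x)"
  have "open (W x) \<and> x \<in> W x" if "x \<in> X" for x
  proof -
    have "open (U x y \<inter> V y x) \<and> x \<in> U x y \<inter> V y x" if "y \<in> X - {x}" for y
      using UV[of x y] UV[of y x] that by auto
    then show ?thesis using assms unfolding W_def by (intro conjI open_INT) auto
  qed
  moreover have "W x \<inter> W y = {}" if "x \<in> X" "y \<in> X" "x \<noteq> y" for x y
  proof -
    have "W x \<subseteq> U x y" "W y \<subseteq> V x y" using that by (auto simp: W_def)
    then show ?thesis using UV[OF that(3)] by blast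
  qed
  ultimately show ?thesis by (intro exI[of _ W]) (auto simp: disjoint_family_on_def)
qed


text \<open>In coordinates, composing with \<open>\<psi>\<close> replaces the derivative \<open>H (q x)\<close> of \<open>f\<close> by
  \<open>H z \<circ> D \<circ> T x\<close>, where \<open>z = q (\<psi> x)\<close>, \<open>D\<close> is the derivative of \<open>\<psi>\<close> and \<open>T\<close> that of the
  change of charts. This is continuous in \<open>(z, D, x)\<close>, so a strict inequality persists.\<close>

lemma near_id_preserves_closeness_in_chart:
  assumes f: "C1_map A f" and h: "C1_map A h"
    and c: "c \<in> charts_at A p" and d: "d \<in> charts_at A (f p)" "d \<in> charts_at A (h p)"
    and lt: "norm (chart_map d (f p) - chart_map d (h p)) < \<epsilon>"
      "norm (bderiv (chart_map d \<circ> f \<circ> chart_inv c) (chart_map c p)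
        - bderiv (chart_map d \<circ> h \<circ> chart_inv c) (chart_map c p)) < \<epsilon>"
    and q: "q \<in> P"
  shows "\<exists>\<delta>>0. \<exists>W. open W \<and> p \<in> W \<and> (\<forall>\<psi> x. C1_map A \<psi> \<longrightarrow> x \<in> W \<longrightarrow> x \<in> K q \<longrightarrow> \<psi> x \<in> chart_dom q \<longrightarrow>
      norm (chart_map q (\<psi> x) - chart_map q x) \<le> \<delta> \<longrightarrow>
      norm (bderiv (chart_map q \<circ> \<psi> \<circ> chart_inv q) (chart_map q x) - id_blinfun) \<le> \<delta> \<longrightarrow>
      f (\<psi> x) \<in> chart_dom d \<and> norm (chart_map d (f (\<psi> x)) - chart_map d (h x)) < \<epsilon> \<and>
      norm (bderiv (chart_map d \<circ> (f \<circ> \<psi>) \<circ> chart_inv c) (chart_map c x)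
        - bderiv (chart_map d \<circ> h \<circ> chart_inv c) (chart_map c x)) < \<epsilon>)"
proof (cases "p \<in> K q")
  case False
  \<comment> \<open>\<open>K q\<close> is closed, so the points near \<open>p\<close> avoid it and
    the claim is vacuous there.\<close>
  have "open (- K q)" using cover_compact[OF q] by (simp add: compact_imp_closed open_Compl)
  with False show ?thesis by (intro exI[of _ "1::real"] conjI exI[of _ "- K q"]) auto
next
  case True
  note qp = cover_charts_at[OF q True]
  note qA = charts_atD[OF qp] and cA = charts_atD[OF c] and dA = charts_atD[OF d(1)] charts_atD(2)[OF d(2)]
  define H where "H = bderiv (chart_map d \<circ> f \<circ> chart_inv q)"
  define T where "T = bderiv (chart_map q \<circ> id \<circ> chart_inv c)"
  define G where "G = bderiv (chart_map d \<circ> h \<circ> chart_inv c)"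
  have contH: "isCont H (chart_map q p)"
    unfolding H_def using C1_map_imp_C1_at[OF f qp d(1)] by (rule C1_at_imp_isCont_bderiv)
  have contT: "isCont T (chart_map c p)"
    unfolding T_def using C1_map_imp_C1_at[OF C1_map_id c, of q] qp by (simp add: C1_at_imp_isCont_bderiv)
  have contG: "isCont G (chart_map c p)"
    unfolding G_def using C1_map_imp_C1_at[OF h c d(2)] by (rule C1_at_imp_isCont_bderiv)
  have HT: "H (chart_map q p) o\<^sub>L T (chart_map c p) = bderiv (chart_map d \<circ> f \<circ> chart_inv c) (chart_map c p)"
    using bderiv_coords_compose[where h = id and k = f and x = p and c = c and e = q and d = d]
      C1_map_imp_C1_at[OF C1_map_id c, of q] C1_map_imp_C1_at[OF f qp d(1)] c qp
    by (simp add: H_def T_def)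
  \<comment> \<open>The image point, the derivative of \<open>\<psi>\<close> and the base point are
    treated as independent variables, so that one \<delta> serves all \<open>\<psi>\<close> at
    once.\<close>
  define F where "F = nhds (chart_map q p) \<times>\<^sub>F (nhds (id_blinfun :: 'b \<Rightarrow>\<^sub>L 'b) \<times>\<^sub>F nhds p)"
  have lim_z: "filterlim fst (nhds (chart_map q p)) F"
    unfolding F_def by (rule filterlim_fst)
  have lim_D: "((\<lambda>t. fst (snd t)) \<longlongrightarrow> id_blinfun) F"
    unfolding F_def by (rule filterlim_compose[OF filterlim_fst filterlim_snd])
  have lim_x: "((\<lambda>t. snd (snd t)) \<longlongrightarrow> p) F"
    unfolding F_def by (rule filterlim_compose[OF filterlim_snd filterlim_snd])
  have lim_cx: "((\<lambda>t. chart_map c (snd (snd t))) \<longlongrightarrow> chart_map c p) F"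
    by (rule isCont_tendsto_compose[OF isCont_chart_map[OF cA] lim_x])
  have "isCont (chart_inv q) (chart_map q p)" using qA by (intro isCont_chart_inv) auto
  from isCont_tendsto_compose[OF this lim_z]
  have lim_qz: "((\<lambda>t. chart_inv q (fst t)) \<longlongrightarrow> p) F" using qA by simp
  have lim_f: "((\<lambda>t. f (chart_inv q (fst t))) \<longlongrightarrow> f p) F"
    by (rule isCont_tendsto_compose[OF C1_map_imp_isCont[OF f] lim_qz])
  have lim_h: "((\<lambda>t. h (snd (snd t))) \<longlongrightarrow> h p) F"
    by (rule isCont_tendsto_compose[OF C1_map_imp_isCont[OF h] lim_x])
  have E1: "\<forall>\<^sub>F t in F. f (chart_inv q (fst t)) \<in> chart_dom d"
    using topological_tendstoD[OF lim_f open_chart_dom] dA by blast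
  have E2: "\<forall>\<^sub>F t in F. norm (chart_map d (f (chart_inv q (fst t))) - chart_map d (h (snd (snd t)))) < \<epsilon>"
    by (rule order_tendstoD(2)[OF _ lt(1)])
      (intro tendsto_intros isCont_tendsto_compose[OF isCont_chart_map lim_f]
        isCont_tendsto_compose[OF isCont_chart_map lim_h] dA)
  have "norm ((H (chart_map q p) o\<^sub>L id_blinfun o\<^sub>L T (chart_map c p)) - G (chart_map c p)) < \<epsilon>"
    using lt(2) HT blinfun_compose_id_right[of "H (chart_map q p)"] by (simp add: G_def)
  then have E3: "\<forall>\<^sub>F t in F. norm ((H (fst t) o\<^sub>L fst (snd t) o\<^sub>L T (chart_map c (snd (snd t))))
      - G (chart_map c (snd (snd t)))) < \<epsilon>"
    by (rule order_tendstoD(2)[rotated])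
      (intro tendsto_intros isCont_tendsto_compose[OF contH lim_z] lim_D
        isCont_tendsto_compose[OF contT lim_cx] isCont_tendsto_compose[OF contG lim_cx])
  have E4: "\<forall>\<^sub>F t in F. snd (snd t) \<in> chart_dom c"
    using topological_tendstoD[OF lim_x open_chart_dom] cA by blast
  have "\<forall>\<^sub>F t in F. f (chart_inv q (fst t)) \<in> chart_dom d \<and>
      norm (chart_map d (f (chart_inv q (fst t))) - chart_map d (h (snd (snd t)))) < \<epsilon> \<and>
      norm ((H (fst t) o\<^sub>L fst (snd t) o\<^sub>L T (chart_map c (snd (snd t)))) - G (chart_map c (snd (snd t)))) < \<epsilon> \<and>
      snd (snd t) \<in> chart_dom c"
    using E1 E2 E3 E4 by eventually_elim simp
  then obtain Pz Pd Px where ev: "eventually Pz (nhds (chart_map q p))" "eventually Pd (nhds id_blinfun)"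
      "eventually Px (nhds p)"
    and P: "\<And>z D x. Pz z \<Longrightarrow> Pd D \<Longrightarrow> Px x \<Longrightarrow> f (chart_inv q z) \<in> chart_dom d \<and>
      norm (chart_map d (f (chart_inv q z)) - chart_map d (h x)) < \<epsilon> \<and>
      norm ((H z o\<^sub>L D o\<^sub>L T (chart_map c x)) - G (chart_map c x)) < \<epsilon> \<and> x \<in> chart_dom c"
    unfolding F_def eventually_prod_filter by fastforce
  obtain e1 where e1: "0 < e1" "\<And>z. norm (z - chart_map q p) < e1 \<Longrightarrow> Pz z"
    using ev(1) unfolding eventually_nhds_metric dist_norm by blast
  obtain e2 where e2: "0 < e2" "\<And>D. norm (D - id_blinfun) < e2 \<Longrightarrow> Pd D"
    using ev(2) unfolding eventually_nhds_metric dist_norm by blast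
  have "\<forall>\<^sub>F x in nhds p. chart_map q x \<in> ball (chart_map q p) (e1/2)"
    using isCont_eventually_mem[OF isCont_chart_map[OF qA], of "ball (chart_map q p) (e1/2)"] e1(1) by simp
  with ev(3) have "\<forall>\<^sub>F x in nhds p. Px x \<and> chart_map q x \<in> ball (chart_map q p) (e1/2)"
    by (rule eventually_conj)
  then obtain W where W: "open W" "p \<in> W" "\<And>x. x \<in> W \<Longrightarrow> Px x"
      "\<And>x. x \<in> W \<Longrightarrow> norm (chart_map q x - chart_map q p) < e1/2"
    unfolding eventually_nhds by (auto simp: dist_norm norm_minus_commute)
  define \<delta> where "\<delta> = min (e1/2) (e2/2)"
  have \<delta>: "0 < \<delta>" "\<delta> \<le> e1/2" "\<delta> < e2" using e1 e2 by (auto simp: \<delta>_def)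
  have "f (\<psi> x) \<in> chart_dom d \<and> norm (chart_map d (f (\<psi> x)) - chart_map d (h x)) < \<epsilon> \<and>
      norm (bderiv (chart_map d \<circ> (f \<circ> \<psi>) \<circ> chart_inv c) (chart_map c x)
        - bderiv (chart_map d \<circ> h \<circ> chart_inv c) (chart_map c x)) < \<epsilon>"
    if \<psi>: "C1_map A \<psi>" and x: "x \<in> W" "x \<in> K q" "\<psi> x \<in> chart_dom q"
      and near: "norm (chart_map q (\<psi> x) - chart_map q x) \<le> \<delta>"
        "norm (bderiv (chart_map q \<circ> \<psi> \<circ> chart_inv q) (chart_map q x) - id_blinfun) \<le> \<delta>" for \<psi> x
  proof -
    define D where "D = bderiv (chart_map q \<circ> \<psi> \<circ> chart_inv q) (chart_map q x)"
    have "norm (chart_map q (\<psi> x) - chart_map q p) \<le>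
        norm (chart_map q (\<psi> x) - chart_map q x) + norm (chart_map q x - chart_map q p)"
      using norm_triangle_ineq[of "chart_map q (\<psi> x) - chart_map q x" "chart_map q x - chart_map q p"] by simp
    also have "\<dots> < e1" using near(1) \<delta>(2) W(4)[OF x(1)] by simp
    finally have "Pz (chart_map q (\<psi> x))" by (rule e1(2))
    moreover have "Pd D" using near(2) \<delta>(3) by (intro e2(2)) (simp add: D_def)
    ultimately have concl: "f (\<psi> x) \<in> chart_dom d"
      "norm (chart_map d (f (\<psi> x)) - chart_map d (h x)) < \<epsilon>"
      "norm ((H (chart_map q (\<psi> x)) o\<^sub>L D o\<^sub>L T (chart_map c x)) - G (chart_map c x)) < \<epsilon>" "x \<in> chart_dom c"
      using P[OF _ _ W(3)[OF x(1)]] qA(1) x(3) by force+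
    have cx: "c \<in> charts_at A x" and qx: "q \<in> charts_at A x" and q\<psi>: "q \<in> charts_at A (\<psi> x)"
      and df: "d \<in> charts_at A (f (\<psi> x))"
      using concl cA dA qA x cover_charts_at[OF q] by (auto simp: charts_at_def)
    have "bderiv (chart_map q \<circ> (\<psi> \<circ> id) \<circ> chart_inv c) (chart_map c x) =
        bderiv (chart_map q \<circ> \<psi> \<circ> chart_inv q) (chart_map q (id x)) o\<^sub>L
        bderiv (chart_map q \<circ> id \<circ> chart_inv c) (chart_map c x)"
      using C1_map_imp_C1_at[OF C1_map_id cx, of q] C1_map_imp_C1_at[OF \<psi> qx q\<psi>] qx
      by (intro bderiv_coords_compose[OF cx]) simp_all
    moreover have "bderiv (chart_map d \<circ> (f \<circ> \<psi>) \<circ> chart_inv c) (chart_map c x) =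
        bderiv (chart_map d \<circ> f \<circ> chart_inv q) (chart_map q (\<psi> x)) o\<^sub>L
        bderiv (chart_map q \<circ> \<psi> \<circ> chart_inv c) (chart_map c x)"
      by (rule bderiv_coords_compose[where h = \<psi>, OF cx q\<psi> C1_map_imp_isCont[OF \<psi>]
          C1_map_imp_C1_at[OF \<psi> cx q\<psi>] C1_map_imp_C1_at[OF f q\<psi> df]])
    ultimately have "bderiv (chart_map d \<circ> (f \<circ> \<psi>) \<circ> chart_inv c) (chart_map c x) =
        H (chart_map q (\<psi> x)) o\<^sub>L D o\<^sub>L T (chart_map c x)"
      by (simp add: H_def D_def T_def blinfun_eqI)
    then show ?thesis using concl by (simp add: G_def)
  qed
  then show ?thesis using W(1,2) \<delta>(1) by blast
qed

text \<open>\<open>near_id_at\<close> does not tell in which chart of the cover the map is close to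
  the identity; the least of finitely many \<delta> covers every possibility.\<close>

lemma near_id_preserves_closeness_at:
  assumes f: "C1_map A f" and h: "C1_map A h"
    and c: "c \<in> charts_at A p" and d: "d \<in> charts_at A (f p)" "d \<in> charts_at A (h p)"
    and lt: "norm (chart_map d (f p) - chart_map d (h p)) < \<epsilon>"
      "norm (bderiv (chart_map d \<circ> f \<circ> chart_inv c) (chart_map c p)
        - bderiv (chart_map d \<circ> h \<circ> chart_inv c) (chart_map c p)) < \<epsilon>"
  shows "\<exists>\<delta>>0. \<exists>W. open W \<and> p \<in> W \<and> (\<forall>\<psi> x. C1_map A \<psi> \<longrightarrow> x \<in> W \<longrightarrow> near_id_at \<delta> \<psi> x \<longrightarrow>
      f (\<psi> x) \<in> chart_dom d \<and> norm (chart_map d (f (\<psi> x)) - chart_map d (h x)) < \<epsilon> \<and>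
      norm (bderiv (chart_map d \<circ> (f \<circ> \<psi>) \<circ> chart_inv c) (chart_map c x)
        - bderiv (chart_map d \<circ> h \<circ> chart_inv c) (chart_map c x)) < \<epsilon>)"
proof -
  define good where "good = (\<lambda>\<psi> x. f (\<psi> x) \<in> chart_dom d \<and> norm (chart_map d (f (\<psi> x)) - chart_map d (h x)) < \<epsilon> \<and>
      norm (bderiv (chart_map d \<circ> (f \<circ> \<psi>) \<circ> chart_inv c) (chart_map c x)
        - bderiv (chart_map d \<circ> h \<circ> chart_inv c) (chart_map c x)) < \<epsilon>)"
  define near where "near = (\<lambda>\<delta> q \<psi> x. x \<in> K q \<and> \<psi> x \<in> chart_dom q \<and>
      norm (chart_map q (\<psi> x) - chart_map q x) \<le> \<delta> \<and>
      norm (bderiv (chart_map q \<circ> \<psi> \<circ> chart_inv q) (chart_map q x) - id_blinfun) \<le> \<delta>)"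
  have near_mono: "near \<delta>' q \<psi> x" if "near \<delta> q \<psi> x" "\<delta> \<le> \<delta>'" for \<delta> \<delta>' q \<psi> x
    using that by (auto simp: near_def)
  have "\<forall>q\<in>P. \<exists>\<delta> W. 0 < \<delta> \<and> open W \<and> p \<in> W \<and> (\<forall>\<psi> x. C1_map A \<psi> \<longrightarrow> x \<in> W \<longrightarrow> near \<delta> q \<psi> x \<longrightarrow> good \<psi> x)"
  proof
    fix q assume "q \<in> P"
    from near_id_preserves_closeness_in_chart[OF assms this]
    show "\<exists>\<delta> W. 0 < \<delta> \<and> open W \<and> p \<in> W \<and> (\<forall>\<psi> x. C1_map A \<psi> \<longrightarrow> x \<in> W \<longrightarrow> near \<delta> q \<psi> x \<longrightarrow> good \<psi> x)"
      unfolding good_def near_def by blast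
  qed
  then obtain \<delta> W where \<delta>W: "\<And>q. q \<in> P \<Longrightarrow> 0 < \<delta> q \<and> open (W q) \<and> p \<in> W q"
      "\<And>q \<psi> x. q \<in> P \<Longrightarrow> C1_map A \<psi> \<Longrightarrow> x \<in> W q \<Longrightarrow> near (\<delta> q) q \<psi> x \<Longrightarrow> good \<psi> x"
    by metis
  define \<delta>' where "\<delta>' = Min (\<delta> ` P)"
  have "P \<noteq> {}" using cover_chart(1) by blast
  then have "0 < \<delta>'" using finite_cover \<delta>W(1) by (simp add: \<delta>'_def)
  have le: "\<delta>' \<le> \<delta> q" if "q \<in> P" for q using finite_cover that by (simp add: \<delta>'_def)
  have "good \<psi> x" if C1: "C1_map A \<psi>" and x: "x \<in> (\<Inter>q\<in>P. W q)" and n: "near_id_at \<delta>' \<psi> x" for \<psi> x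
  proof -
    obtain q where q: "q \<in> P" "near \<delta>' q \<psi> x" using n unfolding near_id_at_def near_def by blast
    then show ?thesis using \<delta>W(2)[OF q(1) C1] x near_mono[OF q(2) le[OF q(1)]] by blast
  qed
  moreover have "open (\<Inter>q\<in>P. W q)" "p \<in> (\<Inter>q\<in>P. W q)"
    using finite_cover \<delta>W(1) by (auto intro!: open_INT)
  ultimately show ?thesis
    using \<open>0 < \<delta>'\<close> unfolding good_def by blast
qed

lemma near_id_preserves_subbasic:
  assumes mem: "f \<in> C1_subbasic A h c d S \<epsilon>" and h: "C1_map A h" and cd: "c \<in> A" "d \<in> A"
    and S: "compact S" "S \<subseteq> chart_dom c" "h ` S \<subseteq> chart_dom d"
  shows "\<exists>\<delta>>0. \<forall>\<psi>. C1_map A \<psi> \<longrightarrow> (\<forall>x. near_id_at \<delta> \<psi> x) \<longrightarrow> f \<circ> \<psi> \<in> C1_subbasic A h c d S \<epsilon>"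
proof -
  have f: "C1_map A f" and fS: "f ` S \<subseteq> chart_dom d" using mem by (auto simp: C1_subbasic_def)
  have charts: "c \<in> charts_at A p" "d \<in> charts_at A (h p)" if "p \<in> S" for p
    using cd S that by (auto simp: charts_at_def)
  have onorm_eq: "onorm (\<lambda>x. frechet_derivative (chart_map d \<circ> k \<circ> chart_inv c) (at (chart_map c p)) x
        - frechet_derivative (chart_map d \<circ> h \<circ> chart_inv c) (at (chart_map c p)) x)
      = norm (bderiv (chart_map d \<circ> k \<circ> chart_inv c) (chart_map c p)
        - bderiv (chart_map d \<circ> h \<circ> chart_inv c) (chart_map c p))"
    if "p \<in> S" "C1_map A k" "k p \<in> chart_dom d" for k p
  proof -
    have "d \<in> charts_at A (k p)" using that cd by (simp add: charts_at_def)
    then have "C1_at (chart_map d \<circ> k \<circ> chart_inv c) (chart_map c p)"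
      "C1_at (chart_map d \<circ> h \<circ> chart_inv c) (chart_map c p)"
      using C1_map_imp_C1_at[OF that(2) charts(1)[OF that(1)]]
        C1_map_imp_C1_at[OF h charts(1)[OF that(1)] charts(2)[OF that(1)]] by auto
    then show ?thesis
      by (simp add: frechet_derivative_eq_bderiv[OF C1_at_imp_differentiable] norm_blinfun.rep_eq minus_blinfun.rep_eq)
  qed
  define good where "good = (\<lambda>\<psi> x. f (\<psi> x) \<in> chart_dom d \<and> norm (chart_map d (f (\<psi> x)) - chart_map d (h x)) < \<epsilon> \<and>
      norm (bderiv (chart_map d \<circ> (f \<circ> \<psi>) \<circ> chart_inv c) (chart_map c x)
        - bderiv (chart_map d \<circ> h \<circ> chart_inv c) (chart_map c x)) < \<epsilon>)"
  have "\<forall>p\<in>S. \<exists>\<delta> W. 0 < \<delta> \<and> open W \<and> p \<in> W \<and> (\<forall>\<psi> x. C1_map A \<psi> \<longrightarrow> x \<in> W \<longrightarrow> near_id_at \<delta> \<psi> x \<longrightarrow> good \<psi> x)"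
  proof
    fix p assume p: "p \<in> S"
    have fp: "f p \<in> chart_dom d" using fS p by blast
    then have "d \<in> charts_at A (f p)" using cd by (simp add: charts_at_def)
    moreover have "norm (chart_map d (f p) - chart_map d (h p)) < \<epsilon>"
      "norm (bderiv (chart_map d \<circ> f \<circ> chart_inv c) (chart_map c p)
        - bderiv (chart_map d \<circ> h \<circ> chart_inv c) (chart_map c p)) < \<epsilon>"
      using mem p unfolding onorm_eq[OF p f fp, symmetric] by (auto simp: C1_subbasic_def)
    ultimately show "\<exists>\<delta> W. 0 < \<delta> \<and> open W \<and> p \<in> W \<and> (\<forall>\<psi> x. C1_map A \<psi> \<longrightarrow> x \<in> W \<longrightarrow> near_id_at \<delta> \<psi> x \<longrightarrow> good \<psi> x)"
      using near_id_preserves_closeness_at[OF f h charts(1)[OF p] _ charts(2)[OF p]]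
      unfolding good_def by blast
  qed
  then obtain \<delta> W where \<delta>W: "\<And>p. p \<in> S \<Longrightarrow> 0 < \<delta> p \<and> open (W p) \<and> p \<in> W p"
      "\<And>p \<psi> x. p \<in> S \<Longrightarrow> C1_map A \<psi> \<Longrightarrow> x \<in> W p \<Longrightarrow> near_id_at (\<delta> p) \<psi> x \<Longrightarrow> good \<psi> x"
    by metis
  obtain F where F: "F \<subseteq> S" "finite F" "S \<subseteq> (\<Union>p\<in>F. W p)"
  proof (rule compactE_image[OF S(1), of S W])
    show "S \<subseteq> (\<Union>p\<in>S. W p)" using \<delta>W(1) by blast
  qed (use \<delta>W(1) in auto)
  \<comment> \<open>The extra 1 keeps the minimum meaningful when \<open>F\<close> is empty.\<close>
  define \<delta>' where "\<delta>' = Min (insert 1 (\<delta> ` F))"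
  have "0 < \<delta>'" using F \<delta>W(1) by (auto simp: \<delta>'_def)
  have le: "\<delta>' \<le> \<delta> p" if "p \<in> F" for p using F(2) that by (simp add: \<delta>'_def)
  have "f \<circ> \<psi> \<in> C1_subbasic A h c d S \<epsilon>" if \<psi>: "C1_map A \<psi>" "\<forall>x. near_id_at \<delta>' \<psi> x" for \<psi>
  proof -
    have good: "good \<psi> x" if x: "x \<in> S" for x
    proof -
      obtain p where p: "p \<in> F" "x \<in> W p" using F x by blast
      then show ?thesis
        using \<delta>W(2)[OF _ \<psi>(1) p(2)] F(1) near_id_at_mono[OF \<psi>(2)[rule_format] le[OF p(1)]] by blast
    qed
    have comp: "C1_map A (f \<circ> \<psi>)" using \<psi>(1) f by (rule C1_map_compose)
    have "(f \<circ> \<psi>) ` S \<subseteq> chart_dom d" using good by (auto simp: good_def)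
    moreover have "norm (chart_map d ((f \<circ> \<psi>) p) - chart_map d (h p)) < \<epsilon> \<and>
        onorm (\<lambda>x. frechet_derivative (chart_map d \<circ> (f \<circ> \<psi>) \<circ> chart_inv c) (at (chart_map c p)) x
          - frechet_derivative (chart_map d \<circ> h \<circ> chart_inv c) (at (chart_map c p)) x) < \<epsilon>"
      if "p \<in> S" for p
      using good[OF that] onorm_eq[OF that comp] unfolding good_def by (auto simp only: comp_apply)
    ultimately show ?thesis using comp unfolding C1_subbasic_def by blast
  qed
  then show ?thesis using \<open>0 < \<delta>'\<close> by blast
qed

text \<open>Induction on the generation of the topology, with \<open>f\<close> fixed: an
  intersection takes the smaller \<delta>, a union the \<delta> of a member containing
  \<open>f\<close>.\<close>

lemma near_id_preserves_neighbourhood: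
  assumes V: "openin (Diff1_topology A) V" "f \<in> V"
  shows "\<exists>\<delta>>0. \<forall>\<psi>\<in>Diff1 A. (\<forall>x. near_id_at \<delta> \<psi> x) \<longrightarrow> f \<circ> \<psi> \<in> V"
proof -
  obtain T where T: "openin (C1_topology A) T" "V = T \<inter> Diff1 A"
    using V(1) unfolding Diff1_topology_def openin_subtopology by blast
  have "f \<in> T" "f \<in> Diff1 A" using V(2) T(2) by auto
  have "\<exists>\<delta>>0. \<forall>\<psi>. C1_map A \<psi> \<longrightarrow> (\<forall>x. near_id_at \<delta> \<psi> x) \<longrightarrow> f \<circ> \<psi> \<in> T"
    using openin_topology_generated_by[OF T(1)[unfolded C1_topology_def]] \<open>f \<in> T\<close>
  proof (induction rule: generate_topology_on.induct)
    case (Int a b)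
    then obtain \<delta>1 \<delta>2 where "0 < \<delta>1" "\<And>\<psi>. C1_map A \<psi> \<Longrightarrow> (\<forall>x. near_id_at \<delta>1 \<psi> x) \<Longrightarrow> f \<circ> \<psi> \<in> a"
      "0 < \<delta>2" "\<And>\<psi>. C1_map A \<psi> \<Longrightarrow> (\<forall>x. near_id_at \<delta>2 \<psi> x) \<Longrightarrow> f \<circ> \<psi> \<in> b"
      by blast
    moreover have "\<forall>x. near_id_at \<delta>1 \<psi> x" "\<forall>x. near_id_at \<delta>2 \<psi> x"
      if "\<forall>x. near_id_at (min \<delta>1 \<delta>2) \<psi> x" for \<psi>
      using near_id_at_mono[OF that[rule_format], of \<delta>1] near_id_at_mono[OF that[rule_format], of \<delta>2] by simp_all
    ultimately show ?case by (intro exI[of _ "min \<delta>1 \<delta>2"]) (simp del: comp_apply)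
  next
    case (UN \<K>)
    then obtain k where k: "k \<in> \<K>" "f \<in> k" by blast
    from UN.IH[OF k] k(1) show ?case by blast
  next
    case (Basis s)
    then obtain h c d S \<epsilon> where "s = C1_subbasic A h c d S \<epsilon>" "C1_map A h" "c \<in> A" "d \<in> A"
      "compact S" "S \<subseteq> chart_dom c" "h ` S \<subseteq> chart_dom d" by blast
    then show ?case using near_id_preserves_subbasic[of f h c d S \<epsilon>] Basis.prems by blast
  qed simp
  then show ?thesis
    using T(2) \<open>f \<in> Diff1 A\<close> by (auto simp: Diff1_compose) (auto simp: Diff1_def)
qed

text \<open>One chart is fixed per point, so the target chart of one step is the source chart of the
  next, and derivatives along an orbit multiply without transition factors.\<close>

definition cover_deriv :: "('a \<Rightarrow> 'a) \<Rightarrow> 'a \<Rightarrow> 'b \<Rightarrow>\<^sub>L 'b" where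
  "cover_deriv f x = bderiv (chart_map (cover_chart (f x)) \<circ> f \<circ> chart_inv (cover_chart x))
     (chart_map (cover_chart x) x)"

text \<open>\<open>h\<close> is \<open>f \<circ> \<psi>\<close> with \<open>\<psi>\<close> fixing
  \<open>X\<close> pointwise, so the chain rule puts \<open>id_blinfun + E x\<close> to the right of
  the derivative of \<open>f\<close>. The \<epsilon> is chosen before \<open>X\<close> and does not
  depend on the number of its points.\<close>

lemma franks:
  assumes V: "openin (Diff1_topology A) V" "f \<in> V"
  shows "\<exists>\<epsilon>>0. \<forall>X E. finite X \<longrightarrow> (\<forall>x\<in>X. norm (E x) \<le> \<epsilon>) \<longrightarrow>
    (\<exists>h\<in>V. \<forall>x\<in>X. h x = f x \<and> cover_deriv h x = cover_deriv f x o\<^sub>L (id_blinfun + E x))"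
proof -
  have "V \<subseteq> Diff1 A" using openin_subset[OF V(1)] by (auto simp: Diff1_topology_def)
  then have f: "C1_map A f" using V(2) by (auto simp: Diff1_def)
  obtain \<delta> where \<delta>: "0 < \<delta>" "\<And>\<psi>. \<psi> \<in> Diff1 A \<Longrightarrow> (\<forall>x. near_id_at \<delta> \<psi> x) \<Longrightarrow> f \<circ> \<psi> \<in> V"
    using near_id_preserves_neighbourhood[OF V] by blast
  have "\<exists>h\<in>V. \<forall>x\<in>X. h x = f x \<and> cover_deriv h x = cover_deriv f x o\<^sub>L (id_blinfun + E x)"
    if X: "finite X" and E: "\<forall>x\<in>X. norm (E x) \<le> min (1/10) (\<delta>/5)" for X E
  proof -
    obtain W where W: "\<And>x. x \<in> X \<Longrightarrow> open (W x) \<and> x \<in> W x" "disjoint_family_on W X"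
      using ex_disjoint_neighbourhoods[OF X] by blast
    have E': "norm (E x) \<le> 1/10 \<and> norm (E x) \<le> \<delta>/5" if "x \<in> X" for x using E that by auto
    obtain \<psi> where \<psi>: "\<psi> \<in> Diff1 A" "\<forall>y. near_id_at \<delta> \<psi> y" and fix_deriv: "\<forall>x\<in>X. \<psi> x = x \<and>
        bderiv (chart_map (cover_chart x) \<circ> \<psi> \<circ> chart_inv (cover_chart x)) (chart_map (cover_chart x) x)
        = id_blinfun + E x"
      using ex_perturbation_at_finite_set[where E = E and W = W, OF X \<delta>(1) E' W] by blast
    have C1: "C1_map A \<psi>" using \<psi>(1) by (simp add: Diff1_def)
    have "(f \<circ> \<psi>) x = f x \<and> cover_deriv (f \<circ> \<psi>) x = cover_deriv f x o\<^sub>L (id_blinfun + E x)" if "x \<in> X" for x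
    proof -
      have x: "\<psi> x = x" and D: "bderiv (chart_map (cover_chart x) \<circ> \<psi> \<circ> chart_inv (cover_chart x))
          (chart_map (cover_chart x) x) = id_blinfun + E x" using fix_deriv that by auto
      have kx: "cover_chart x \<in> charts_at A (\<psi> x)" and kfx: "cover_chart (f x) \<in> charts_at A (f (\<psi> x))"
        unfolding x by simp_all
      have "bderiv (chart_map (cover_chart (f x)) \<circ> (f \<circ> \<psi>) \<circ> chart_inv (cover_chart x)) (chart_map (cover_chart x) x)
        = bderiv (chart_map (cover_chart (f x)) \<circ> f \<circ> chart_inv (cover_chart x)) (chart_map (cover_chart x) (\<psi> x)) o\<^sub>L
          bderiv (chart_map (cover_chart x) \<circ> \<psi> \<circ> chart_inv (cover_chart x)) (chart_map (cover_chart x) x)"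
        by (rule bderiv_coords_compose[where h = \<psi>, OF cover_chart_in_charts_at kx C1_map_imp_isCont[OF C1]
          C1_map_imp_C1_at[OF C1 cover_chart_in_charts_at kx] C1_map_imp_C1_at[OF f kx kfx]])
      then show ?thesis unfolding cover_deriv_def D by (simp add: x)
    qed
    then show ?thesis using \<delta>(2)[OF \<psi>] by blast
  qed
  then show ?thesis using \<delta>(1) by (intro exI[of _ "min (1/10) (\<delta>/5)"]) auto
qed

end

section \<open>Eigenvalues of periodic points\<close>

text \<open>The minimum of the form on the compact unit sphere is positive; homogeneity carries it
  over to all vectors.\<close>

lemma quadratic_form_bounds:
  fixes \<gamma> :: "'b::euclidean_space \<Rightarrow> 'b \<Rightarrow> real"
  assumes bil: "bilinear \<gamma>" and pos: "\<And>u. u \<noteq> 0 \<Longrightarrow> 0 < \<gamma> u u"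
  obtains m M where "0 < m" "0 \<le> M" "\<And>u. m * (norm u)\<^sup>2 \<le> \<gamma> u u" "\<And>u. \<gamma> u u \<le> M * (norm u)\<^sup>2"
proof -
  have bb: "bounded_bilinear \<gamma>" using bil bilinear_conv_bounded_bilinear by blast
  obtain M where M: "0 \<le> M" "\<And>u v. norm (\<gamma> u v) \<le> norm u * norm v * M"
    using bounded_bilinear.nonneg_bounded[OF bb] by blast
  have "continuous_on (sphere 0 1) (\<lambda>u. \<gamma> u u)"
    by (intro bounded_bilinear.continuous_on[OF bb] continuous_intros)
  moreover have "compact (sphere (0::'b) 1)" "sphere (0::'b) 1 \<noteq> {}" by auto
  ultimately obtain u0 :: 'b where u0: "norm u0 = 1" and min: "\<And>u. norm u = 1 \<Longrightarrow> \<gamma> u0 u0 \<le> \<gamma> u u"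
    using continuous_attains_inf[of "sphere (0::'b) 1" "\<lambda>u. \<gamma> u u"] by auto
  have "\<gamma> u0 u0 * (norm u)\<^sup>2 \<le> \<gamma> u u" for u
  proof (cases "u = 0")
    case True
    then show ?thesis using bb by (simp add: bounded_bilinear.zero_left)
  next
    case False
    have "\<gamma> ((1 / norm u) *\<^sub>R u) ((1 / norm u) *\<^sub>R u) = \<gamma> u u / (norm u)\<^sup>2"
      by (simp add: bounded_bilinear.scaleR_left[OF bb] bounded_bilinear.scaleR_right[OF bb] power2_eq_square)
    then have "\<gamma> u0 u0 \<le> \<gamma> u u / (norm u)\<^sup>2"
      using min[of "(1 / norm u) *\<^sub>R u"] False by simp
    then show ?thesis using False by (simp add: pos_le_divide_eq)
  qed
  moreover have "\<gamma> u u \<le> M * (norm u)\<^sup>2" for u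
    using M(2)[of u u] by (simp add: power2_eq_square algebra_simps)
  moreover have "0 < \<gamma> u0 u0" using u0 pos[of u0] by fastforce
  ultimately show ?thesis using that M(1) by blast
qed

context atlas
begin

lemma tangent_of_coords_eq_0_iff:
  assumes "c \<in> charts_at A p"
  shows "tangent_of_coords A p c u = (\<lambda>d. 0) \<longleftrightarrow> u = 0"
proof
  assume "tangent_of_coords A p c u = (\<lambda>d. 0)"
  then show "u = 0" using tangent_of_coords_same[OF assms, of u] by simp
next
  assume "u = 0"
  then show "tangent_of_coords A p c u = (\<lambda>d. 0)" by (simp add: tangent_of_coords_apply[OF assms] fun_eq_iff)
qed

lemma tangent_map_of_coords:
  assumes "C1_map A k" "k p = p" "c \<in> charts_at A p"
  shows "tangent_map A k p (tangent_of_coords A p c u) =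
    tangent_of_coords A p c (bderiv (chart_map c \<circ> k \<circ> chart_inv c) (chart_map c p) u)"
  using tangent_map_coords[OF assms(1,3), of c "tangent_of_coords A p c u"] assms
    tangent_of_coords_in_tangent_space tangent_of_coords_same by simp

lemma complex_eigenvalue_of_coords:
  assumes k: "C1_map A k" "k p = p" and c: "c \<in> charts_at A p"
    and z: "complexified_eigenvalue (bderiv (chart_map c \<circ> k \<circ> chart_inv c) (chart_map c p)) z"
  shows "complex_eigenvalue (tangent_space A p) (tangent_map A k p) z"
proof -
  let ?D = "bderiv (chart_map c \<circ> k \<circ> chart_inv c) (chart_map c p)" and ?\<iota> = "tangent_of_coords A p c"
  obtain u w where uw: "u \<noteq> 0 \<or> w \<noteq> 0" "blinfun_apply ?D u = Re z *\<^sub>R u + (- Im z) *\<^sub>R w"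
      "blinfun_apply ?D w = Im z *\<^sub>R u + Re z *\<^sub>R w"
    using z unfolding complexified_eigenvalue_def by auto
  have "tangent_map A k p (?\<iota> u) = (\<lambda>d. Re z *\<^sub>R ?\<iota> u d - Im z *\<^sub>R ?\<iota> w d)"
    "tangent_map A k p (?\<iota> w) = (\<lambda>d. Im z *\<^sub>R ?\<iota> u d + Re z *\<^sub>R ?\<iota> w d)"
    unfolding tangent_map_of_coords[OF k c] uw(2,3) tangent_of_coords_linear[OF c] by simp_all
  moreover have "?\<iota> u \<noteq> (\<lambda>d. 0) \<or> ?\<iota> w \<noteq> (\<lambda>d. 0)" using uw(1) tangent_of_coords_eq_0_iff[OF c] by simp
  moreover have "?\<iota> u \<in> tangent_space A p" "?\<iota> w \<in> tangent_space A p"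
    using tangent_of_coords_in_tangent_space[OF c] by auto
  ultimately show ?thesis unfolding complex_eigenvalue_def by blast
qed

text \<open>For an eigenvector \<open>u + \<i> w\<close> the squared lengths of \<open>u\<close> and \<open>w\<close> add up to a number
  that is multiplied by the square of the modulus of the eigenvalue.\<close>

lemma eigenvalue_le_opnorm:
  assumes g: "riemannian_metric A g" and k: "C1_map A k" "k p = p" and c: "c \<in> charts_at A p"
    and z: "complexified_eigenvalue (bderiv (chart_map c \<circ> k \<circ> chart_inv c) (chart_map c p)) z"
  shows "cmod z \<le> tangent_opnorm A g p p (tangent_map A k p)"
proof -
  define D where "D = bderiv (chart_map c \<circ> k \<circ> chart_inv c) (chart_map c p)"
  define \<iota> where "\<iota> = tangent_of_coords A p c"
  define \<gamma> where "\<gamma> = (\<lambda>u v. g p (\<iota> u) (\<iota> v))"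
  have \<iota>_in: "\<iota> u \<in> tangent_space A p" for u
    unfolding \<iota>_def by (rule tangent_of_coords_in_tangent_space[OF c])
  have lin: "\<gamma> (a *\<^sub>R u + b *\<^sub>R v) w = a * \<gamma> u w + b * \<gamma> v w" for a b u v w
    using g \<iota>_in unfolding riemannian_metric_def \<gamma>_def \<iota>_def tangent_of_coords_linear[OF c] by blast
  have symm: "\<gamma> u v = \<gamma> v u" for u v
    using g \<iota>_in unfolding riemannian_metric_def \<gamma>_def by blast
  have "\<gamma> (u + v) w = \<gamma> u w + \<gamma> v w" "\<gamma> (a *\<^sub>R u) w = a * \<gamma> u w" for a u v w
    using lin[where a = 1 and b = 1 and u = u and v = v and w = w] lin[where a = a and b = 0 and u = u and v = 0 and w = w] by simp_all
  then have bil: "bilinear \<gamma>"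
    unfolding bilinear_def by (auto intro!: linearI simp: symm[of w for w])
  have pos: "0 < \<gamma> u u" if "u \<noteq> 0" for u
    using g \<iota>_in[of u] tangent_of_coords_eq_0_iff[OF c, of u] that
    unfolding riemannian_metric_def \<gamma>_def \<iota>_def by blast
  obtain m M where m: "0 < m" "0 \<le> M" "\<And>u. m * (norm u)\<^sup>2 \<le> \<gamma> u u" "\<And>u. \<gamma> u u \<le> M * (norm u)\<^sup>2"
    using quadratic_form_bounds[OF bil pos] by blast
  have nonneg: "0 \<le> \<gamma> u u" for u
    using m(1) m(3)[of u] by (meson less_imp_le mult_nonneg_nonneg order_trans zero_le_power2)
  define S where "S = tangent_opnorm A g p p (tangent_map A k p)"
  have norm_L: "tangent_norm g p (tangent_map A k p (\<iota> u)) = sqrt (\<gamma> (D u) (D u))" for u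
    unfolding tangent_norm_def \<iota>_def tangent_map_of_coords[OF k c] \<gamma>_def D_def ..
  have \<iota>_surj: "\<exists>u. v = \<iota> u" if "v \<in> tangent_space A p" for v
    using tangent_space_eq_coords[OF that c] unfolding \<iota>_def by blast
  let ?B = "{v \<in> tangent_space A p. tangent_norm g p v \<le> 1}"
  \<comment> \<open>The real supremum in \<open>tangent_opnorm\<close> bounds its members only if
    they are bounded above; comparing the metric with the Euclidean norm gives that.\<close>
  have bdd: "bdd_above ((\<lambda>v. tangent_norm g p (tangent_map A k p v)) ` ?B)"
  proof (rule bdd_aboveI2)
    fix v assume v: "v \<in> ?B"
    then obtain u where u: "v = \<iota> u" using \<iota>_surj by blast
    have "sqrt (\<gamma> u u) \<le> 1" using v by (simp add: u tangent_norm_def \<gamma>_def)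
    then have "m * (norm u)\<^sup>2 \<le> 1" using m(3)[of u] by simp
    then have "(norm u)\<^sup>2 \<le> 1 / m" using m(1) by (simp add: field_simps)
    have "\<gamma> (D u) (D u) \<le> M * (norm (D u))\<^sup>2" by (rule m(4))
    also have "\<dots> \<le> M * (norm D * norm u)\<^sup>2"
      using m(2) by (intro mult_left_mono power_mono norm_blinfun) auto
    also have "\<dots> \<le> M * ((norm D)\<^sup>2 * (1 / m))"
      using \<open>(norm u)\<^sup>2 \<le> 1 / m\<close> m(2) unfolding power_mult_distrib by (intro mult_left_mono) auto
    finally show "tangent_norm g p (tangent_map A k p v) \<le> sqrt (M * ((norm D)\<^sup>2 * (1 / m)))"
      by (simp add: u norm_L)
  qed
  have S_ge: "sqrt (\<gamma> (D u) (D u)) \<le> S" if "\<gamma> u u \<le> 1" for u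
  proof -
    have "\<iota> u \<in> ?B" using that \<iota>_in by (simp add: tangent_norm_def \<gamma>_def[symmetric]) (simp add: \<gamma>_def)
    from cSUP_upper[OF this bdd] show ?thesis unfolding S_def tangent_opnorm_def norm_L .
  qed
  have zero: "\<gamma> 0 u = 0" for u using lin[where a = 0 and b = 0 and u = 0 and v = 0 and w = u] by simp
  have "0 \<le> S" using S_ge[of 0] by (simp add: zero)
  have expand: "\<gamma> (D u) (D u) \<le> S\<^sup>2 * \<gamma> u u" for u
  proof (cases "u = 0")
    case False
    define t where "t = 1 / sqrt (\<gamma> u u)"
    have t: "0 < t" "t\<^sup>2 * \<gamma> u u = 1" using pos[OF False] by (simp_all add: t_def power_divide)
    have scale: "\<gamma> (t *\<^sub>R x) (t *\<^sub>R x) = t\<^sup>2 * \<gamma> x x" for x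
      using lin[where a = t and b = 0 and u = x and v = 0 and w = "t *\<^sub>R x"] symm[of x "t *\<^sub>R x"] lin[where a = t and b = 0 and u = x and v = 0 and w = x] by (simp add: power2_eq_square)
    have "sqrt (\<gamma> (D (t *\<^sub>R u)) (D (t *\<^sub>R u))) \<le> S" using scale t by (intro S_ge) simp
    then have "t\<^sup>2 * \<gamma> (D u) (D u) \<le> S\<^sup>2"
      using sqrt_le_D by (simp add: blinfun.scaleR_right scale)
    then have "\<gamma> u u * (t\<^sup>2 * \<gamma> (D u) (D u)) \<le> \<gamma> u u * S\<^sup>2" using nonneg by (intro mult_left_mono)
    then show ?thesis using t(2) by (simp add: algebra_simps) (metis mult.assoc mult.commute mult_1)
  qed (simp add: zero)
  obtain u w where uw: "u \<noteq> 0 \<or> w \<noteq> 0" "D u = Re z *\<^sub>R u + (- Im z) *\<^sub>R w" "D w = Im z *\<^sub>R u + Re z *\<^sub>R w"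
    using z unfolding complexified_eigenvalue_def D_def by auto
  have lin2: "\<gamma> (a *\<^sub>R u + b *\<^sub>R w) (a *\<^sub>R u + b *\<^sub>R w) = a\<^sup>2 * \<gamma> u u + 2 * a * b * \<gamma> u w + b\<^sup>2 * \<gamma> w w" for a b
  proof -
    have "\<gamma> x (a *\<^sub>R u + b *\<^sub>R w) = a * \<gamma> u x + b * \<gamma> w x" for x
      by (rule trans[OF symm lin])
    then show ?thesis using lin[where w = "a *\<^sub>R u + b *\<^sub>R w" and a = a and b = b and u = u and v = w] symm[of w u]
      by (simp add: power2_eq_square algebra_simps)
  qed
  \<comment> \<open>The mixed terms cancel: their coefficients are \<open>- 2 * Re z * Im z\<close>
    and \<open>2 * Re z * Im z\<close>.\<close>
  have "(cmod z)\<^sup>2 * (\<gamma> u u + \<gamma> w w) = \<gamma> (D u) (D u) + \<gamma> (D w) (D w)"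
    unfolding uw(2,3) lin2 cmod_power2 by (simp add: algebra_simps)
  also have "\<dots> \<le> S\<^sup>2 * (\<gamma> u u + \<gamma> w w)" using expand[of u] expand[of w] by (simp add: distrib_left)
  finally have "(cmod z)\<^sup>2 * (\<gamma> u u + \<gamma> w w) \<le> S\<^sup>2 * (\<gamma> u u + \<gamma> w w)" .
  moreover have "0 < \<gamma> u u + \<gamma> w w"
    using uw(1) pos[of u] pos[of w] nonneg[of u] nonneg[of w] by linarith
  ultimately have "(cmod z)\<^sup>2 \<le> S\<^sup>2" by (rule mult_right_le_imp_le)
  then show ?thesis using \<open>0 \<le> S\<close> unfolding S_def by (rule power2_le_imp_le)
qed

lemma C1_map_funpow: "C1_map A h \<Longrightarrow> C1_map A (h ^^ n)"
  by (induction n) (auto intro: C1_map_id C1_map_compose simp del: comp_apply)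

end

section \<open>Periods\<close>

lemma period_eqI:
  assumes "0 < n" "(h ^^ n) p = p" "\<And>m. 0 < m \<Longrightarrow> m < n \<Longrightarrow> (h ^^ m) p \<noteq> p"
  shows "period h p = n"
  unfolding period_def using assms by (intro Least_equality) (auto simp: not_less[symmetric])

lemma periodD:
  assumes "p \<in> periodic_points h"
  shows "0 < period h p" "(h ^^ period h p) p = p"
    and "0 < m \<Longrightarrow> m < period h p \<Longrightarrow> (h ^^ m) p \<noteq> p"
proof -
  have "\<exists>n. n > 0 \<and> (h ^^ n) p = p" using assms by (auto simp: periodic_points_def)
  from LeastI_ex[OF this] show "0 < period h p" "(h ^^ period h p) p = p"
    unfolding period_def by auto
  show "0 < m \<Longrightarrow> m < period h p \<Longrightarrow> (h ^^ m) p \<noteq> p"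
    unfolding period_def using not_less_Least by blast
qed

lemma funpow_periodic_multiple: "(h ^^ n) p = p \<Longrightarrow> (h ^^ (k * n)) p = p"
  by (induction k) (auto simp: funpow_add)

lemma funpow_periodic_shift:
  assumes "(h ^^ n) p = p"
  shows "(h ^^ n) ((h ^^ j) p) = (h ^^ j) p"
  using assms by (metis add.commute comp_apply funpow_add)

lemma
  assumes "inj h" "p \<in> periodic_points h"
  shows funpow_in_periodic_points: "(h ^^ j) p \<in> periodic_points h"
    and period_funpow: "period h ((h ^^ j) p) = period h p"
proof -
  note p = periodD[OF assms(2)]
  have inj: "inj (h ^^ j)" using assms(1) by simp
  have ret: "(h ^^ period h p) ((h ^^ j) p) = (h ^^ j) p"
    by (rule funpow_periodic_shift) (rule p)
  then show "(h ^^ j) p \<in> periodic_points h" using p(1) by (auto simp: periodic_points_def)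
  have "(h ^^ m) ((h ^^ j) p) = (h ^^ j) ((h ^^ m) p)" for m
    by (metis add.commute comp_apply funpow_add)
  then show "period h ((h ^^ j) p) = period h p"
    using p ret inj by (intro period_eqI) (auto dest: injD)
qed

lemma inj_on_orbit:
  assumes "inj h" "p \<in> periodic_points h"
  shows "inj_on (\<lambda>i. (h ^^ i) p) {..<period h p}"
proof (rule linorder_inj_onI)
  fix i j assume ij: "i < j" "j \<in> {..<period h p}"
  then have "(h ^^ j) p = (h ^^ i) ((h ^^ (j - i)) p)"
    by (metis add_diff_inverse_nat comp_apply funpow_add less_imp_not_less)
  moreover have "(h ^^ (j - i)) p \<noteq> p" using ij by (intro periodD(3)[OF assms(2)]) auto
  ultimately show "(h ^^ i) p \<noteq> (h ^^ j) p" using assms(1) by (metis inj_fn injD)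
qed auto

section \<open>Periodic orbits and the linear cocycle along them\<close>

context atlas_cover
begin

definition orbit_deriv :: "('a \<Rightarrow> 'a) \<Rightarrow> 'a \<Rightarrow> nat \<Rightarrow> 'b \<Rightarrow>\<^sub>L 'b" where
  "orbit_deriv f p i = cover_deriv f ((f ^^ i) p)"

lemma orbit_deriv_shift: "orbit_deriv f p (i + j) = orbit_deriv f ((f ^^ j) p) i"
  by (simp add: orbit_deriv_def funpow_add)

text \<open>The chain rule along the orbit, written as a product with zero perturbation so that it
  can be compared with the perturbed products of another map.\<close>

lemma bderiv_funpow:
  assumes h: "C1_map A h"
  shows "bderiv (chart_map (cover_chart ((h ^^ l) p)) \<circ> (h ^^ l) \<circ> chart_inv (cover_chart p))
    (chart_map (cover_chart p) p) = perturbed_product (orbit_deriv h p) (\<lambda>_. 0) 0 l"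
proof (induction l)
  case 0
  show ?case using bderiv_coords_id[OF cover_chart_in_charts_at[of p]] by (simp add: id_def comp_def)
next
  case (Suc l)
  have hl: "C1_map A (h ^^ l)" using h by (rule C1_map_funpow)
  have "bderiv (chart_map (cover_chart (h ((h ^^ l) p))) \<circ> (h \<circ> h ^^ l) \<circ> chart_inv (cover_chart p))
      (chart_map (cover_chart p) p) =
    bderiv (chart_map (cover_chart (h ((h ^^ l) p))) \<circ> h \<circ> chart_inv (cover_chart ((h ^^ l) p)))
      (chart_map (cover_chart ((h ^^ l) p)) ((h ^^ l) p)) o\<^sub>L
    bderiv (chart_map (cover_chart ((h ^^ l) p)) \<circ> (h ^^ l) \<circ> chart_inv (cover_chart p))
      (chart_map (cover_chart p) p)"
    by (rule bderiv_coords_compose[where h = "h ^^ l", OF cover_chart_in_charts_at cover_chart_in_charts_at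
      C1_map_imp_isCont[OF hl] C1_map_imp_C1_at[OF hl] C1_map_imp_C1_at[OF h]]) simp_all
  moreover have step: "orbit_deriv h p (0 + l) =
    bderiv (chart_map (cover_chart (h ((h ^^ l) p))) \<circ> h \<circ> chart_inv (cover_chart ((h ^^ l) p)))
      (chart_map (cover_chart ((h ^^ l) p)) ((h ^^ l) p))"
    by (simp only: orbit_deriv_def cover_deriv_def add_0)
  moreover have "(h ^^ Suc l) p = h ((h ^^ l) p)" "h ^^ Suc l = h \<circ> h ^^ l" by simp_all
  ultimately show ?case
    unfolding perturbed_product.simps step Suc[symmetric] add_0_right blinfun_compose_id_right by metis
qed

text \<open>The diffeomorphism \<open>h\<close> from \<open>franks\<close> has the same orbit of
  \<open>p\<close> as \<open>f\<close>, so \<open>p\<close> keeps its period, and the perturbed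
  product is the derivative of the return map of \<open>h\<close>, to which the hypothesis on the
  neighbourhood applies.\<close>

lemma eigenvalue_bound_along_orbits:
  assumes g: "riemannian_metric A g" and f: "f \<in> Diff1 A"
    and V: "openin (Diff1_topology A) V" "f \<in> V"
    and bound: "\<And>h q. h \<in> V \<Longrightarrow> q \<in> nonsink_periodic_points A h \<Longrightarrow>
      tangent_opnorm A g q q (return_derivative A h q) \<le> C"
  shows "\<exists>\<epsilon>>0. \<forall>p\<in>periodic_points f. \<forall>E z. (\<forall>i. norm (E i) \<le> \<epsilon>) \<longrightarrow>
    complexified_eigenvalue (perturbed_product (orbit_deriv f p) E 0 (period f p)) z \<longrightarrow> cmod z \<le> max 1 C"
proof -
  have inj: "inj f" using f by (simp add: Diff1_def bij_def)
  obtain \<epsilon> where \<epsilon>: "0 < \<epsilon>" "\<And>X E. finite X \<Longrightarrow> (\<forall>x\<in>X. norm (E x) \<le> \<epsilon>) \<Longrightarrow>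
      \<exists>h\<in>V. \<forall>x\<in>X. h x = f x \<and> cover_deriv h x = cover_deriv f x o\<^sub>L (id_blinfun + E x)"
    using franks[OF V] by blast
  have "cmod z \<le> max 1 C" if p: "p \<in> periodic_points f" and E: "\<forall>i. norm (E i) \<le> \<epsilon>"
    and z: "complexified_eigenvalue (perturbed_product (orbit_deriv f p) E 0 (period f p)) z" for p E z
  proof -
    define n where "n = period f p"
    note n = periodD[OF p, folded n_def]
    \<comment> \<open>Perturbations are given by time but realised by point; over one period the
      orbit is injective, so \<open>E\<close> can be transferred.\<close>
    define E' where "E' = (\<lambda>x. E (inv_into {..<n} (\<lambda>i. (f ^^ i) p) x))"
    have E': "E' ((f ^^ i) p) = E i" if "i < n" for i
      using inv_into_f_f[OF inj_on_orbit[OF inj p, folded n_def], of i] that by (simp add: E'_def)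
    have "\<forall>x\<in>(\<lambda>i. (f ^^ i) p) ` {..<n}. norm (E' x) \<le> \<epsilon>" using E by (simp add: E'_def)
    from \<epsilon>(2)[OF _ this] obtain h where h: "h \<in> V"
      and on_orbit: "\<And>i. i < n \<Longrightarrow> h ((f ^^ i) p) = f ((f ^^ i) p)"
        "\<And>i. i < n \<Longrightarrow> cover_deriv h ((f ^^ i) p) = cover_deriv f ((f ^^ i) p) o\<^sub>L (id_blinfun + E' ((f ^^ i) p))"
      by blast
    have "h \<in> Diff1 A" using h openin_subset[OF V(1)] by (auto simp: Diff1_topology_def)
    then have C1: "C1_map A h" by (simp add: Diff1_def)
    have orbit: "(h ^^ i) p = (f ^^ i) p" if "i \<le> n" for i
      using that by (induction i) (auto simp: on_orbit(1))
    have per: "period h p = n" using n orbit by (intro period_eqI) auto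
    have hp: "(h ^^ n) p = p" using n orbit by simp
    then have p_per: "p \<in> periodic_points h" using n(1) by (auto simp: periodic_points_def)
    have "perturbed_product (orbit_deriv h p) (\<lambda>_. 0) 0 l = perturbed_product (orbit_deriv f p) E 0 l"
      if "l \<le> n" for l
      using that
    proof (induction l)
      case (Suc l)
      then have "orbit_deriv h p l = orbit_deriv f p l o\<^sub>L (id_blinfun + E l)"
        using on_orbit(2)[of l] orbit[of l] E'[of l] by (simp add: orbit_deriv_def)
      with Suc show ?case by (simp add: blinfun_compose_id_right)
    qed simp
    then have ev: "complexified_eigenvalue (bderiv (chart_map (cover_chart p) \<circ> (h ^^ n) \<circ> chart_inv (cover_chart p))
        (chart_map (cover_chart p) p)) z"
      using z bderiv_funpow[OF C1, of n p] hp unfolding n_def by simp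
    note C1n = C1_map_funpow[OF C1, of n]
    show ?thesis
    proof (cases "p \<in> sinks A h")
      case True
      have "complex_eigenvalue (tangent_space A p) (return_derivative A h p) z"
        unfolding return_derivative_def per
        by (rule complex_eigenvalue_of_coords[OF C1n hp cover_chart_in_charts_at ev])
      then have "cmod z < 1" using True by (auto simp: sinks_def periodic_eigenvalues_def)
      then show ?thesis by simp
    next
      case False
      have "cmod z \<le> tangent_opnorm A g p p (return_derivative A h p)"
        unfolding return_derivative_def per
        by (rule eigenvalue_le_opnorm[OF g C1n hp cover_chart_in_charts_at ev])
      also have "\<dots> \<le> C" using bound[OF h] False p_per by (simp add: nonsink_periodic_points_def)
      finally show ?thesis by simp
    qed
  qed
  with \<epsilon>(1) show ?thesis by blast
qed

end

section \<open>Nonlinear orbits near a contracting orbit\<close>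

text \<open>The nonlinear remainder is pulled back through the derivative at \<open>y\<close>. The
  result is small against \<open>z - y\<close>, so \<open>ex_blinfun_maps_to\<close> makes it a
  perturbation applied before the derivative.\<close>

lemma ex_local_linearization:
  fixes H :: "'b::euclidean_space \<Rightarrow> 'b" and B :: "'b \<Rightarrow>\<^sub>L 'b"
  assumes H: "C1_at H a" and B: "B o\<^sub>L bderiv H a = id_blinfun" and "0 < \<epsilon>"
  shows "\<exists>s>0. \<forall>y\<in>ball a s. \<forall>z\<in>ball a s. \<exists>E. norm E \<le> \<epsilon> \<and>
    H z - H y = blinfun_apply (bderiv H y) (blinfun_apply (id_blinfun + E) (z - y))"
proof -
  define k where "k = norm B + 1"
  have k: "0 < k" by (simp add: k_def add_nonneg_pos)
  have lower_a: "norm v \<le> k * norm (bderiv H a v)" for v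
  proof -
    have "v = B (bderiv H a v)" using B by (metis blinfun_apply_blinfun_compose id_blinfun.rep_eq)
    then have "norm v \<le> norm B * norm (bderiv H a v)" by (metis norm_blinfun)
    also have "\<dots> \<le> k * norm (bderiv H a v)" by (intro mult_right_mono) (auto simp: k_def)
    finally show ?thesis .
  qed
  \<comment> \<open>\<open>k * \<eta> \<le> 1/2\<close> keeps the derivatives near \<open>a\<close>
    invertible, with constant \<open>2 * k\<close>; \<open>2 * k * \<eta> \<le> \<epsilon>\<close>
    bounds the pulled back remainder.\<close>
  define \<eta> where "\<eta> = min (1 / (2 * k)) (\<epsilon> / (2 * k))"
  have \<eta>: "0 < \<eta>" "k * \<eta> \<le> 1/2" "2 * k * \<eta> \<le> \<epsilon>"
    using k \<open>0 < \<epsilon>\<close> by (auto simp: \<eta>_def min_def field_simps)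
  obtain s where s: "0 < s" "\<And>y. y \<in> ball a s \<Longrightarrow> norm (bderiv H y - bderiv H a) \<le> \<eta>"
      "\<And>y z. y \<in> ball a s \<Longrightarrow> z \<in> ball a s \<Longrightarrow> norm (H z - H y - bderiv H y (z - y)) \<le> \<eta> * norm (z - y)"
    using C1_at_uniform_approx[OF H \<eta>(1)] by blast
  have "\<exists>E. norm E \<le> \<epsilon> \<and> H z - H y = blinfun_apply (bderiv H y) (blinfun_apply (id_blinfun + E) (z - y))"
    if y: "y \<in> ball a s" and z: "z \<in> ball a s" for y z
  proof -
    let ?D = "blinfun_apply (bderiv H y)"
    have lower: "norm v \<le> 2 * k * norm (?D v)" for v
    proof -
      have "norm (bderiv H a v) \<le> norm (?D v) + norm ((bderiv H y - bderiv H a) v)"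
        using norm_triangle_ineq4[of "?D v" "(bderiv H y - bderiv H a) v"] by (simp add: blinfun.diff_left)
      also have "norm ((bderiv H y - bderiv H a) v) \<le> \<eta> * norm v"
        using norm_blinfun[of "bderiv H y - bderiv H a" v] mult_right_mono[OF s(2)[OF y] norm_ge_zero[of v]] by simp
      finally have "k * norm (bderiv H a v) \<le> k * (norm (?D v) + \<eta> * norm v)"
        using k by (intro mult_left_mono) auto
      then have "norm v \<le> k * norm (?D v) + (k * \<eta>) * norm v"
        using lower_a[of v] by (simp add: algebra_simps)
      also have "(k * \<eta>) * norm v \<le> 1/2 * norm v" using \<eta>(2) by (intro mult_right_mono) auto
      finally show ?thesis by simp
    qed
    have lin: "linear ?D" by (rule bounded_linear.linear[OF blinfun.bounded_linear_right])
    have "inj ?D"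
      unfolding linear_injective_0[OF lin] using lower by (metis mult_zero_right norm_zero norm_le_zero_iff)
    then obtain G where G: "linear G" "G \<circ> ?D = id"
      using linear_injective_left_inverse[OF lin] by blast
    then have DG: "?D (G v) = v" for v using linear_inverse_left[OF G(1) lin] by (metis comp_apply id_apply)
    define e where "e = G (H z - H y - ?D (z - y))"
    have De: "?D e = H z - H y - ?D (z - y)" unfolding e_def by (rule DG)
    have "norm e \<le> 2 * k * norm (?D e)" by (rule lower)
    also have "\<dots> \<le> 2 * k * (\<eta> * norm (z - y))" unfolding De using s(3)[OF y z] k by (intro mult_left_mono) auto
    also have "\<dots> \<le> \<epsilon> * norm (z - y)" using mult_right_mono[OF \<eta>(3) norm_ge_zero[of "z - y"]] by (simp add: mult.assoc)
    finally obtain E :: "'b \<Rightarrow>\<^sub>L 'b" where E: "norm E \<le> \<epsilon>" "blinfun_apply E (z - y) = e"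
      using ex_blinfun_maps_to[of e \<epsilon> "z - y"] \<open>0 < \<epsilon>\<close> by auto
    have "H z - H y = ?D (blinfun_apply (id_blinfun + E) (z - y))"
      using De by (simp add: blinfun.add_left blinfun.add_right E(2))
    with E(1) show ?thesis by blast
  qed
  with s(1) show ?thesis by blast
qed

context atlas_cover
begin

section \<open>Uniform linearisation and contracting points on the manifold\<close>

lemma Diff1_left_inverse_deriv:
  assumes f: "f \<in> Diff1 A" and q: "q \<in> charts_at A x" and q': "q' \<in> charts_at A (f x)"
  shows "\<exists>B. B o\<^sub>L bderiv (chart_map q' \<circ> f \<circ> chart_inv q) (chart_map q x) = id_blinfun"
proof -
  have C1: "C1_map A f" "C1_map A (inv f)" and "inj f" using f by (auto simp: Diff1_def bij_def)
  have qf: "q \<in> charts_at A (inv f (f x))" using q \<open>inj f\<close> by simp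
  have "bderiv (chart_map q \<circ> (inv f \<circ> f) \<circ> chart_inv q) (chart_map q x) =
      bderiv (chart_map q \<circ> inv f \<circ> chart_inv q') (chart_map q' (f x)) o\<^sub>L
      bderiv (chart_map q' \<circ> f \<circ> chart_inv q) (chart_map q x)"
    by (rule bderiv_coords_compose[where h = f, OF q q' C1_map_imp_isCont[OF C1(1)]
      C1_map_imp_C1_at[OF C1(1) q q'] C1_map_imp_C1_at[OF C1(2) q' qf]])
  then show ?thesis using bderiv_coords_id[OF q] by (auto simp: inv_o_cancel[OF \<open>inj f\<close>])
qed

text \<open>The points to which both charts apply form a compact set, and a Lebesgue number of its
  cover by balls of local linearisation is a radius that serves all of them.\<close>

lemma ex_uniform_linearization_in_charts:
  assumes f: "f \<in> Diff1 A" and "0 < \<epsilon>" and q: "q \<in> P" "q' \<in> P"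
  shows "\<exists>r>0. \<forall>x z. x \<in> K q \<longrightarrow> f x \<in> K q' \<longrightarrow> z \<in> chart_dom q \<longrightarrow> norm (chart_map q z - chart_map q x) \<le> r \<longrightarrow>
    f z \<in> chart_dom q' \<and> (\<exists>E. norm E \<le> \<epsilon> \<and> chart_map q' (f z) - chart_map q' (f x) =
      blinfun_apply (bderiv (chart_map q' \<circ> f \<circ> chart_inv q) (chart_map q x))
        (blinfun_apply (id_blinfun + E) (chart_map q z - chart_map q x)))"
proof -
  have C1: "C1_map A f" using f by (simp add: Diff1_def)
  have qA: "q \<in> A" "q' \<in> A" using q cover_subset by auto
  define S where "S = K q \<inter> f -` K q'"
  have "continuous_on UNIV f" using C1 by (simp add: C1_map_def)
  then have "closed (f -` K q')"
    using cover_compact[OF q(2)] by (auto intro: closed_vimage compact_imp_closed)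
  then have "compact S" unfolding S_def using cover_compact[OF q(1)] by (rule compact_Int_closed[rotated])
  moreover have "continuous_on S (chart_map q)"
    using isCont_chart_map[OF qA(1)] cover_in_dom[OF q(1)]
    by (intro continuous_at_imp_continuous_on ballI) (auto simp: S_def)
  ultimately have comp: "compact (chart_map q ` S)" by (rule compact_continuous_image[rotated])
  define H where "H = chart_map q' \<circ> f \<circ> chart_inv q"
  define good where "good = (\<lambda>y z. z \<in> chart_map q ` chart_dom q \<longrightarrow> f (chart_inv q z) \<in> chart_dom q' \<and>
    (\<exists>E. norm E \<le> \<epsilon> \<and> H z - H y = blinfun_apply (bderiv H y) (blinfun_apply (id_blinfun + E) (z - y))))"
  have "\<forall>a\<in>chart_map q ` S. \<exists>s>0. \<forall>y\<in>ball a s. \<forall>z\<in>ball a s. good y z"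
  proof
    fix a assume "a \<in> chart_map q ` S"
    then obtain x where x: "x \<in> S" "a = chart_map q x" by blast
    have qx: "q \<in> charts_at A x" and qfx: "q' \<in> charts_at A (f x)"
      using x(1) cover_charts_at q by (auto simp: S_def)
    obtain B where "B o\<^sub>L bderiv H a = id_blinfun"
      using Diff1_left_inverse_deriv[OF f qx qfx] unfolding H_def x(2) by blast
    moreover have "C1_at H a" unfolding H_def x(2) by (rule C1_map_imp_C1_at[OF C1 qx qfx])
    ultimately obtain s1 where s1: "0 < s1" "\<forall>y\<in>ball a s1. \<forall>z\<in>ball a s1. \<exists>E. norm E \<le> \<epsilon> \<and>
        H z - H y = blinfun_apply (bderiv H y) (blinfun_apply (id_blinfun + E) (z - y))"
      using ex_local_linearization[of H a B \<epsilon>] \<open>0 < \<epsilon>\<close> by blast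
    have "\<forall>\<^sub>F z in nhds x. f z \<in> chart_dom q'"
      using charts_atD[OF qfx] open_chart_dom by (intro isCont_eventually_mem C1_map_imp_isCont[OF C1]) auto
    from eventually_chart_inv[OF qx this] obtain s2 where s2: "0 < s2"
        "\<And>z. z \<in> ball a s2 \<Longrightarrow> f (chart_inv q z) \<in> chart_dom q'"
      unfolding eventually_nhds_metric x(2)[symmetric] by (auto simp: dist_commute)
    show "\<exists>s>0. \<forall>y\<in>ball a s. \<forall>z\<in>ball a s. good y z"
      using s1 s2 unfolding good_def by (intro exI[of _ "min s1 s2"]) auto
  qed
  then obtain s where s: "\<And>a. a \<in> chart_map q ` S \<Longrightarrow> 0 < s a"
      "\<And>a y z. a \<in> chart_map q ` S \<Longrightarrow> y \<in> ball a (s a) \<Longrightarrow> z \<in> ball a (s a) \<Longrightarrow> good y z"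
    by metis
  obtain e where e: "0 < e" "\<And>y. y \<in> chart_map q ` S \<Longrightarrow>
      \<exists>G\<in>(\<lambda>a. ball a (s a)) ` chart_map q ` S. ball y e \<subseteq> G"
  proof (rule Heine_Borel_lemma[OF comp, of "(\<lambda>a. ball a (s a)) ` chart_map q ` S"])
    show "chart_map q ` S \<subseteq> \<Union> ((\<lambda>a. ball a (s a)) ` chart_map q ` S)" using s(1) by auto
  qed auto
  have "f z \<in> chart_dom q' \<and> (\<exists>E. norm E \<le> \<epsilon> \<and> chart_map q' (f z) - chart_map q' (f x) =
      blinfun_apply (bderiv (chart_map q' \<circ> f \<circ> chart_inv q) (chart_map q x))
        (blinfun_apply (id_blinfun + E) (chart_map q z - chart_map q x)))"
    if x: "x \<in> K q" "f x \<in> K q'" and z: "z \<in> chart_dom q" "norm (chart_map q z - chart_map q x) \<le> e/2" for x z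
  proof -
    have xS: "x \<in> S" and xd: "x \<in> chart_dom q" using x cover_in_dom[OF q(1)] by (auto simp: S_def)
    then obtain a where a: "a \<in> chart_map q ` S" "ball (chart_map q x) e \<subseteq> ball a (s a)"
      using e(2)[of "chart_map q x"] by blast
    have "chart_map q x \<in> ball (chart_map q x) e" "chart_map q z \<in> ball (chart_map q x) e"
      using e(1) z(2) by (auto simp: dist_norm norm_minus_commute)
    then have "good (chart_map q x) (chart_map q z)" using s(2)[OF a(1)] a(2) by blast
    then show ?thesis using z(1) xd qA(1) unfolding good_def by (simp add: H_def)
  qed
  \<comment> \<open>Half the Lebesgue number, since the condition on the radius is not
    strict.\<close>
  then show ?thesis using e(1) by (intro exI[of _ "e/2"]) auto
qed

text \<open>The domain condition is carried along because \<open>chart_map\<close> is arbitrary off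
  the chart domain, where a small coordinate difference means nothing.\<close>

definition linearized_within :: "('a \<Rightarrow> 'a) \<Rightarrow> real \<Rightarrow> real \<Rightarrow> bool" where
  "linearized_within f \<epsilon> r \<longleftrightarrow> (\<forall>x z. z \<in> chart_dom (cover_chart x) \<longrightarrow>
    norm (chart_map (cover_chart x) z - chart_map (cover_chart x) x) \<le> r \<longrightarrow>
    f z \<in> chart_dom (cover_chart (f x)) \<and> (\<exists>E. norm E \<le> \<epsilon> \<and>
      chart_map (cover_chart (f x)) (f z) - chart_map (cover_chart (f x)) (f x) =
      blinfun_apply (cover_deriv f x) (blinfun_apply (id_blinfun + E)
        (chart_map (cover_chart x) z - chart_map (cover_chart x) x))))"

lemma ex_uniform_linearization:
  assumes f: "f \<in> Diff1 A" and "0 < \<epsilon>"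
  shows "\<exists>r>0. linearized_within f \<epsilon> r"
proof -
  define good where "good = (\<lambda>r q q'. \<forall>x z. x \<in> K q \<longrightarrow> f x \<in> K q' \<longrightarrow> z \<in> chart_dom q \<longrightarrow>
    norm (chart_map q z - chart_map q x) \<le> r \<longrightarrow>
    f z \<in> chart_dom q' \<and> (\<exists>E. norm E \<le> \<epsilon> \<and> chart_map q' (f z) - chart_map q' (f x) =
      blinfun_apply (bderiv (chart_map q' \<circ> f \<circ> chart_inv q) (chart_map q x))
        (blinfun_apply (id_blinfun + E) (chart_map q z - chart_map q x))))"
  have "\<forall>t\<in>P \<times> P. \<exists>r>0. good r (fst t) (snd t)"
    using ex_uniform_linearization_in_charts[OF assms] unfolding good_def by auto
  then obtain r where r: "\<And>t. t \<in> P \<times> P \<Longrightarrow> 0 < r t" "\<And>t. t \<in> P \<times> P \<Longrightarrow> good (r t) (fst t) (snd t)"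
    by metis
  define r' where "r' = Min (r ` (P \<times> P))"
  have fin: "finite (r ` (P \<times> P))" "r ` (P \<times> P) \<noteq> {}" using finite_cover cover_chart(1) by auto
  have "0 < r'" using fin r(1) by (simp add: r'_def)
  moreover have "r' \<le> r t" if "t \<in> P \<times> P" for t using fin that by (simp add: r'_def)
  ultimately show ?thesis
    unfolding linearized_within_def
  proof (intro exI[of _ r'] conjI allI impI)
    fix x z
    assume le: "\<And>t. t \<in> P \<times> P \<Longrightarrow> r' \<le> r t" and z: "z \<in> chart_dom (cover_chart x)"
      "norm (chart_map (cover_chart x) z - chart_map (cover_chart x) x) \<le> r'"
    let ?t = "(cover_chart x, cover_chart (f x))"
    have t: "?t \<in> P \<times> P" using cover_chart(1) by simp
    have "norm (chart_map (cover_chart x) z - chart_map (cover_chart x) x) \<le> r ?t"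
      using z(2) le[OF t] by simp
    then have concl: "f z \<in> chart_dom (cover_chart (f x)) \<and> (\<exists>E. norm E \<le> \<epsilon> \<and>
      chart_map (cover_chart (f x)) (f z) - chart_map (cover_chart (f x)) (f x) =
      blinfun_apply (cover_deriv f x) (blinfun_apply (id_blinfun + E)
        (chart_map (cover_chart x) z - chart_map (cover_chart x) x)))"
      using r(2)[OF t] z(1) cover_chart_in_K unfolding good_def cover_deriv_def fst_conv snd_conv by blast
    then show "f z \<in> chart_dom (cover_chart (f x))" by blast
    from concl show "\<exists>E. norm E \<le> \<epsilon> \<and>
      chart_map (cover_chart (f x)) (f z) - chart_map (cover_chart (f x)) (f x) =
      blinfun_apply (cover_deriv f x) (blinfun_apply (id_blinfun + E)
        (chart_map (cover_chart x) z - chart_map (cover_chart x) x))" by blast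
  qed auto
qed

text \<open>The bound is the one delivered by \<open>ex_contracting_time\<close>. Its constants do
  not involve the period of \<open>y\<close>, so the neighbourhood that \<open>y\<close> attracts
  has a size common to all such points.\<close>

definition contracting_point :: "('a \<Rightarrow> 'a) \<Rightarrow> real \<Rightarrow> real \<Rightarrow> 'a \<Rightarrow> bool" where
  "contracting_point f \<epsilon> \<theta> y \<longleftrightarrow> (\<forall>l E. (\<forall>i. norm (E i) \<le> \<epsilon>) \<longrightarrow>
     \<epsilon> / (1 + \<epsilon>) * norm (perturbed_product (orbit_deriv f y) E 0 l) \<le> \<theta> ^ l)"

text \<open>As long as the orbit of \<open>z\<close> stays close to that of \<open>y\<close>, the difference evolves by a
  perturbed product along the orbit of \<open>y\<close>; since all of these contract, it stays close forever.\<close>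

lemma contracting_point_attracts:
  assumes "0 < \<epsilon>" "0 < \<theta>" "\<theta> < 1" and y: "contracting_point f \<epsilon> \<theta> y"
    and r: "linearized_within f \<epsilon> r"
    and z: "z \<in> chart_dom (cover_chart y)"
      "norm (chart_map (cover_chart y) z - chart_map (cover_chart y) y) \<le> \<epsilon> / (1 + \<epsilon>) * r"
  shows "\<epsilon> / (1 + \<epsilon>) * norm (chart_map (cover_chart ((f ^^ l) y)) ((f ^^ l) z)
      - chart_map (cover_chart ((f ^^ l) y)) ((f ^^ l) y))
    \<le> \<theta> ^ l * norm (chart_map (cover_chart y) z - chart_map (cover_chart y) y)"
proof -
  define c where "c = \<epsilon> / (1 + \<epsilon>)"
  have c: "0 < c" using assms(1) by (simp add: c_def)
  define v where "v = (\<lambda>l. chart_map (cover_chart ((f ^^ l) y)) ((f ^^ l) z)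
      - chart_map (cover_chart ((f ^^ l) y)) ((f ^^ l) y))"
  have bound: "c * norm (perturbed_product (orbit_deriv f y) E 0 l (v 0)) \<le> \<theta> ^ l * norm (v 0)"
    if "\<forall>i. norm (E i) \<le> \<epsilon>" for E l
  proof -
    have "c * norm (perturbed_product (orbit_deriv f y) E 0 l (v 0)) \<le>
        (c * norm (perturbed_product (orbit_deriv f y) E 0 l)) * norm (v 0)"
      using mult_left_mono[OF norm_blinfun less_imp_le[OF c]] by (simp add: mult.assoc)
    also have "\<dots> \<le> \<theta> ^ l * norm (v 0)"
      using y that unfolding contracting_point_def c_def[symmetric] by (intro mult_right_mono) auto
    finally show ?thesis .
  qed
  have "(f ^^ l) z \<in> chart_dom (cover_chart ((f ^^ l) y)) \<and> (\<exists>E. (\<forall>i. norm (E i) \<le> \<epsilon>) \<and>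
      v l = blinfun_apply (perturbed_product (orbit_deriv f y) E 0 l) (v 0))" for l
  proof (induction l)
    case 0
    then show ?case using z(1) assms(1) by (auto intro!: exI[of _ "\<lambda>_. 0"])
  next
    case (Suc l)
    then obtain E where E: "\<forall>i. norm (E i) \<le> \<epsilon>"
        "v l = blinfun_apply (perturbed_product (orbit_deriv f y) E 0 l) (v 0)" by blast
    \<comment> \<open>The products are bounded by \<open>\<theta> ^ l / c\<close> and the starting
      distance by \<open>c * r\<close>, so the orbit stays within the radius \<open>r\<close> where
      linearisation applies.\<close>
    have "c * norm (v l) \<le> \<theta> ^ l * norm (v 0)" using bound[OF E(1)] E(2) by simp
    also have "\<dots> \<le> 1 * (c * r)"
      using assms(2,3) z(2) by (intro mult_mono) (auto simp: power_le_one v_def c_def)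
    finally have "norm (v l) \<le> r" using c by simp
    then have "f ((f ^^ l) z) \<in> chart_dom (cover_chart (f ((f ^^ l) y)))" and
      "\<exists>F. norm F \<le> \<epsilon> \<and> v (Suc l) = blinfun_apply (orbit_deriv f y l) (blinfun_apply (id_blinfun + F) (v l))"
      using r[unfolded linearized_within_def, rule_format, of "(f ^^ l) z" "(f ^^ l) y"] Suc
      unfolding v_def orbit_deriv_def by auto
    then obtain F where F: "norm F \<le> \<epsilon>"
        "v (Suc l) = blinfun_apply (orbit_deriv f y l) (blinfun_apply (id_blinfun + F) (v l))" by blast
    \<comment> \<open>Changing \<open>E\<close> at time \<open>l\<close> leaves the product of the
      first \<open>l\<close> factors alone and supplies the next one.\<close>
    define E' where "E' = E(l := F)"
    have "perturbed_product (orbit_deriv f y) E' 0 l = perturbed_product (orbit_deriv f y) E 0 l"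
      by (rule perturbed_product_cong) (auto simp: E'_def)
    then have "v (Suc l) = blinfun_apply (perturbed_product (orbit_deriv f y) E' 0 (Suc l)) (v 0)"
      using F(2) E(2) by (simp add: E'_def)
    moreover have "\<forall>i. norm (E' i) \<le> \<epsilon>" using E(1) F(1) by (simp add: E'_def)
    ultimately show ?case using \<open>f ((f ^^ l) z) \<in> _\<close> by auto
  qed
  then obtain E where "\<forall>i. norm (E i) \<le> \<epsilon>"
    "v l = blinfun_apply (perturbed_product (orbit_deriv f y) E 0 l) (v 0)" by blast
  then have "c * norm (v l) \<le> \<theta> ^ l * norm (v 0)" using bound by simp
  then show ?thesis by (simp add: v_def c_def)
qed

text \<open>At multiples of a common return time both points are back where they started, so their
  coordinate difference is unchanged, while contraction bounds it by a null sequence.\<close>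

lemma contracting_periodic_point_isolated:
  assumes "0 < \<epsilon>" "0 < \<theta>" "\<theta> < 1" and y: "contracting_point f \<epsilon> \<theta> y"
    and r: "linearized_within f \<epsilon> r"
    and per: "y \<in> periodic_points f" "z \<in> periodic_points f"
    and z: "z \<in> chart_dom (cover_chart y)"
      "norm (chart_map (cover_chart y) z - chart_map (cover_chart y) y) \<le> \<epsilon> / (1 + \<epsilon>) * r"
  shows "chart_map (cover_chart y) z = chart_map (cover_chart y) y"
proof -
  define m where "m = period f y * period f z"
  define w where "w = chart_map (cover_chart y) z - chart_map (cover_chart y) y"
  have m: "0 < m" "(f ^^ m) y = y" "(f ^^ m) z = z"
    using periodD[OF per(1)] periodD[OF per(2)] funpow_periodic_multiple[of "period f y" f y "period f z"]
      funpow_periodic_multiple[of "period f z" f z "period f y"]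
    by (auto simp: m_def mult.commute)
  have "\<epsilon> / (1 + \<epsilon>) * norm w \<le> (\<theta> ^ m) ^ t * norm w" for t
    using contracting_point_attracts[OF assms(1-4) r z, of "t * m"]
      funpow_periodic_multiple[OF m(2), of t] funpow_periodic_multiple[OF m(3), of t]
    by (simp add: w_def power_mult[symmetric] mult.commute)
  moreover have "(\<lambda>t. (\<theta> ^ m) ^ t * norm w) \<longlonglongrightarrow> 0 * norm w"
    using assms(2,3) m(1) by (intro tendsto_mult tendsto_const LIMSEQ_realpow_zero) (auto simp: power_less_one_iff)
  ultimately have "\<epsilon> / (1 + \<epsilon>) * norm w \<le> 0"
    using LIMSEQ_le_const[of _ "0 * norm w" "\<epsilon> / (1 + \<epsilon>) * norm w"] by auto
  then have "norm w = 0" using assms(1) by (simp add: mult_le_0_iff divide_le_0_iff)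
  then show ?thesis by (simp add: w_def)
qed

text \<open>Sorted by their chart, the points have coordinates in a compact set, and distinct
  coordinates are at least \<open>\<epsilon> / (1 + \<epsilon>) * r\<close> apart; a bounded
  uniformly discrete set is finite.\<close>

lemma finite_contracting_periodic_points:
  assumes f: "f \<in> Diff1 A" and "0 < \<epsilon>" "0 < \<theta>" "\<theta> < 1"
  shows "finite {y \<in> periodic_points f. contracting_point f \<epsilon> \<theta> y}" (is "finite ?G")
proof -
  obtain r where "0 < r" and r: "linearized_within f \<epsilon> r"
    using ex_uniform_linearization[OF f \<open>0 < \<epsilon>\<close>] by blast
  have "finite {y \<in> ?G. cover_chart y = q}" if q: "q \<in> P" for q
  proof -
    let ?Gq = "{y \<in> ?G. cover_chart y = q}"
    have in_K: "?Gq \<subseteq> K q" using cover_chart_in_K by blast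
    then have "chart_map q ` ?Gq \<subseteq> chart_map q ` K q" by blast
    moreover have "compact (chart_map q ` K q)"
      using cover_compact[OF q] isCont_chart_map cover_charts_at[OF q] charts_atD
      by (intro compact_continuous_image continuous_at_imp_continuous_on ballI) metis+
    ultimately have "bounded (chart_map q ` ?Gq)" by (meson bounded_subset compact_imp_bounded)
    moreover have "uniform_discrete (chart_map q ` ?Gq)"
      unfolding uniform_discrete_def
    proof (intro exI[of _ "\<epsilon> / (1 + \<epsilon>) * r"] conjI ballI impI)
      show "0 < \<epsilon> / (1 + \<epsilon>) * r" using \<open>0 < \<epsilon>\<close> \<open>0 < r\<close> by simp
      fix a b assume "a \<in> chart_map q ` ?Gq" "b \<in> chart_map q ` ?Gq" and ab: "dist a b < \<epsilon> / (1 + \<epsilon>) * r"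
      then obtain y z where y: "y \<in> ?Gq" "a = chart_map q y" and z: "z \<in> ?Gq" "b = chart_map q z" by blast
      have "z \<in> chart_dom q" using z in_K cover_in_dom[OF q] by blast
      then show "a = b"
        using contracting_periodic_point_isolated[OF assms(2-4) _ r, of y z] y z ab
        by (auto simp: dist_norm norm_minus_commute)
    qed
    ultimately have "finite (chart_map q ` ?Gq)" using uniform_discrete_finite_iff by blast
    moreover have "inj_on (chart_map q) ?Gq"
      using in_K cover_in_dom[OF q] cover_subset q
      by (intro inj_on_inverseI[where g = "chart_inv q"]) (auto intro!: chart_inv_map)
    ultimately show ?thesis by (rule finite_imageD)
  qed
  then have "finite (\<Union>q\<in>P. {y \<in> ?G. cover_chart y = q})" using finite_cover by simp
  moreover have "?G \<subseteq> (\<Union>q\<in>P. {y \<in> ?G. cover_chart y = q})" using cover_chart(1) by blast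
  ultimately show ?thesis by (rule finite_subset[rotated])
qed

lemma ex_contracting_point_on_long_orbits:
  assumes f: "f \<in> Diff1 A" and "0 < \<epsilon>0" and eig: "\<forall>p\<in>periodic_points f. \<forall>E z. (\<forall>i. norm (E i) \<le> \<epsilon>0) \<longrightarrow>
      complexified_eigenvalue (perturbed_product (orbit_deriv f p) E 0 (period f p)) z \<longrightarrow> cmod z \<le> C"
  shows "\<exists>\<epsilon> \<theta> N. 0 < \<epsilon> \<and> 0 < \<theta> \<and> \<theta> < 1 \<and> (\<forall>p\<in>periodic_points f. N \<le> period f p \<longrightarrow>
    (\<exists>j. contracting_point f \<epsilon> \<theta> ((f ^^ j) p)))"
proof -
  have inj: "inj f" using f by (simp add: Diff1_def bij_def)
  \<comment> \<open>\<open>perturbed_product_norm_decay\<close> asks for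
    \<open>\<epsilon> \<le> 1\<close> and for eigenvalue bounds under perturbations of size
    \<open>3 * \<epsilon>\<close>.\<close>
  define \<epsilon> where "\<epsilon> = min 1 (\<epsilon>0 / 3)"
  have \<epsilon>: "0 < \<epsilon>" "\<epsilon> \<le> 1" "3 * \<epsilon> \<le> \<epsilon>0" using \<open>0 < \<epsilon>0\<close> by (auto simp: \<epsilon>_def)
  \<comment> \<open>Products over a period are bounded by \<open>B / (1 + \<epsilon>) ^ n\<close>,
    that is, by \<open>B * \<theta> ^ (2 * n)\<close>; one factor \<open>\<theta> ^ n\<close>
    absorbs \<open>B\<close> as soon as \<open>N \<le> n\<close>.\<close>
  define \<theta> where "\<theta> = 1 / sqrt (1 + \<epsilon>)"
  have \<theta>: "0 < \<theta>" "\<theta> < 1" using \<epsilon>(1) by (auto simp: \<theta>_def)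
  have \<theta>2: "\<theta> * \<theta> * (1 + \<epsilon>) = 1" using \<epsilon>(1) by (simp add: \<theta>_def)
  define B where "B = (2 * real DIM('b) * C / (3 * \<epsilon>)) * (1 + 3 * \<epsilon>)"
  have "(\<lambda>n. \<theta> ^ n * B) \<longlonglongrightarrow> 0 * B"
    using \<theta> by (intro tendsto_mult tendsto_const LIMSEQ_realpow_zero) auto
  then have "\<forall>\<^sub>F n in sequentially. \<theta> ^ n * B < 1" by (rule order_tendstoD(2)) simp
  then obtain N where N: "\<And>n. N \<le> n \<Longrightarrow> \<theta> ^ n * B < 1" unfolding eventually_sequentially by blast
  have "\<exists>j. contracting_point f \<epsilon> \<theta> ((f ^^ j) p)" if p: "p \<in> periodic_points f" and n: "N \<le> period f p" for p
  proof -
    define n where "n = period f p"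
    have "0 < n" using periodD(1)[OF p] by (simp add: n_def)
    have "norm (perturbed_product (orbit_deriv f p) E j n) \<le> \<theta> ^ n" if E: "\<And>i. norm (E i) \<le> \<epsilon>" for j E
    proof -
      have "(1 + \<epsilon>) ^ n * norm (perturbed_product (orbit_deriv f p) E j n) \<le> B"
        unfolding B_def
      proof (rule perturbed_product_norm_decay[OF \<epsilon>(1,2) \<open>0 < n\<close> _ E])
        fix E' :: "nat \<Rightarrow> 'b \<Rightarrow>\<^sub>L 'b" and z
        assume E': "\<And>i. norm (E' i) \<le> 3 * \<epsilon>"
          and ev: "complexified_eigenvalue (perturbed_product (orbit_deriv f p) E' j n) z"
        \<comment> \<open>A product started at time \<open>j\<close> is one started at time 0 from
          \<open>(f ^^ j) p\<close>, a point of the same period; \<open>0 + j\<close> has the shape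
          of \<open>perturbed_product_shift\<close>.\<close>
        have "perturbed_product (orbit_deriv f p) E' (0 + j) n =
            perturbed_product (orbit_deriv f ((f ^^ j) p)) (\<lambda>i. E' (i + j)) 0 n"
          unfolding perturbed_product_shift orbit_deriv_shift ..
        moreover have "norm (E' (i + j)) \<le> \<epsilon>0" for i using E'[of "i + j"] \<epsilon>(3) by simp
        moreover have "(f ^^ j) p \<in> periodic_points f" "period f ((f ^^ j) p) = n"
          using funpow_in_periodic_points[OF inj p] period_funpow[OF inj p] by (simp_all add: n_def)
        ultimately show "cmod z \<le> C"
          using eig[rule_format, of "(f ^^ j) p" "\<lambda>i. E' (i + j)" z] ev by simp
      qed
      then have "(\<theta> ^ n * \<theta> ^ n) * ((1 + \<epsilon>) ^ n * norm (perturbed_product (orbit_deriv f p) E j n))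
          \<le> (\<theta> ^ n * \<theta> ^ n) * B"
        using \<theta>(1) by (intro mult_left_mono) auto
      also have "\<dots> \<le> \<theta> ^ n * 1"
        using N[OF n] \<theta>(1) unfolding mult.assoc by (intro mult_left_mono) (auto simp: n_def)
      finally have "(\<theta> ^ n * \<theta> ^ n * (1 + \<epsilon>) ^ n) * norm (perturbed_product (orbit_deriv f p) E j n) \<le> \<theta> ^ n"
        by (simp add: mult.assoc)
      then show ?thesis by (simp add: \<theta>2 flip: power_mult_distrib)
    qed
    from ex_contracting_time[OF \<epsilon>(1) \<theta>(1) \<open>0 < n\<close> this] obtain j where
      j: "\<And>l E. \<forall>i. norm (E i) \<le> \<epsilon> \<Longrightarrow>
        \<epsilon> / (1 + \<epsilon>) * norm (perturbed_product (orbit_deriv f p) E j l) \<le> \<theta> ^ l"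
      by blast
    have "contracting_point f \<epsilon> \<theta> ((f ^^ j) p)"
      unfolding contracting_point_def
    proof (intro allI impI)
      fix l and E :: "nat \<Rightarrow> 'b \<Rightarrow>\<^sub>L 'b" assume E: "\<forall>i. norm (E i) \<le> \<epsilon>"
      \<comment> \<open>Shifting \<open>E (i - j)\<close> by \<open>j\<close> returns
        \<open>E\<close>; the truncated subtraction at times below \<open>j\<close> does no harm, as
        the product starts at \<open>j\<close>.\<close>
      have "perturbed_product (orbit_deriv f p) (\<lambda>i. E (i - j)) (0 + j) l =
          perturbed_product (orbit_deriv f ((f ^^ j) p)) E 0 l"
        unfolding perturbed_product_shift orbit_deriv_shift by simp
      then show "\<epsilon> / (1 + \<epsilon>) * norm (perturbed_product (orbit_deriv f ((f ^^ j) p)) E 0 l) \<le> \<theta> ^ l"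
        using j[of "\<lambda>i. E (i - j)" l] E by simp
    qed
    then show ?thesis by blast
  qed
  then show ?thesis using \<epsilon>(1) \<theta> by blast
qed

text \<open>Periods below \<open>N\<close> are left to \<open>fin\<close>. Every other periodic
  point lies on the orbit of a contracting one, and finitely many finite orbits make a finite
  set.\<close>

lemma finite_periodic_points_if_eigenvalues_bounded:
  assumes f: "f \<in> Diff1 A" and fin: "\<And>n. 0 < n \<Longrightarrow> finite {p \<in> periodic_points f. period f p = n}"
    and "0 < \<epsilon>0" and eig: "\<forall>p\<in>periodic_points f. \<forall>E z. (\<forall>i. norm (E i) \<le> \<epsilon>0) \<longrightarrow>
      complexified_eigenvalue (perturbed_product (orbit_deriv f p) E 0 (period f p)) z \<longrightarrow> cmod z \<le> C"
  shows "finite (periodic_points f)"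
proof -
  have inj: "inj f" using f by (simp add: Diff1_def bij_def)
  obtain \<epsilon> \<theta> N where \<epsilon>: "0 < \<epsilon>" "0 < \<theta>" "\<theta> < 1" and long: "\<And>p. p \<in> periodic_points f \<Longrightarrow> N \<le> period f p \<Longrightarrow>
      \<exists>j. contracting_point f \<epsilon> \<theta> ((f ^^ j) p)"
    using ex_contracting_point_on_long_orbits[OF f \<open>0 < \<epsilon>0\<close> eig] by blast
  let ?G = "{y \<in> periodic_points f. contracting_point f \<epsilon> \<theta> y}"
  let ?short = "\<Union>n\<in>{0<..<N}. {p \<in> periodic_points f. period f p = n}"
  let ?long = "\<Union>y\<in>?G. (\<lambda>i. (f ^^ i) y) ` {..<period f y}"
  have "p \<in> ?short \<union> ?long" if p: "p \<in> periodic_points f" for p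
  proof (cases "N \<le> period f p")
    case True
    obtain j where j: "contracting_point f \<epsilon> \<theta> ((f ^^ j) p)" using long[OF p True] by blast
    define n where "n = period f p"
    note n = periodD(1,2)[OF p, folded n_def]
    let ?y = "(f ^^ j) p"
    have y: "?y \<in> periodic_points f" "period f ?y = n"
      using funpow_in_periodic_points[OF inj p] period_funpow[OF inj p] by (simp_all add: n_def)
    \<comment> \<open>The time left to reach a multiple of \<open>n\<close>; the outer
      \<open>mod\<close> gives 0 instead of \<open>n\<close> when \<open>n\<close> divides
      \<open>j\<close>.\<close>
    define i where "i = (n - j mod n) mod n"
    have "(f ^^ i) ?y = (f ^^ (i + j)) p" by (simp add: funpow_add)
    moreover have "n dvd i + j"
    proof -
      have "(i + j) mod n = ((n - j mod n) + j mod n) mod n" by (simp add: i_def mod_simps)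
      also have "\<dots> = 0" using mod_less_divisor[OF n(1), of j] by simp
      finally show ?thesis by (rule dvd_eq_mod_eq_0[THEN iffD2])
    qed
    ultimately have "(f ^^ i) ?y = p"
      using funpow_periodic_multiple[OF n(2)] by (metis dvd_def mult.commute)
    moreover have "i < period f ?y" using n(1) y(2) by (simp add: i_def)
    ultimately show ?thesis using y(1) j by force
  next
    case False
    then show ?thesis using p periodD(1)[OF p] by auto
  qed
  moreover have "finite (?short \<union> ?long)"
    using fin finite_contracting_periodic_points[OF f \<epsilon>] by auto
  ultimately show ?thesis by (meson finite_subset subsetI)
qed

end

theorem corollary1p6:
  fixes A :: "('a::{t2_space, second_countable_topology}, 'b::euclidean_space) chart set"
    and g :: "'a \<Rightarrow> ('a, 'b) tangent \<Rightarrow> ('a, 'b) tangent \<Rightarrow> real"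
    and f :: "'a \<Rightarrow> 'a"
  assumes "closed_manifold A"
    and "riemannian_metric A g"
    and "f \<in> Diff1 A"
    and "\<forall>n>0. finite {p \<in> periodic_points f. period f p = n}"
    and "\<exists>\<U>. \<U> \<subseteq> Diff1 A \<and> (\<exists>V. openin (Diff1_topology A) V \<and> f \<in> V \<and> V \<subseteq> \<U>) \<and>
           Sup {ereal (tangent_opnorm A g q q (return_derivative A h q)) | h q.
                  h \<in> \<U> \<and> q \<in> nonsink_periodic_points A h} < \<infinity>"
  shows "finite (periodic_points f)"
proof -
  have atlas: "smooth_atlas A" "compact (UNIV :: 'a set)"
    using assms(1) by (auto simp: closed_manifold_def)
  obtain P K where "atlas_cover A P K" using ex_atlas_cover[OF atlas] by blast
  then interpret atlas_cover A P K .
  obtain \<U> V where V: "openin (Diff1_topology A) V" "f \<in> V" "V \<subseteq> \<U>"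
    and sup: "Sup {ereal (tangent_opnorm A g q q (return_derivative A h q)) | h q.
                  h \<in> \<U> \<and> q \<in> nonsink_periodic_points A h} < \<infinity>" (is "Sup ?S < \<infinity>")
    using assms(5) by blast
  \<comment> \<open>The supremum may be \<open>-\<infinity>\<close>, when no map in \<U> has a
    periodic point that is not a sink; a real strict upper bound exists in either case.\<close>
  obtain C where C: "Sup ?S < ereal C" using less_PInf_Ex_of_nat[of "Sup ?S"] sup by auto
  have "tangent_opnorm A g q q (return_derivative A h q) \<le> C"
    if "h \<in> V" "q \<in> nonsink_periodic_points A h" for h q
  proof -
    have "ereal (tangent_opnorm A g q q (return_derivative A h q)) \<le> Sup ?S"
      using that V(3) by (intro Sup_upper) blast
    then have "ereal (tangent_opnorm A g q q (return_derivative A h q)) < ereal C"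
      using C by (rule le_less_trans)
    then show ?thesis by simp
  qed
  from eigenvalue_bound_along_orbits[OF assms(2,3) V(1,2) this]
  obtain \<epsilon> where "0 < \<epsilon>" and eig: "\<forall>p\<in>periodic_points f. \<forall>E z. (\<forall>i. norm (E i) \<le> \<epsilon>) \<longrightarrow>
      complexified_eigenvalue (perturbed_product (orbit_deriv f p) E 0 (period f p)) z \<longrightarrow> cmod z \<le> max 1 C"
    by blast
  show ?thesis
    using finite_periodic_points_if_eigenvalues_bounded[OF assms(3) _ \<open>0 < \<epsilon>\<close> eig] assms(4) by blast
qed

end
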